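(* Let $A$ satisfy the weak correlation assumption (stated in the context). Let $\rho\in[-1,1]$ and $\beta=\sigma+i\tau\in B_1$, and let $\widehat{\mathcal{M}}_{\sigma_b\sigma,\sigma_b\tau}$ be the coupled realization (defined in the context) of the martingale limit $\mathcal{M}_{\sigma_b\sigma,\sigma_b\tau}$. Then $$e^{-t\left(1+i\rho\sigma\tau+\frac{\sigma^2-\tau^2}{2}\right)}\,\mathcal{X}_{\beta,\rho}(t)\longrightarrow\widehat{\mathcal{M}}_{\sigma_b\sigma,\sigma_b\tau}\qquad\text{as }t\uparrow\infty,$$ in probability.
   Context: Tree. Let $(p_k)_{k\ge1}$ be a probability distribution on $\{1,2,\dots\}$ with $\sum_k k p_k=2$ and $K:=\sum_k k(k-1)p_k<\infty$. Consider the continuous-time Galton-Watson process started from one particle, in which each particle independently lives an exponential time of rate 1 and is then replaced by $k$ particles with probability $p_k$. Let $n(t)$ be the number of particles alive at time $t$ (so $\mathbb{E}[n(t)]=e^t$), labelled $1,\dots,n(t)$. For $k,l\le n(t)$ let $d(k,l)\in[0,t]$ be the time of their most recent common ancestor ($d(k,k)=t$). Weak correlation assumption. $A:[0,1]\to[0,1]$ is right-continuous, non-decreasing, and: (A1) $A(0)=0$, $A(1)=1$, $A(x)<x$ for all $x\in(0,1)$. (A2) There are $\delta_b>0$ and functions $\underline B,\overline B:[0,1]\to[0,1]$, twice differentiable on $[0,\delta_b]$ with bounded second derivatives, with $\underline B\le A\le\overline B$ on $[0,\delta_b]$ and $\overline B'(0)=\underline B'(0)\equiv A'(0)\equiv\sigma_b^2$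 ($\sigma_b\ge0$). (A3) There are $\delta_e>0$ and functions $\underline C,\overline C:[0,1]\to[0,1]$, twice differentiable on $[1-\delta_e,1]$ with bounded second derivatives, with $\underline C\le A\le\overline C$ on $[1-\delta_e,1]$ and $\overline C'(1)=\underline C'(1)\equiv A'(1)\equiv\sigma_e^2$; the case $A'(1)=+\infty$ is allowed, meaning that for every $R<\infty$ there is $\varepsilon>0$ with $A(x)\le1-R(1-x)$ for all $x\in[1-\varepsilon,1]$. CREM. For time horizon $t$, conditionally on the tree, $(x_k(s))_{k\le n(t),s\in[0,t]}$ and $(z_k(s))_{k\le n(t),s\in[0,t]}$ are independent centered Gaussian processes, each with covariance $\mathbb{E}[x_k(s)x_l(s')]=tA(\min(s,s',d(k,l))/t)$. Set $y_k:=\rho x_k+\sqrt{1-\rho^2}\,z_k$, so $\mathrm{Cov}(x_k(t),y_k(t))=\rho t$. The partition function is $\mathcal{X}_{\beta,\rho}(t):=\sum_{k=1}^{n(t)}e^{\sigma x_k(t)+i\tau y_k(t)}$. Phase. $B_1:=\mathbb{C}\setminus\overline{B_2\cup B_3}$ with $B_2:=\{\sigma+i\tau:2\sigma^2>1,\ |\sigma|+|\tau|>\sqrt2\}$, $B_3:=\{\sigma+i\tau:2\sigma^2<1,\ \sigma^2+\tau^2>1\}$. Martingale. Let $\tilde x,\tilde z$ be two standard branching Brownian motions (the case $A(x)=x$) on the same Galton-Watson tree (run for all times), conditionally independent given the tree, and $\tilde y_k:=\rho\tilde x_k+\sqrt{1-\rho^2}\,\tilde z_k$. For real $\sigma,\tau$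 put $$\mathcal{M}_{\sigma,\tau}(r):=\sum_{k=1}^{n(r)}e^{-r\left(1+i\rho\sigma\tau+\frac{\sigma^2-\tau^2}{2}\right)}e^{\sigma\tilde x_k(r)+i\tau\tilde y_k(r)}.$$ It is known that for $\sigma+i\tau\in B_1$ the limit $\mathcal{M}_{\sigma,\tau}:=\lim_{r\uparrow\infty}\mathcal{M}_{\sigma,\tau}(r)$ exists a.s. and in $L^1$ and is non-degenerate. Coupling. The CREM and the standard BBMs are built on the same tree from the same edge Gaussians: for horizon $t$, truncate the tree at time $t$; for an edge $e$ (a particle's life interval $[a_e,b_e]$, with $b_e$ truncated at $t$) let $G_e,G_e'\sim\mathcal N(0,b_e-a_e)$ be the increments of $\tilde x$ and $\tilde z$ along $e$. Then $x_k(t)$ (resp. $z_k(t)$) is the sum, over the edges $e$ on the ancestral line of $k$, of $\sqrt{\frac{tA(b_e/t)-tA(a_e/t)}{b_e-a_e}}\;G_e$ (resp. with $G_e'$). $\widehat{\mathcal{M}}_{\sigma_b\sigma,\sigma_b\tau}$ denotes the limit $\mathcal{M}_{\sigma_b\sigma,\sigma_b\tau}$ computed from these coupled $\tilde x,\tilde y$. *)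

theory Defs
  imports "HOL-Probability.Probability"
begin

section \<open>Offspring law, correlation function, phase\<close>

definition offspring_law :: "nat pmf \<Rightarrow> bool" where
  "offspring_law p \<longleftrightarrow>
     pmf p 0 = 0 \<and>
     (\<lambda>k. real k * pmf p k) sums 2 \<and>
     summable (\<lambda>k. real k * (real k - 1) * pmf p k)"

definition twice_differentiable_bounded :: "(real \<Rightarrow> real) \<Rightarrow> real set \<Rightarrow> bool" where
  "twice_differentiable_bounded f S \<longleftrightarrow>
     (\<exists>f' f''. (\<forall>x\<in>S. (f has_real_derivative f' x) (at x within S) \<and>
                      (f' has_real_derivative f'' x) (at x within S)) \<and>
              bounded (f'' ` S))"

text \<open>
  Sandwiching of \<open>A\<close> on \<open>S\<close> between twice differentiable functions, all three having the
  derivative \<open>D\<close> at the end point \<open>x0\<close>. The derivative of \<open>A\<close> itself is required explicitly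
  because the bounding functions are not required to agree with \<open>A\<close> at \<open>x0\<close>.
\<close>

definition sandwiched ::
    "(real \<Rightarrow> real) \<Rightarrow> real set \<Rightarrow> real \<Rightarrow> real \<Rightarrow> bool" where
  "sandwiched A S x0 D \<longleftrightarrow>
     (A has_real_derivative D) (at x0 within {0..1}) \<and>
     (\<exists>lo up. lo ` {0..1} \<subseteq> {0..1} \<and> up ` {0..1} \<subseteq> {0..1} \<and>
        twice_differentiable_bounded lo S \<and> twice_differentiable_bounded up S \<and>
        (\<forall>x\<in>S. lo x \<le> A x \<and> A x \<le> up x) \<and>
        (lo has_real_derivative D) (at x0 within S) \<and>
        (up has_real_derivative D) (at x0 within S))"

definition infinite_slope_at_1 :: "(real \<Rightarrow> real) \<Rightarrow> bool" where
  "infinite_slope_at_1 A \<longleftrightarrow>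
     (\<forall>R. \<exists>\<epsilon>. 0 < \<epsilon> \<and> \<epsilon> \<le> 1 \<and> (\<forall>x\<in>{1-\<epsilon>..1}. A x \<le> 1 - R * (1 - x)))"

text \<open>Only the values of \<open>A\<close> on \<open>[0,1]\<close> matter.\<close>

definition weak_correlation :: "(real \<Rightarrow> real) \<Rightarrow> real \<Rightarrow> bool" where
  "weak_correlation A \<sigma>\<^sub>b \<longleftrightarrow>
     A ` {0..1} \<subseteq> {0..1} \<and>
     mono_on {0..1} A \<and>
     (\<forall>x\<in>{0..<1}. continuous (at_right x) A) \<and>
     A 0 = 0 \<and> A 1 = 1 \<and> (\<forall>x\<in>{0<..<1}. A x < x) \<and>
     0 \<le> \<sigma>\<^sub>b \<and>
     (\<exists>\<delta>. 0 < \<delta> \<and> \<delta> \<le> 1 \<and> sandwiched A {0..\<delta>} 0 (\<sigma>\<^sub>b\<^sup>2)) \<and>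
     ((\<exists>\<delta> \<sigma>\<^sub>e. 0 < \<delta> \<and> \<delta> \<le> 1 \<and> sandwiched A {1-\<delta>..1} 1 (\<sigma>\<^sub>e\<^sup>2)) \<or> infinite_slope_at_1 A)"

definition B2 :: "complex set" where
  "B2 = {z. 2 * (Re z)\<^sup>2 > 1 \<and> \<bar>Re z\<bar> + \<bar>Im z\<bar> > sqrt 2}"

definition B3 :: "complex set" where
  "B3 = {z. 2 * (Re z)\<^sup>2 < 1 \<and> (Re z)\<^sup>2 + (Im z)\<^sup>2 > 1}"

definition B1 :: "complex set" where
  "B1 = UNIV - closure (B2 \<union> B3)"


section \<open>Realizations of the tree and of the processes on it\<close>

text \<open>
  Particles carry Ulam-Harris labels: \<open>[]\<close> is the initial particle and \<open>u @ [j]\<close> is the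
  \<open>j\<close>-th child (counted from \<open>0\<close>) of \<open>u\<close>. A realization of the tree is given by the lifetime
  \<open>L u\<close> and the number of children \<open>N u\<close> of every label; those of labels that do not
  occur in the tree are never used. Labels are identified with edges, the edge of \<open>u\<close> being
  its life interval.
\<close>

type_synonym label = "nat list"

definition in_tree :: "(label \<Rightarrow> nat) \<Rightarrow> label \<Rightarrow> bool" where
  "in_tree N u \<longleftrightarrow> (\<forall>i<length u. u ! i < N (take i u))"

definition birth :: "(label \<Rightarrow> real) \<Rightarrow> label \<Rightarrow> real" where
  "birth L u = (\<Sum>i<length u. L (take i u))"

definition death :: "(label \<Rightarrow> real) \<Rightarrow> label \<Rightarrow> real" where
  "death L u = birth L u + L u"

definition alive :: "(label \<Rightarrow> real) \<Rightarrow> (label \<Rightarrow> nat) \<Rightarrow> real \<Rightarrow> label set" where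
  "alive L N t = {u. in_tree N u \<and> birth L u \<le> t \<and> t < death L u}"

text \<open>End of the edge of \<open>v\<close> in the tree truncated at time \<open>t\<close>.\<close>

definition edge_end :: "(label \<Rightarrow> real) \<Rightarrow> real \<Rightarrow> label \<Rightarrow> real" where
  "edge_end L t v = min (death L v) t"

text \<open>
  \<open>w v\<close> is the path of the motion of \<open>v\<close>, relative to its place of birth and
  parametrized by its age, so this is the increment along the (truncated) edge of \<open>v\<close>.
\<close>

definition edge_increment ::
    "(label \<Rightarrow> real) \<Rightarrow> (label \<Rightarrow> real \<Rightarrow> real) \<Rightarrow> real \<Rightarrow> label \<Rightarrow> real" where
  "edge_increment L w t v = w v (edge_end L t v - birth L v)"

definition bbm_position ::
    "(label \<Rightarrow> real) \<Rightarrow> (label \<Rightarrow> real \<Rightarrow> real) \<Rightarrow> real \<Rightarrow> label \<Rightarrow> real" where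
  "bbm_position L w t u = (\<Sum>i\<le>length u. edge_increment L w t (take i u))"

text \<open>
  The edge of \<open>v\<close> contributes conditional variance
  \<open>t A(edge_end L t v / t) - t A(birth L v / t)\<close>; these contributions telescope along common
  ancestral lines, which gives the CREM covariance \<open>t A(d(k,l)/t)\<close> at time \<open>t\<close>.
\<close>

definition crem_position ::
    "(real \<Rightarrow> real) \<Rightarrow> (label \<Rightarrow> real) \<Rightarrow> (label \<Rightarrow> real \<Rightarrow> real) \<Rightarrow> real \<Rightarrow> label \<Rightarrow> real" where
  "crem_position A L w t u =
     (\<Sum>i\<le>length u. let v = take i u; a = birth L v; b = edge_end L t v in
        sqrt ((t * A (b / t) - t * A (a / t)) / (b - a)) * edge_increment L w t v)"

definition correlated :: "real \<Rightarrow> real \<Rightarrow> real \<Rightarrow> real" where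
  "correlated \<rho> x z = \<rho> * x + sqrt (1 - \<rho>\<^sup>2) * z"

definition boltzmann :: "real \<Rightarrow> real \<Rightarrow> real \<Rightarrow> real \<Rightarrow> complex" where
  "boltzmann \<sigma> \<tau> x y = exp (complex_of_real (\<sigma> * x) + \<i> * complex_of_real (\<tau> * y))"

definition growth_rate :: "real \<Rightarrow> real \<Rightarrow> real \<Rightarrow> complex" where
  "growth_rate \<rho> \<sigma> \<tau> =
     1 + \<i> * complex_of_real (\<rho> * \<sigma> * \<tau>) + complex_of_real ((\<sigma>\<^sup>2 - \<tau>\<^sup>2) / 2)"

text \<open>
  In the next two definitions the set of particles alive is almost surely finite; on the
  exceptional null event the sum is \<open>0\<close>.
\<close>

definition partition_function ::
    "(real \<Rightarrow> real) \<Rightarrow> (label \<Rightarrow> real) \<Rightarrow> (label \<Rightarrow> nat) \<Rightarrow>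
     (label \<Rightarrow> real \<Rightarrow> real) \<Rightarrow> (label \<Rightarrow> real \<Rightarrow> real) \<Rightarrow> real \<Rightarrow> real \<Rightarrow> real \<Rightarrow> real \<Rightarrow> complex" where
  "partition_function A L N w w' \<rho> \<sigma> \<tau> t =
     (\<Sum>u\<in>alive L N t. boltzmann \<sigma> \<tau> (crem_position A L w t u)
        (correlated \<rho> (crem_position A L w t u) (crem_position A L w' t u)))"

definition additive_martingale ::
    "(label \<Rightarrow> real) \<Rightarrow> (label \<Rightarrow> nat) \<Rightarrow>
     (label \<Rightarrow> real \<Rightarrow> real) \<Rightarrow> (label \<Rightarrow> real \<Rightarrow> real) \<Rightarrow> real \<Rightarrow> real \<Rightarrow> real \<Rightarrow> real \<Rightarrow> complex" where
  "additive_martingale L N w w' \<rho> \<sigma> \<tau> r =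
     (\<Sum>u\<in>alive L N r. exp (- complex_of_real r * growth_rate \<rho> \<sigma> \<tau>) *
        boltzmann \<sigma> \<tau> (bbm_position L w r u)
          (correlated \<rho> (bbm_position L w r u) (bbm_position L w' r u)))"


section \<open>Probability\<close>

definition brownian_motion :: "'a measure \<Rightarrow> (real \<Rightarrow> 'a \<Rightarrow> real) \<Rightarrow> bool" where
  "brownian_motion M W \<longleftrightarrow>
     (\<forall>s\<ge>0. W s \<in> borel_measurable M) \<and>
     (\<forall>\<omega>\<in>space M. W 0 \<omega> = 0 \<and> continuous_on {0..} (\<lambda>s. W s \<omega>)) \<and>
     (\<forall>s\<ge>0. \<forall>r>s. distributed M lborel (\<lambda>\<omega>. W r \<omega> - W s \<omega>) (normal_density 0 (sqrt (r - s)))) \<and>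
     (\<forall>n (s :: nat \<Rightarrow> real). 0 \<le> s 0 \<and> mono s \<longrightarrow>
        prob_space.indep_vars M (\<lambda>_. borel) (\<lambda>i \<omega>. W (s (Suc i)) \<omega> - W (s i) \<omega>) {..<n})"

datatype source = Lifetime label | Offspring label | MotionX label | MotionZ label

text \<open>
  The sigma-algebra generated by each of the independent ingredients of the model. A motion is
  viewed as one random element of the product space of real functions on \<open>[0,\<infinity>)\<close>.
\<close>

primrec source_events ::
    "'a measure \<Rightarrow> (label \<Rightarrow> 'a \<Rightarrow> real) \<Rightarrow> (label \<Rightarrow> 'a \<Rightarrow> nat) \<Rightarrow>
     (label \<Rightarrow> real \<Rightarrow> 'a \<Rightarrow> real) \<Rightarrow> (label \<Rightarrow> real \<Rightarrow> 'a \<Rightarrow> real) \<Rightarrow> source \<Rightarrow> 'a set set" where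
  "source_events M L N W W' (Lifetime u) =
     sets (vimage_algebra (space M) (L u) borel)"
| "source_events M L N W W' (Offspring u) =
     sets (vimage_algebra (space M) (N u) (count_space UNIV))"
| "source_events M L N W W' (MotionX u) =
     sets (vimage_algebra (space M) (\<lambda>\<omega>. \<lambda>s\<in>{0..}. W u s \<omega>) (PiM {0..} (\<lambda>_. borel)))"
| "source_events M L N W W' (MotionZ u) =
     sets (vimage_algebra (space M) (\<lambda>\<omega>. \<lambda>s\<in>{0..}. W' u s \<omega>) (PiM {0..} (\<lambda>_. borel)))"

text \<open>
  The common probability space of the tree and of the two branching Brownian motions:
  independent exponential lifetimes, offspring numbers, and one pair of Brownian motions
  per particle. The edge Gaussians for a time horizon \<open>t\<close> are the increments of these
  motions over the life intervals truncated at \<open>t\<close>.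
\<close>

locale branching_model = prob_space M for M :: "'a measure" +
  fixes p :: "nat pmf"
    and L :: "label \<Rightarrow> 'a \<Rightarrow> real"
    and N :: "label \<Rightarrow> 'a \<Rightarrow> nat"
    and W W' :: "label \<Rightarrow> real \<Rightarrow> 'a \<Rightarrow> real"
  assumes lifetime_positive: "\<omega> \<in> space M \<Longrightarrow> 0 < L u \<omega>"
    and lifetime_distributed: "distributed M lborel (L u) (exponential_density 1)"
    and offspring_measurable: "N u \<in> M \<rightarrow>\<^sub>M count_space UNIV"
    and offspring_distr: "distr M (count_space UNIV) (N u) = measure_pmf p"
    and motion_x: "brownian_motion M (W u)"
    and motion_z: "brownian_motion M (W' u)"
    and independent_sources: "indep_sets (source_events M L N W W') UNIV"

text \<open>
  Measurability of the converging variables is part of the notion, since \<open>measure\<close>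
  vanishes on non-measurable sets.
\<close>

definition converges_in_probability ::
    "'a measure \<Rightarrow> ('b \<Rightarrow> 'a \<Rightarrow> complex) \<Rightarrow> ('a \<Rightarrow> complex) \<Rightarrow> 'b filter \<Rightarrow> bool" where
  "converges_in_probability M X Y F \<longleftrightarrow>
     (\<forall>\<^sub>F t in F. X t \<in> borel_measurable M) \<and> Y \<in> borel_measurable M \<and>
     (\<forall>\<epsilon>>0. ((\<lambda>t. measure M {\<omega> \<in> space M. dist (X t \<omega>) (Y \<omega>) > \<epsilon>}) \<longlongrightarrow> 0) F)"

end

theory Submission
  imports Defs
begin

text \<open>
  The idea is to expand the normalized partition function along the generations of the
  genealogical tree and to compare it with the martingale of branching Brownian motion generation
  by generation.

  Fix a horizon \<open>t\<close>, and call \<^emph>\<open>clock\<close> the variance \<open>\<Lambda> s\<close> that a line of descent has accumulated up to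
  time \<open>s\<close>. The CREM has the clock \<open>s \<mapsto> t A(s/t)\<close>. Branching Brownian motion with the parameters
  \<open>\<sigma>\<^sub>b \<sigma>\<close>, \<open>\<sigma>\<^sub>b \<tau>\<close> is the same model with the clock \<open>s \<mapsto> \<sigma>\<^sub>b\<^sup>2 s\<close>. Both clocks start at 0, are monotone and
  satisfy \<open>\<Lambda> s \<le> s\<close>; the moment estimates rest on these properties. A summand of the
  normalized partition function is the product of one factor for each edge of the ancestral line.
  Let the increment of a label be the change of the conditional expectation of the sum when
  the lifetime, the offspring number and the motions of this label are revealed. Then the sum is 1
  plus the increments of all labels born by time \<open>t\<close> (\<open>sum_increments_eq_normalized_sum\<close>), and each
  increment is centred given the sources of all other labels (\<open>increment_orthogonal\<close>).

  Let \<open>1 < \<alpha> \<le> 2\<close>. By an inequality of von Bahr and Esseen (\<open>norm_add_powr_le\<close>,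
  \<open>sum_increments_moment\<close>) the \<open>\<alpha>\<close>-th absolute moment of a sum of increments is at most a constant
  times the sum of their \<open>\<alpha>\<close>-th moments. Passing from the modulus of a mean to an \<open>\<alpha>\<close>-th moment costs
  a factor \<open>exp (c \<Lambda> s)\<close> along a line of duration \<open>s\<close>, where \<open>c = moment_cost \<sigma> \<tau> \<alpha>\<close>, and \<open>\<Lambda> s \<le> s\<close>
  bounds it by \<open>exp (c s)\<close>. With exponential lifetimes and two children on average, the moments of the
  \<open>k\<close>-th generation therefore add up to at most a constant times \<open>(2 / (1 + \<alpha> - c))\<^sup>k\<close>. This is
  summable if \<open>c < \<alpha> - 1\<close>, and the phase \<open>B\<^sub>1\<close> provides such an \<open>\<alpha>\<close> (\<open>B1_subcritical_moment\<close>). So the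
  generations from \<open>n\<close> on are negligible for large \<open>n\<close>, uniformly in the horizon and in the clock
  (\<open>tail_probability\<close>).

  The generations below \<open>n\<close> consist of finitely many particles with finite lifetimes. Since \<open>A\<close> has the
  derivative \<open>\<sigma>\<^sub>b\<^sup>2\<close> at 0, the CREM clock converges to \<open>\<sigma>\<^sub>b\<^sup>2 s\<close> at every fixed \<open>s\<close>, so that on every
  realization the contributions of these generations to the two sums have the same limit
  (\<open>early_sum_tendsto\<close>). Hence the CREM sum and the martingale at the same time \<open>t\<close> get close in
  probability, and the martingale converges to its limit.
\<close>


section \<open>Power inequalities\<close>

lemma exp_scale_le:
  fixes q u :: real
  assumes "0 \<le> q" "q \<le> 1"
  shows "exp (q * u) \<le> q * exp u + (1 - q)"
proof -
  have "exp ((1 - q) *\<^sub>R 0 + q *\<^sub>R u) \<le> (1 - q) * exp 0 + q * exp u"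
    by (rule convex_onD[OF exp_convex]) (use assms in auto)
  then show ?thesis by simp
qed

text \<open>
  The graph of a concave power lies below its tangents; in logarithmic coordinates this is the
  convexity of the exponential function.
\<close>

lemma powr_tangent_bound:
  fixes q x y :: real
  assumes "0 \<le> q" "q \<le> 1" "0 < x" "0 \<le> y"
  shows "y powr q \<le> x powr q + q * x powr (q - 1) * (y - x)"
proof (cases "y = 0")
  case True
  have "x powr (q - 1) * x = x powr q" using assms(3)
    by (simp add: powr_diff)
  then show ?thesis using True assms
    by (simp add: algebra_simps mult_left_le)
next
  case False
  then have y: "y > 0" using assms by simp
  have "(y / x) powr q \<le> q * (y / x) + (1 - q)"
    using exp_scale_le[OF assms(1,2), of "ln (y / x)"] y assms by (simp add: powr_def)
  then have "(y / x) powr q * x powr q \<le> (q * (y / x) + (1 - q)) * x powr q"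
    by (rule mult_right_mono) simp
  then show ?thesis using y assms
    by (simp add: powr_divide powr_diff field_simps)
qed

text \<open>
  An inequality of von Bahr and Esseen. The tangent bound for the power \<open>\<alpha> / 2\<close> is applied to
  \<open>\<bar>a + b\<bar>\<^sup>2 = \<bar>a\<bar>\<^sup>2 + (2 Re (cnj a * b) + \<bar>b\<bar>\<^sup>2)\<close>. If \<open>\<bar>b\<bar> \<le> \<bar>a\<bar>\<close>, the quadratic remainder
  \<open>\<bar>a\<bar> powr (\<alpha> - 2) * \<bar>b\<bar>\<^sup>2\<close> is at most \<open>\<bar>b\<bar> powr \<alpha>\<close> because \<open>\<alpha> \<le> 2\<close>; if \<open>\<bar>a\<bar> < \<bar>b\<bar>\<close>, every term is
  bounded by a multiple of \<open>\<bar>b\<bar> powr \<alpha>\<close>. The term that is linear in \<open>b\<close> vanishes in expectation when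
  \<open>b\<close> is centred given \<open>a\<close>, so that \<open>\<alpha>\<close>-th moments add up as variances do.
\<close>

lemma norm_add_powr_le:
  fixes a b :: complex and \<alpha> :: real
  assumes "1 < \<alpha>" "\<alpha> \<le> 2"
  shows "cmod (a + b) powr \<alpha> \<le>
    cmod a powr \<alpha> + \<alpha> * Re (cnj (of_real (cmod a powr (\<alpha> - 2)) * a) * b) + 6 * cmod b powr \<alpha>"
proof (cases "cmod b \<le> cmod a")
  case False
  have "cmod (a + b) powr \<alpha> \<le> (2 * cmod b) powr \<alpha>"
    using assms False by (intro powr_mono2) (auto intro: order_trans[OF norm_triangle_ineq])
  also have "\<dots> \<le> 4 * cmod b powr \<alpha>"
    using assms powr_mono[of \<alpha> 2 "2::real"] by (simp add: powr_mult mult_right_mono)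
  finally have 1: "cmod (a + b) powr \<alpha> \<le> 4 * cmod b powr \<alpha>" .
  have "\<bar>Re (cnj (of_real (cmod a powr (\<alpha> - 2)) * a) * b)\<bar> \<le> cmod a powr (\<alpha> - 2) * cmod a * cmod b"
    using abs_Re_le_cmod[of "cnj (of_real (cmod a powr (\<alpha> - 2)) * a) * b"] by (simp add: norm_mult)
  also have "cmod a powr (\<alpha> - 2) * cmod a = cmod a powr (\<alpha> - 1)"
    by (cases "a = 0") (auto simp: powr_diff power2_eq_square)
  also have "\<dots> \<le> cmod b powr (\<alpha> - 1)" using assms False by (intro powr_mono2) auto
  also have "cmod b powr (\<alpha> - 1) * cmod b = cmod b powr \<alpha>"
    by (cases "b = 0") (auto simp: powr_diff)
  finally have "\<bar>Re (cnj (of_real (cmod a powr (\<alpha> - 2)) * a) * b)\<bar> \<le> cmod b powr \<alpha>"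
    by (simp add: mult_right_mono)
  then have "\<alpha> * \<bar>Re (cnj (of_real (cmod a powr (\<alpha> - 2)) * a) * b)\<bar> \<le> 2 * cmod b powr \<alpha>"
    using assms by (intro mult_mono) auto
  then have "- (2 * cmod b powr \<alpha>) \<le> \<alpha> * Re (cnj (of_real (cmod a powr (\<alpha> - 2)) * a) * b)"
    using assms by (smt (verit) mult_minus_right mult_left_mono abs_ge_minus_self)
  then show ?thesis using 1 powr_ge_zero[of "cmod a" \<alpha>] by linarith
next
  case True
  show ?thesis
  proof (cases "a = 0")
    case True
    then have "b = 0" using \<open>cmod b \<le> cmod a\<close> by simp
    then show ?thesis using True by simp
  next
    case False
    then have pos: "cmod a > 0" by simp
    have eq: "(cmod (a + b))\<^sup>2 = (cmod a)\<^sup>2 + (2 * Re (cnj a * b) + (cmod b)\<^sup>2)"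
      by (simp only: cmod_power2) (simp add: power2_eq_square algebra_simps)
    have sq: "(cmod z)\<^sup>2 powr r = cmod z powr (2 * r)" for z and r :: real
    proof (cases "z = 0")
      case False
      then have "(cmod z)\<^sup>2 = cmod z powr 2" by simp
      then show ?thesis by (simp only: powr_powr)
    qed simp
    have "((cmod (a + b))\<^sup>2) powr (\<alpha> / 2) \<le> ((cmod a)\<^sup>2) powr (\<alpha> / 2)
        + \<alpha> / 2 * ((cmod a)\<^sup>2) powr (\<alpha> / 2 - 1) * ((cmod (a + b))\<^sup>2 - (cmod a)\<^sup>2)"
      using assms pos by (intro powr_tangent_bound) auto
    then have "cmod (a + b) powr \<alpha> \<le> cmod a powr \<alpha>
        + \<alpha> / 2 * cmod a powr (\<alpha> - 2) * (2 * Re (cnj a * b) + (cmod b)\<^sup>2)"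
      unfolding sq by (simp add: eq algebra_simps)
    also have "\<dots> = cmod a powr \<alpha> + \<alpha> * (cmod a powr (\<alpha> - 2) * Re (cnj a * b))
        + \<alpha> / 2 * (cmod a powr (\<alpha> - 2) * (cmod b)\<^sup>2)"
      by (simp add: algebra_simps)
    also have "cmod a powr (\<alpha> - 2) * Re (cnj a * b) = Re (cnj (of_real (cmod a powr (\<alpha> - 2)) * a) * b)"
      by (simp add: algebra_simps)
    also have "\<alpha> / 2 * (cmod a powr (\<alpha> - 2) * (cmod b)\<^sup>2) \<le> 6 * cmod b powr \<alpha>"
    proof (cases "b = 0")
      case False
      have "cmod a powr (\<alpha> - 2) * (cmod b)\<^sup>2 \<le> cmod b powr (\<alpha> - 2) * (cmod b)\<^sup>2"
        using assms True False by (intro mult_right_mono powr_mono2') auto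
      also have "\<dots> = cmod b powr \<alpha>" using False by (simp add: powr_diff)
      finally have "\<alpha> / 2 * (cmod a powr (\<alpha> - 2) * (cmod b)\<^sup>2) \<le> 6 * cmod b powr \<alpha>"
        using assms by (intro mult_mono) auto
      then show ?thesis .
    qed simp
    finally show ?thesis by simp
  qed
qed

text \<open>
  This makes the linear term of the preceding inequality integrable.
\<close>

lemma norm_cross_term_le:
  fixes a b :: complex
  assumes "1 < \<alpha>"
  shows "cmod (cnj (of_real (cmod a powr (\<alpha> - 2)) * a) * b) \<le> cmod a powr \<alpha> + cmod b powr \<alpha>"
proof (cases "a = 0")
  case False
  have "cmod (cnj (of_real (cmod a powr (\<alpha> - 2)) * a) * b) = cmod a powr (\<alpha> - 1) * cmod b"
    using False by (simp only: norm_mult complex_mod_cnj norm_of_real)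
      (simp add: powr_diff power2_eq_square)
  also have "\<dots> \<le> max (cmod a) (cmod b) powr (\<alpha> - 1) * max (cmod a) (cmod b)"
    using assms by (intro mult_mono powr_mono2) auto
  also have "\<dots> = max (cmod a) (cmod b) powr \<alpha>"
    using False by (simp add: powr_diff max_def split: if_splits)
  also have "\<dots> \<le> cmod a powr \<alpha> + cmod b powr \<alpha>" by (simp add: max_def)
  finally show ?thesis .
qed simp


section \<open>The phase and the order of the moments\<close>

text \<open>
  A point that violates one of the inequalities is a limit of points of \<open>B2 \<union> B3\<close>: it is dilated, in
  the second case only in the direction of \<open>\<tau>\<close> in order to keep the bound on \<open>\<sigma>\<close>.
\<close>

lemma mem_B1_cases:
  assumes "Complex \<sigma> \<tau> \<in> B1"
  shows "1 \<le> 2 * \<sigma>\<^sup>2 \<Longrightarrow> \<bar>\<sigma>\<bar> + \<bar>\<tau>\<bar> < sqrt 2"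
    and "2 * \<sigma>\<^sup>2 < 1 \<Longrightarrow> \<sigma>\<^sup>2 + \<tau>\<^sup>2 < 1"
proof -
  have closure: False if "\<And>n. Z n \<in> B2 \<union> B3" "Z \<longlonglongrightarrow> Complex \<sigma> \<tau>" for Z :: "nat \<Rightarrow> complex"
    using assms that closure_sequential[of "Complex \<sigma> \<tau>" "B2 \<union> B3"] unfolding B1_def by blast
  \<comment> \<open>The dilations by these factors push a point outwards and tend to the identity.\<close>
  have lim: "(\<lambda>n. 1 + 1 / real (Suc n)) \<longlonglongrightarrow> 1 + 0"
    by (intro tendsto_add tendsto_const LIMSEQ_Suc[OF lim_1_over_n])
  have sq: "1 < (1 + 1 / real (Suc n))\<^sup>2" for n
    by (rule one_less_power) auto
  {
    assume s: "1 \<le> 2 * \<sigma>\<^sup>2"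
    show "\<bar>\<sigma>\<bar> + \<bar>\<tau>\<bar> < sqrt 2"
    proof (rule ccontr)
      assume c: "\<not> ?thesis"
      show False
      proof (rule closure)
        show "Complex ((1 + 1 / real (Suc n)) * \<sigma>) ((1 + 1 / real (Suc n)) * \<tau>) \<in> B2 \<union> B3" for n
        proof -
          have "1 < (1 + 1 / real (Suc n))\<^sup>2 * (2 * \<sigma>\<^sup>2)"
            using sq[of n] s by (smt (verit) mult_le_cancel_left1)
          moreover have "sqrt 2 < (1 + 1 / real (Suc n)) * (\<bar>\<sigma>\<bar> + \<bar>\<tau>\<bar>)"
          proof -
            have "0 < (1 / real (Suc n)) * (\<bar>\<sigma>\<bar> + \<bar>\<tau>\<bar>)"
              using c by (intro mult_pos_pos) (auto simp: not_less intro: less_le_trans[of _ "sqrt 2"])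
            then show ?thesis using c by (simp add: algebra_simps)
          qed
          moreover define c where "c = 1 + 1 / real (Suc n)"
          moreover have "0 < c" by (auto simp: c_def intro: add_pos_nonneg)
          ultimately have "1 < c\<^sup>2 * (2 * \<sigma>\<^sup>2)" "sqrt 2 < c * (\<bar>\<sigma>\<bar> + \<bar>\<tau>\<bar>)" "0 < c" by auto
          then show ?thesis unfolding c_def[symmetric]
            by (simp add: B2_def power_mult_distrib abs_mult algebra_simps)
        qed
        have "(\<lambda>n. Complex ((1 + 1 / real (Suc n)) * \<sigma>) ((1 + 1 / real (Suc n)) * \<tau>))
            \<longlonglongrightarrow> Complex ((1 + 0) * \<sigma>) ((1 + 0) * \<tau>)"
          by (intro tendsto_Complex tendsto_mult lim tendsto_const)
        then show "(\<lambda>n. Complex ((1 + 1 / real (Suc n)) * \<sigma>) ((1 + 1 / real (Suc n)) * \<tau>))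
            \<longlonglongrightarrow> Complex \<sigma> \<tau>" by simp
      qed
    qed
  next
    assume s: "2 * \<sigma>\<^sup>2 < 1"
    show "\<sigma>\<^sup>2 + \<tau>\<^sup>2 < 1"
    proof (rule ccontr)
      assume c: "\<not> ?thesis"
      then have t: "\<tau>\<^sup>2 > 0" using s by linarith
      show False
      proof (rule closure)
        show "Complex \<sigma> ((1 + 1 / real (Suc n)) * \<tau>) \<in> B2 \<union> B3" for n
        proof -
          have "\<tau>\<^sup>2 < (1 + 1 / real (Suc n))\<^sup>2 * \<tau>\<^sup>2" using sq[of n] t by simp
          then show ?thesis using c s
            by (simp add: B3_def power_mult_distrib)
        qed
        have "(\<lambda>n. Complex \<sigma> ((1 + 1 / real (Suc n)) * \<tau>)) \<longlonglongrightarrow> Complex \<sigma> ((1 + 0) * \<tau>)"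
          by (intro tendsto_Complex tendsto_mult lim tendsto_const)
        then show "(\<lambda>n. Complex \<sigma> ((1 + 1 / real (Suc n)) * \<tau>)) \<longlonglongrightarrow> Complex \<sigma> \<tau>" by simp
      qed
    qed
  }
qed

text \<open>
  For a centred Gaussian pair \<open>x, y\<close> of variance \<open>s\<close> and correlation \<open>\<rho>\<close>, the \<open>\<alpha>\<close>-th absolute moment of
  \<open>exp (\<sigma> x + \<i> \<tau> y)\<close> is \<open>exp (moment_cost \<sigma> \<tau> \<alpha> * s)\<close> times the \<open>\<alpha>\<close>-th power of the modulus of its mean.
\<close>

definition moment_cost :: "real \<Rightarrow> real \<Rightarrow> real \<Rightarrow> real" where
  "moment_cost \<sigma> \<tau> \<alpha> = (\<alpha> * (\<alpha> - 1) * \<sigma>\<^sup>2 + \<alpha> * \<tau>\<^sup>2) / 2"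

text \<open>
  For \<open>2 \<sigma>\<^sup>2 < 1\<close> second moments suffice, since \<open>moment_cost \<sigma> \<tau> 2 = \<sigma>\<^sup>2 + \<tau>\<^sup>2\<close>. Otherwise the choice is
  \<open>\<alpha> = sqrt 2 / \<bar>\<sigma>\<bar>\<close>, which lies between 1 and 2; the condition on the cost then amounts to
  \<open>\<tau>\<^sup>2 < (sqrt 2 - \<bar>\<sigma>\<bar>)\<^sup>2\<close>.
\<close>

lemma B1_subcritical_moment:
  assumes "Complex \<sigma> \<tau> \<in> B1"
  obtains \<alpha> where "1 < \<alpha>" "\<alpha> \<le> 2" "moment_cost \<sigma> \<tau> \<alpha> < \<alpha> - 1"
proof (cases "2 * \<sigma>\<^sup>2 < 1")
  case True
  then have "moment_cost \<sigma> \<tau> 2 < 2 - 1"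
    using mem_B1_cases(2)[OF assms] by (simp add: moment_cost_def)
  then show ?thesis using that[of 2] by simp
next
  case False
  define s where "s = \<bar>\<sigma>\<bar>"
  define r where "r = sqrt (2::real)"
  have r: "r > 0" "r * r = 2" by (auto simp: r_def)
  have st: "s + \<bar>\<tau>\<bar> < r" using mem_B1_cases(1)[OF assms] False by (simp add: s_def r_def)
  have s1: "1 \<le> 2 * s\<^sup>2" using False by (simp add: s_def)
  have s0: "s > 0"
    using s1 by (cases "s = 0") (auto simp: s_def)
  have "1 \<le> (r * s)\<^sup>2" using s1 by (simp add: r_def power_mult_distrib)
  then have rs: "1 \<le> r * s" using r s0
    by (metis (no_types) abs_le_square_iff abs_of_pos mult_pos_pos one_power2 abs_one)
  have a2: "r / s \<le> 2"
  proof -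
    have "r * 1 \<le> r * (r * s)" using rs r by (intro mult_left_mono) auto
    then have "r \<le> 2 * s" using r by (simp flip: mult.assoc)
    then show ?thesis using s0 by (simp add: field_simps)
  qed
  have a1: "1 < r / s" using st s0 by (simp add: field_simps)
  have "\<tau>\<^sup>2 < (r - s)\<^sup>2" using st by (intro power2_strict_mono) auto
  then have "2 * (r * s) < 2 + s\<^sup>2 - \<tau>\<^sup>2" using r by (simp add: power2_eq_square algebra_simps)
  then have "0 < (r / s) * (2 + s\<^sup>2 - \<tau>\<^sup>2 - 2 * (r * s))" using a1 by (intro mult_pos_pos) auto
  also have "\<dots> = 2 * (r / s) + r * s - (r / s) * \<tau>\<^sup>2 - 4"
    using s0 r by (simp add: field_simps power2_eq_square)
  finally have h: "0 < 2 * (r / s) + r * s - (r / s) * \<tau>\<^sup>2 - 4" .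
  have "\<sigma>\<^sup>2 = s\<^sup>2" by (simp add: s_def)
  have "(r / s) * (r / s - 1) * s\<^sup>2 = 2 - r * s"
    using s0 r by (simp add: field_simps power2_eq_square)
  then have "2 * moment_cost \<sigma> \<tau> (r / s) = 2 - r * s + (r / s) * \<tau>\<^sup>2"
    unfolding moment_cost_def \<open>\<sigma>\<^sup>2 = s\<^sup>2\<close> by simp
  then have "2 * moment_cost \<sigma> \<tau> (r / s) < 2 * (r / s - 1)" using h by argo
  then have "moment_cost \<sigma> \<tau> (r / s) < r / s - 1" by (simp only: mult_less_cancel_left_pos zero_less_numeral)
  then show ?thesis using that[of "r / s"] a1 a2 by simp
qed


section \<open>Sums over labels\<close>

lemma sum_prod_over_lists:
  fixes r :: "nat \<Rightarrow> real"
  assumes "\<And>j. 0 \<le> r j" "(\<Sum>j<b. r j) \<le> q"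
  shows "(\<Sum>u | set u \<subseteq> {..<b} \<and> length u = k. \<Prod>i<length u. r (u ! i)) \<le> q ^ k"
proof (induction k)
  case 0
  have "{u::nat list. set u \<subseteq> {..<b} \<and> length u = 0} = {[]}" by auto
  then show ?case by simp
next
  case (Suc k)
  let ?S = "\<lambda>k. {u. set u \<subseteq> {..<b} \<and> length u = k}"
  have eq: "?S (Suc k) = (\<lambda>(j, u). j # u) ` ({..<b} \<times> ?S k)"
    by (auto simp: length_Suc_conv image_iff)
  have inj: "inj_on (\<lambda>(j, u). j # u) ({..<b} \<times> ?S k)" by (auto simp: inj_on_def)
  have "(\<Sum>u\<in>?S (Suc k). \<Prod>i<length u. r (u ! i)) =
      (\<Sum>(j, u)\<in>{..<b} \<times> ?S k. r j * (\<Prod>i<length u. r (u ! i)))"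
    unfolding eq by (subst sum.reindex[OF inj])
      (auto intro!: sum.cong simp del: prod.lessThan_Suc simp: prod.lessThan_Suc_shift)
  also have "\<dots> = (\<Sum>j<b. r j) * (\<Sum>u\<in>?S k. \<Prod>i<length u. r (u ! i))"
    by (auto simp: sum_product sum.cartesian_product intro!: sum.cong)
  also have "\<dots> \<le> q * q ^ k"
    using assms Suc by (intro mult_mono) (auto intro!: sum_nonneg prod_nonneg order_trans[OF _ assms(2)])
  finally show ?case by simp
qed

text \<open>
  Summation over the lengths of the words gives a geometric series; a finite set of words uses only
  finitely many letters.
\<close>

lemma sum_prod_long_lists:
  fixes r :: "nat \<Rightarrow> real"
  assumes r: "\<And>j. 0 \<le> r j" "\<And>b. (\<Sum>j<b. r j) \<le> q" and q: "0 \<le> q" "q < 1"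
    and F: "finite F" "\<And>u. u \<in> F \<Longrightarrow> n \<le> length u"
  shows "(\<Sum>u\<in>F. \<Prod>i<length u. r (u ! i)) \<le> q ^ n / (1 - q)"
proof -
  define m where "m = Max (insert 0 (length ` F))"
  define b where "b = Suc (Max (insert 0 (\<Union>(set ` F))))"
  define S where "S k = {u. set u \<subseteq> {..<b} \<and> length u = k}" for k
  have "x < b" if "u \<in> F" "x \<in> set u" for u x
    unfolding b_def less_Suc_eq_le by (rule Max_ge) (use that F in auto)
  moreover have "length u \<le> m" if "u \<in> F" for u
    unfolding m_def by (rule Max_ge) (use that F in auto)
  ultimately have sub: "F \<subseteq> (\<Union>k\<in>{n..m}. S k)" using F(2) unfolding S_def by auto
  have fin: "finite (S k)" for k
    unfolding S_def by (rule finite_lists_length_eq) simp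
  have "(\<Sum>u\<in>F. \<Prod>i<length u. r (u ! i)) \<le> (\<Sum>u\<in>(\<Union>k\<in>{n..m}. S k). \<Prod>i<length u. r (u ! i))"
    using sub fin r by (intro sum_mono2) (auto intro: prod_nonneg)
  also have "\<dots> = (\<Sum>k=n..m. \<Sum>u\<in>S k. \<Prod>i<length u. r (u ! i))"
    using fin by (intro sum.UNION_disjoint) (auto simp: S_def)
  also have "\<dots> \<le> (\<Sum>k=n..m. q ^ k)"
    unfolding S_def by (intro sum_mono sum_prod_over_lists r)
  also have "\<dots> \<le> (\<Sum>k. q ^ (k + n))"
  proof -
    have s: "summable (\<lambda>k. q ^ (k + n))" using q by (intro summable_ignore_initial_segment) simp
    have "(\<Sum>k=n..m. q ^ k) \<le> (\<Sum>k<Suc m. q ^ (k + n))"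
    proof -
      have "(\<Sum>k=n..m. q ^ k) = (\<Sum>k\<in>(\<lambda>k. k - n) ` {n..m}. q ^ (k + n))"
        by (subst sum.reindex) (auto intro!: inj_onI sum.cong)
      also have "\<dots> \<le> (\<Sum>k<Suc m. q ^ (k + n))" using q by (intro sum_mono2) auto
      finally show ?thesis .
    qed
    also have "\<dots> \<le> (\<Sum>k. q ^ (k + n))" using s q by (intro sum_le_suminf) auto
    finally show ?thesis .
  qed
  also have "\<dots> = q ^ n / (1 - q)"
    using q by (simp add: power_add suminf_mult2[symmetric] suminf_geometric field_simps)
  finally show ?thesis .
qed

abbreviation label_enum :: "nat \<Rightarrow> label" where
  "label_enum \<equiv> from_nat_into UNIV"

lemma bij_label_enum: "bij label_enum"
  using bij_betw_from_nat_into[of "UNIV :: label set"] infinite_UNIV_listI by auto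

lemma label_enum_cofinal:
  assumes "finite P"
  shows "\<forall>\<^sub>F m in sequentially. P \<subseteq> label_enum ` {..<m}"
proof -
  define h where "h = inv label_enum"
  have h: "label_enum (h u) = u" for u
    unfolding h_def using bij_label_enum by (simp add: bij_is_surj surj_f_inv_f)
  have "P \<subseteq> label_enum ` {..<m}" if "m \<ge> Suc (Max (insert 0 (h ` P)))" for m
  proof
    fix u assume "u \<in> P"
    then have "h u \<le> Max (insert 0 (h ` P))" using assms by (intro Max_ge) auto
    then have "h u < m" using that by linarith
    then show "u \<in> label_enum ` {..<m}" using h[of u] by (metis imageI lessThan_iff)
  qed
  then show ?thesis by (intro eventually_sequentiallyI)
qed

lemma finite_in_tree_generations: "finite {u. in_tree K u \<and> length u < n}"
proof (induction n)
  case (Suc n)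
  let ?S = "\<lambda>n. {u. in_tree K u \<and> length u < n}"
  have "?S (Suc n) \<subseteq> insert [] ((\<lambda>(u, j). u @ [j]) ` (SIGMA u:?S n. {..<K u}))"
  proof
    fix w assume w: "w \<in> ?S (Suc n)"
    show "w \<in> insert [] ((\<lambda>(u, j). u @ [j]) ` (SIGMA u:?S n. {..<K u}))"
    proof (cases w rule: rev_cases)
      case (snoc v j)
      then have "in_tree K v" "j < K v" "length v < n"
        using w by (auto simp: in_tree_def nth_append less_Suc_eq)
      then show ?thesis unfolding snoc by (auto intro!: image_eqI[of _ _ "(v, j)"])
    qed simp
  qed
  then show ?case by (rule finite_subset) (use Suc in auto)
qed simp

text \<open>
  On the measurable event that the index set is finite, the sum is the limit of its partial sums
  along an enumeration; elsewhere it is 0 by convention.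
\<close>

lemma measurable_random_finite_sum:
  fixes f :: "'i::countable \<Rightarrow> 'a \<Rightarrow> complex"
  assumes P[measurable]: "\<And>i. Measurable.pred M (P i)"
    and f: "\<And>i. (\<lambda>\<omega>. if P i \<omega> then f i \<omega> else 0) \<in> borel_measurable M"
  shows "(\<lambda>\<omega>. \<Sum>i | P i \<omega>. f i \<omega>) \<in> borel_measurable M"
proof -
  define g where "g n \<omega> = (\<Sum>i\<in>{i. to_nat i < n}. if P i \<omega> then f i \<omega> else 0)" for n \<omega>
  have fin: "finite {i::'i. to_nat i < n}" for n
    by (rule finite_imageD[of to_nat]) (auto intro: finite_subset[of _ "{..<n}"] simp: inj_on_def)
  have [measurable]: "g n \<in> borel_measurable M" for n
    unfolding g_def by (intro borel_measurable_sum f)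
  have fin_iff: "finite {i. P i \<omega>} \<longleftrightarrow> (\<exists>n. \<forall>i. P i \<omega> \<longrightarrow> to_nat i < n)" for \<omega>
  proof
    assume "finite {i. P i \<omega>}"
    then have "finite (to_nat ` {i. P i \<omega>})" by simp
    then show "\<exists>n. \<forall>i. P i \<omega> \<longrightarrow> to_nat i < n"
      by (metis (mono_tags, lifting) finite_nat_set_iff_bounded imageI mem_Collect_eq)
  next
    assume "\<exists>n. \<forall>i. P i \<omega> \<longrightarrow> to_nat i < n"
    then obtain n where "\<And>i. P i \<omega> \<Longrightarrow> to_nat i < n" by blast
    then have "{i. P i \<omega>} \<subseteq> {i. to_nat i < n}" by blast
    then show "finite {i. P i \<omega>}" using fin by (rule finite_subset)
  qed
  have [measurable]: "Measurable.pred M (\<lambda>\<omega>. finite {i. P i \<omega>})"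
    unfolding fin_iff by measurable
  have eq: "(\<Sum>i | P i \<omega>. f i \<omega>) = (if finite {i. P i \<omega>} then lim (\<lambda>n. g n \<omega>) else 0)" for \<omega>
  proof (cases "finite {i. P i \<omega>}")
    case True
    then obtain n where n: "\<And>i. P i \<omega> \<Longrightarrow> to_nat i < n" using fin_iff by blast
    have "g m \<omega> = (\<Sum>i | P i \<omega>. f i \<omega>)" if "m \<ge> n" for m
      unfolding g_def
    proof (rule sum.mono_neutral_cong_right)
      show "{i. P i \<omega>} \<subseteq> {i. to_nat i < m}" using n that by (auto intro: less_le_trans)
    qed (auto simp: fin)
    then have "(\<lambda>m. g m \<omega>) \<longlonglongrightarrow> (\<Sum>i | P i \<omega>. f i \<omega>)"
      by (intro tendsto_eventually eventually_sequentiallyI)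
    then show ?thesis using True by (simp add: limI)
  qed simp
  show ?thesis unfolding eq by measurable
qed


section \<open>Gaussian exponentials and convergence in probability\<close>

text \<open>
  Translation of the density by \<open>Re z\<close> makes the exponential purely oscillating, so that the value
  is read off from the characteristic function.
\<close>

lemma std_normal_complex_exp:
  fixes z :: complex
  shows "integrable lborel (\<lambda>x. std_normal_density x *\<^sub>R exp (z * of_real x))"
    and "(\<integral>x. std_normal_density x *\<^sub>R exp (z * of_real x) \<partial>lborel) = exp (z\<^sup>2 / 2)"
proof -
  define a b where "a = Re z" and "b = Im z"
  have z: "z = of_real a + \<i> * of_real b" by (simp add: a_def b_def complex_eq)
  have shift: "std_normal_density (a + x) *\<^sub>R exp (z * of_real (a + x)) =
      exp (z * of_real a - of_real (a\<^sup>2 / 2)) * (std_normal_density x *\<^sub>R iexp (b * x))" for x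
  proof -
    have "complex_of_real (std_normal_density (a + x)) * exp (z * of_real (a + x)) =
      of_real (1 / sqrt (2 * pi)) * exp (of_real (- (a + x)\<^sup>2 / 2) + z * of_real (a + x))"
      by (simp only: exp_add exp_of_real) (simp add: std_normal_density_def)
    also have "of_real (- (a + x)\<^sup>2 / 2) + z * of_real (a + x) =
      (z * of_real a - of_real (a\<^sup>2 / 2)) + (of_real (- x\<^sup>2 / 2) + \<i> * of_real (b * x))"
      by (simp add: z algebra_simps power2_eq_square add_divide_distrib diff_divide_distrib)
    also have "of_real (1 / sqrt (2 * pi)) * exp \<dots> = exp (z * of_real a - of_real (a\<^sup>2 / 2)) *
       (of_real (std_normal_density x) * iexp (b * x))"
      by (simp only: exp_add exp_of_real std_normal_density_def of_real_mult) (simp add: mult_ac)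
    finally show ?thesis by (simp add: scaleR_conv_of_real)
  qed
  have int: "integrable lborel (\<lambda>x. std_normal_density x *\<^sub>R iexp (b * x))"
    by (rule Bochner_Integration.integrable_bound[OF integrable_std_normal_moment[of 0]]) auto
  have ch: "(\<integral>x. std_normal_density x *\<^sub>R iexp (b * x) \<partial>lborel) = exp (- (b\<^sup>2) / 2)"
    using fun_cong[OF char_std_normal_distribution, of b]
    unfolding char_def by (subst (asm) integral_density) auto
  have "integrable lborel (\<lambda>x. std_normal_density (a + 1 * x) *\<^sub>R exp (z * of_real (a + 1 * x)))"
    unfolding mult_1 shift using int by (intro integrable_mult_right)
  then show "integrable lborel (\<lambda>x. std_normal_density x *\<^sub>R exp (z * of_real x))"
    using lborel_integrable_real_affine_iff[of 1 "\<lambda>x. std_normal_density x *\<^sub>R exp (z * of_real x)" a]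
    by simp
  have "(\<integral>x. std_normal_density x *\<^sub>R exp (z * of_real x) \<partial>lborel) =
     \<bar>1\<bar> *\<^sub>R (\<integral>x. std_normal_density (a + 1 * x) *\<^sub>R exp (z * of_real (a + 1 * x)) \<partial>lborel)"
    by (rule lborel_integral_real_affine) simp
  also have "\<dots> = exp (z * of_real a - of_real (a\<^sup>2 / 2)) * of_real (exp (- (b\<^sup>2) / 2))"
    unfolding mult_1 shift integral_mult_right_zero ch by simp
  also have "\<dots> = exp (z\<^sup>2 / 2)"
  proof -
    have "z * of_real a - of_real (a\<^sup>2 / 2) + of_real (- (b\<^sup>2) / 2) = z\<^sup>2 / 2"
      by (simp add: z power2_eq_square algebra_simps add_divide_distrib diff_divide_distrib)
    moreover have "exp (z * of_real a - of_real (a\<^sup>2 / 2)) * of_real (exp (- (b\<^sup>2) / 2)) =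
        exp (z * of_real a - of_real (a\<^sup>2 / 2) + of_real (- (b\<^sup>2) / 2))"
      by (simp only: exp_add exp_of_real)
    ultimately show ?thesis by (simp only:)
  qed
  finally show "(\<integral>x. std_normal_density x *\<^sub>R exp (z * of_real x) \<partial>lborel) = exp (z\<^sup>2 / 2)" .
qed

lemma (in prob_space) normal_complex_exp:
  fixes z :: complex
  assumes X: "distributed M lborel X (normal_density 0 v)" and v: "0 < v"
  shows "integrable M (\<lambda>\<omega>. exp (z * of_real (X \<omega>)))"
    and "(\<integral>\<omega>. exp (z * of_real (X \<omega>)) \<partial>M) = exp (z\<^sup>2 * of_real (v\<^sup>2) / 2)"
proof -
  have "distributed M lborel (\<lambda>\<omega>. (X \<omega> - 0) / v) std_normal_density"
    using X v by (subst normal_standard_normal_convert[symmetric]) auto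
  then have Y: "distributed M lborel (\<lambda>\<omega>. X \<omega> / v) std_normal_density" by simp
  have eq: "exp (z * of_real (X \<omega>)) = exp ((z * of_real v) * of_real (X \<omega> / v))" for \<omega>
    using v by simp
  have m: "(\<lambda>x. exp (z * of_real v * of_real x)) \<in> borel_measurable lborel" by measurable
  have d: "distr M lborel (\<lambda>\<omega>. X \<omega> / v) = density lborel (\<lambda>x. ennreal (std_normal_density x))"
    using Y by (simp add: distributed_distr_eq_density)
  have rv: "(\<lambda>\<omega>. X \<omega> / v) \<in> M \<rightarrow>\<^sub>M lborel" using Y by (simp add: distributed_def)
  have "integrable (distr M lborel (\<lambda>\<omega>. X \<omega> / v)) (\<lambda>x. exp (z * of_real v * of_real x))"
    unfolding d using std_normal_complex_exp(1)[of "z * of_real v"]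
    by (subst integrable_density) auto
  then show "integrable M (\<lambda>\<omega>. exp (z * of_real (X \<omega>)))"
    unfolding eq by (subst (asm) integrable_distr_eq[OF rv m])
  have "(\<integral>\<omega>. exp (z * of_real v * of_real (X \<omega> / v)) \<partial>M) =
     (\<integral>x. exp (z * of_real v * of_real x) \<partial>distr M lborel (\<lambda>\<omega>. X \<omega> / v))"
    by (subst integral_distr[OF rv m]) simp
  also have "\<dots> = exp ((z * of_real v)\<^sup>2 / 2)"
    unfolding d using std_normal_complex_exp(2)[of "z * of_real v"]
    by (subst integral_density) auto
  finally show "(\<integral>\<omega>. exp (z * of_real (X \<omega>)) \<partial>M) = exp (z\<^sup>2 * of_real (v\<^sup>2) / 2)"
    unfolding eq by (simp add: power_mult_distrib)
qed

lemma boltzmann_correlated: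
  "boltzmann \<sigma> \<tau> x (correlated \<rho> x z) =
    exp ((of_real \<sigma> + \<i> * of_real (\<tau> * \<rho>)) * of_real x) * exp (\<i> * of_real (\<tau> * sqrt (1 - \<rho>\<^sup>2)) * of_real z)"
  by (simp add: boltzmann_def correlated_def exp_add[symmetric] algebra_simps)

lemma norm_boltzmann: "cmod (boltzmann \<sigma> \<tau> x y) = exp (\<sigma> * x)"
  by (simp add: boltzmann_def)

lemma boltzmann_zero [simp]: "boltzmann \<sigma> \<tau> 0 (correlated \<rho> 0 0) = 1"
  by (simp add: boltzmann_def correlated_def)

lemma boltzmann_add:
  "boltzmann \<sigma> \<tau> (x + x') (correlated \<rho> (x + x') (z + z')) =
    boltzmann \<sigma> \<tau> x (correlated \<rho> x z) * boltzmann \<sigma> \<tau> x' (correlated \<rho> x' z')"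
  by (simp add: boltzmann_correlated algebra_simps flip: exp_add)

lemma (in prob_space) AE_tendsto_imp_prob_tendsto:
  fixes Y :: "nat \<Rightarrow> 'a \<Rightarrow> complex"
  assumes [measurable]: "\<And>k. Y k \<in> borel_measurable M"
    and lim: "AE \<omega> in M. (\<lambda>k. Y k \<omega>) \<longlonglongrightarrow> 0" and "0 < \<epsilon>"
  shows "(\<lambda>k. prob {\<omega> \<in> space M. \<epsilon> < cmod (Y k \<omega>)}) \<longlonglongrightarrow> 0"
proof -
  have "(\<lambda>k. \<integral>\<omega>. indicator {\<omega> \<in> space M. \<epsilon> < cmod (Y k \<omega>)} \<omega> \<partial>M) \<longlonglongrightarrow> (\<integral>\<omega>. 0 \<partial>M :: real)"
  proof (rule integral_dominated_convergence[where w = "\<lambda>_. 1"])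
    show "AE \<omega> in M. (\<lambda>k. indicator {\<omega> \<in> space M. \<epsilon> < cmod (Y k \<omega>)} \<omega> :: real) \<longlonglongrightarrow> 0"
      using lim
    proof (rule AE_mp, intro AE_I2 impI)
      fix \<omega> assume "(\<lambda>k. Y k \<omega>) \<longlonglongrightarrow> 0"
      then have "(\<lambda>k. cmod (Y k \<omega>)) \<longlonglongrightarrow> 0" by (rule tendsto_norm_zero)
      then have "\<forall>\<^sub>F k in sequentially. cmod (Y k \<omega>) < \<epsilon>"
        using \<open>0 < \<epsilon>\<close> by (rule order_tendstoD)
      then show "(\<lambda>k. indicator {\<omega> \<in> space M. \<epsilon> < cmod (Y k \<omega>)} \<omega> :: real) \<longlonglongrightarrow> 0"
        by (intro tendsto_eventually) (auto elim!: eventually_mono simp: indicator_def)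
    qed
  qed (auto simp: indicator_def)
  then show ?thesis by simp
qed


section \<open>Independence of the sources\<close>

context branching_model
begin

text \<open>
  The information carried by a set of sources, as a sigma-algebra on the common sample space.
  Statements about independence are phrased with these sigma-algebras instead of families of random
  elements, because the sources have different types.
\<close>

definition src :: "source set \<Rightarrow> 'a measure" where
  "src A = sigma (space M) (\<Union>s\<in>A. source_events M L N W W' s)"

lemma source_events_subset: "source_events M L N W W' s \<subseteq> events"
  using independent_sources by (auto simp: indep_sets_def)

lemma source_events_Pow: "(\<Union>s\<in>A. source_events M L N W W' s) \<subseteq> Pow (space M)"
  using source_events_subset sets.space_closed by blast

lemma space_src [simp]: "space (src A) = space M"
  using source_events_Pow by (simp add: src_def space_measure_of_conv)

lemma sets_src: "sets (src A) = sigma_sets (space M) (\<Union>s\<in>A. source_events M L N W W' s)"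
  using source_events_Pow by (simp add: src_def)

lemma sets_src_subset: "sets (src A) \<subseteq> events"
  unfolding sets_src using source_events_subset by (intro sets.sigma_sets_subset) blast

lemma measurable_src_imp: "f \<in> src A \<rightarrow>\<^sub>M K \<Longrightarrow> f \<in> M \<rightarrow>\<^sub>M K"
  using measurable_mono[of K K "src A" M] sets_src_subset by auto

lemma ident_measurable_src [measurable]: "(\<lambda>\<omega>. \<omega>) \<in> M \<rightarrow>\<^sub>M src A"
  by (rule measurable_src_imp[of _ A]) simp

lemma measurable_from_source:
  assumes "s \<in> A" "f \<in> space M \<rightarrow> space K"
    and "sets (vimage_algebra (space M) f K) \<subseteq> source_events M L N W W' s"
  shows "f \<in> src A \<rightarrow>\<^sub>M K"
proof (rule measurableI)
  fix X assume "X \<in> sets K"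
  then have "f -` X \<inter> space M \<in> sets (vimage_algebra (space M) f K)" by (rule in_vimage_algebra)
  then show "f -` X \<inter> space (src A) \<in> sets (src A)"
    using assms(1,3) by (auto simp: sets_src intro!: sigma_sets.Basic)
qed (use assms(2) in auto)

lemma lifetime_measurable_src: "Lifetime u \<in> A \<Longrightarrow> L u \<in> borel_measurable (src A)"
  by (rule measurable_from_source) auto

lemma offspring_measurable_src: "Offspring u \<in> A \<Longrightarrow> N u \<in> src A \<rightarrow>\<^sub>M count_space UNIV"
  by (rule measurable_from_source) auto

lemma motion_x_measurable_src:
  assumes "MotionX u \<in> A" "0 \<le> s"
  shows "W u s \<in> borel_measurable (src A)"
proof -
  have "(\<lambda>\<omega>. \<lambda>s\<in>{0..}. W u s \<omega>) \<in> src A \<rightarrow>\<^sub>M PiM {0..} (\<lambda>_. borel)"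
    by (rule measurable_from_source[OF assms(1)]) (auto simp: space_PiM)
  then have "(\<lambda>\<omega>. (\<lambda>s\<in>{0..}. W u s \<omega>) s) \<in> borel_measurable (src A)"
    by (rule measurable_compose) (use assms in simp)
  then show ?thesis using assms by simp
qed

lemma motion_z_measurable_src:
  assumes "MotionZ u \<in> A" "0 \<le> s"
  shows "W' u s \<in> borel_measurable (src A)"
proof -
  have "(\<lambda>\<omega>. \<lambda>s\<in>{0..}. W' u s \<omega>) \<in> src A \<rightarrow>\<^sub>M PiM {0..} (\<lambda>_. borel)"
    by (rule measurable_from_source[OF assms(1)]) (auto simp: space_PiM)
  then have "(\<lambda>\<omega>. (\<lambda>s\<in>{0..}. W' u s \<omega>) s) \<in> borel_measurable (src A)"
    by (rule measurable_compose) (use assms in simp)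
  then show ?thesis using assms by simp
qed

text \<open>
  The time is rounded up to the next multiple of \<open>1 / (n + 1)\<close>: there the process is glued from
  countably many measurable maps, and continuity carries this over to the limit. The time and
  the process may read different components of \<open>P\<close>, as needed when a lifetime and a motion are
  taken from two independent samples.
\<close>

lemma continuous_process_at_random_time:
  fixes V :: "real \<Rightarrow> 'b \<Rightarrow> real"
  assumes V: "\<And>s. 0 \<le> s \<Longrightarrow> V s \<in> borel_measurable K"
    and cont: "\<And>x. x \<in> space K \<Longrightarrow> continuous_on {0..} (\<lambda>s. V s x)"
    and T[measurable]: "T \<in> borel_measurable P" and X[measurable]: "X \<in> P \<rightarrow>\<^sub>M K"
  shows "(\<lambda>x. V (max 0 (T x)) (X x)) \<in> borel_measurable P"
proof (rule borel_measurable_LIMSEQ_real)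
  let ?T = "\<lambda>n x. real (nat \<lceil>T x * real (Suc n)\<rceil>) / real (Suc n)"
  fix x assume x: "x \<in> space P"
  have "(\<lambda>n. ?T n x) \<longlonglongrightarrow> max 0 (T x)"
  proof (rule tendsto_sandwich)
    show "\<forall>\<^sub>F n in sequentially. max 0 (T x) \<le> ?T n x"
    proof (rule always_eventually, rule allI)
      fix n
      have "T x * real (Suc n) \<le> real (nat \<lceil>T x * real (Suc n)\<rceil>)" by linarith
      then have "T x \<le> ?T n x" by (simp add: field_simps)
      then show "max 0 (T x) \<le> ?T n x" by simp
    qed
    show "\<forall>\<^sub>F n in sequentially. ?T n x \<le> max 0 (T x) + 1 / real (Suc n)"
    proof (rule always_eventually, rule allI)
      fix n
      have "real (nat \<lceil>T x * real (Suc n)\<rceil>) \<le> max 0 (T x * real (Suc n)) + 1" by linarith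
      also have "max 0 (T x * real (Suc n)) = max 0 (T x) * real (Suc n)"
        by (simp add: max_def mult_le_0_iff zero_le_mult_iff)
      finally have "?T n x \<le> (max 0 (T x) * real (Suc n) + 1) / real (Suc n)"
        by (intro divide_right_mono) auto
      then show "?T n x \<le> max 0 (T x) + 1 / real (Suc n)"
        by (simp add: add_divide_distrib del: of_nat_Suc)
    qed
    have "(\<lambda>n. max 0 (T x) + 1 / real (Suc n)) \<longlonglongrightarrow> max 0 (T x) + 0"
      by (intro tendsto_add tendsto_const LIMSEQ_Suc[OF lim_1_over_n])
    then show "(\<lambda>n. max 0 (T x) + 1 / real (Suc n)) \<longlonglongrightarrow> max 0 (T x)" by simp
  qed simp
  then show "(\<lambda>n. V (?T n x) (X x)) \<longlonglongrightarrow> V (max 0 (T x)) (X x)"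
    by (rule continuous_on_tendsto_compose[OF cont[OF measurable_space[OF X x]]]) auto
next
  fix n
  show "(\<lambda>x. V (real (nat \<lceil>T x * real (Suc n)\<rceil>) / real (Suc n)) (X x)) \<in> borel_measurable P"
  proof (rule measurable_compose_countable[where g = "\<lambda>x. nat \<lceil>T x * real (Suc n)\<rceil>"])
    show "(\<lambda>x. V (real k / real (Suc n)) (X x)) \<in> borel_measurable P" for k
      by (rule measurable_compose[OF X V]) simp
  qed measurable
qed

lemma motion_x_at_random_time:
  assumes "MotionX u \<in> A" "T \<in> borel_measurable P" "X \<in> P \<rightarrow>\<^sub>M src A"
  shows "(\<lambda>x. W u (max 0 (T x)) (X x)) \<in> borel_measurable P"
  using motion_x[of u] unfolding brownian_motion_def
  by (intro continuous_process_at_random_time[OF motion_x_measurable_src[OF assms(1)] _ assms(2,3)]) auto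

lemma motion_z_at_random_time:
  assumes "MotionZ u \<in> A" "T \<in> borel_measurable P" "X \<in> P \<rightarrow>\<^sub>M src A"
  shows "(\<lambda>x. W' u (max 0 (T x)) (X x)) \<in> borel_measurable P"
  using motion_z[of u] unfolding brownian_motion_def
  by (intro continuous_process_at_random_time[OF motion_z_measurable_src[OF assms(1)] _ assms(2,3)]) auto

lemma indep_src:
  assumes "A \<inter> B = {}"
  shows "indep_set (sets (src A)) (sets (src B))"
proof -
  have "indep_sets (\<lambda>b. sigma_sets (space M) (\<Union>i\<in>case_bool A B b. source_events M L N W W' i)) UNIV"
  proof (rule indep_sets_collect_sigma)
    show "indep_sets (source_events M L N W W') (\<Union>b\<in>UNIV. case_bool A B b)"
      by (rule indep_sets_mono_index[OF _ independent_sources]) simp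
    show "Int_stable (source_events M L N W W' i)" for i
      by (cases i) (auto simp: sets.Int_stable)
    show "disjoint_family (case_bool A B)"
      using assms by (auto simp: disjoint_family_on_def split: bool.split)
  qed
  also have "(\<lambda>b. sigma_sets (space M) (\<Union>i\<in>case_bool A B b. source_events M L N W W' i)) =
      case_bool (sets (src A)) (sets (src B))"
    by (auto simp: sets_src intro!: ext split: bool.split)
  finally show ?thesis by (simp add: indep_set_def)
qed

definition srcM :: "source set \<Rightarrow> 'a measure" where
  "srcM A = distr M (src A) (\<lambda>\<omega>. \<omega>)"

lemma prob_space_srcM: "prob_space (srcM A)"
  unfolding srcM_def by (rule prob_space_distr) simp

lemma sets_srcM [measurable_cong]: "sets (srcM A) = sets (src A)" by (simp add: srcM_def)

lemma nn_integral_srcM: "f \<in> borel_measurable (src A) \<Longrightarrow> (\<integral>\<^sup>+\<omega>. f \<omega> \<partial>srcM A) = (\<integral>\<^sup>+\<omega>. f \<omega> \<partial>M)"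
  unfolding srcM_def by (subst nn_integral_distr) simp_all

lemma integral_srcM:
  fixes f :: "'a \<Rightarrow> complex"
  shows "f \<in> borel_measurable (src A) \<Longrightarrow> (\<integral>\<omega>. f \<omega> \<partial>srcM A) = (\<integral>\<omega>. f \<omega> \<partial>M)"
  unfolding srcM_def by (subst integral_distr) simp_all

text \<open>
  Independence of two disjoint sets of sources, stated for the sample point itself: seen through the
  two sigma-algebras, the two copies on the diagonal are independent.
\<close>

lemma diagonal_distr:
  assumes "A \<inter> B = {}"
  shows "srcM A \<Otimes>\<^sub>M srcM B = distr M (src A \<Otimes>\<^sub>M src B) (\<lambda>\<omega>. (\<omega>, \<omega>))"
proof (rule pair_measure_eqI)
  show "sigma_finite_measure (srcM A)" "sigma_finite_measure (srcM B)"
    using prob_space_srcM by (auto intro: prob_space_imp_sigma_finite)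
  show "sets (srcM A \<Otimes>\<^sub>M srcM B) = sets (distr M (src A \<Otimes>\<^sub>M src B) (\<lambda>\<omega>. (\<omega>, \<omega>)))"
    by (simp cong: sets_pair_measure_cong add: sets_srcM)
  fix X Y assume "X \<in> sets (srcM A)" "Y \<in> sets (srcM B)"
  then have XY: "X \<in> sets (src A)" "Y \<in> sets (src B)" by (simp_all add: sets_srcM)
  have sub: "X \<subseteq> space M" "Y \<subseteq> space M" using XY sets.sets_into_space by fastforce+
  have ev: "X \<in> events" "Y \<in> events" using XY sets_src_subset by auto
  have "emeasure (distr M (src A \<Otimes>\<^sub>M src B) (\<lambda>\<omega>. (\<omega>, \<omega>))) (X \<times> Y) = emeasure M (X \<inter> Y)"
    using XY sub by (subst emeasure_distr) (auto intro!: arg_cong[where f = "emeasure M"])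
  also have "\<dots> = ennreal (prob X * prob Y)"
    using indep_setD[OF indep_src[OF assms] XY] by (simp add: emeasure_eq_measure)
  also have "\<dots> = emeasure (srcM A) X * emeasure (srcM B) Y"
    using XY ev sub unfolding srcM_def
    by (subst (1 2) emeasure_distr) (auto simp: emeasure_eq_measure ennreal_mult Int_absorb2)
  finally show "emeasure (srcM A) X * emeasure (srcM B) Y =
      emeasure (distr M (src A \<Otimes>\<^sub>M src B) (\<lambda>\<omega>. (\<omega>, \<omega>))) (X \<times> Y)" by simp
qed

text \<open>
  Disjoint sets of sources may be sampled independently of each other. The inner integral is the
  conditional expectation given the sources in \<open>A\<close>; all conditioning below has this form.
\<close>

lemma nn_integral_decouple:
  assumes "A \<inter> B = {}" and f[measurable]: "f \<in> borel_measurable (src A \<Otimes>\<^sub>M src B)"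
  shows "(\<integral>\<^sup>+\<omega>. f (\<omega>, \<omega>) \<partial>M) = (\<integral>\<^sup>+\<omega>. \<integral>\<^sup>+\<omega>'. f (\<omega>, \<omega>') \<partial>M \<partial>M)"
proof -
  interpret B: prob_space "srcM B" by (rule prob_space_srcM)
  have "(\<integral>\<^sup>+\<omega>. f (\<omega>, \<omega>) \<partial>M) = (\<integral>\<^sup>+x. f x \<partial>distr M (src A \<Otimes>\<^sub>M src B) (\<lambda>\<omega>. (\<omega>, \<omega>)))"
    by (subst nn_integral_distr) simp_all
  also have "\<dots> = (\<integral>\<^sup>+\<omega>. \<integral>\<^sup>+\<omega>'. f (\<omega>, \<omega>') \<partial>srcM B \<partial>srcM A)"
    unfolding diagonal_distr[OF assms(1), symmetric] by (subst B.nn_integral_fst) simp_all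
  also have "\<dots> = (\<integral>\<^sup>+\<omega>. \<integral>\<^sup>+\<omega>'. f (\<omega>, \<omega>') \<partial>srcM B \<partial>M)"
  proof (rule nn_integral_srcM)
    show "(\<lambda>\<omega>. \<integral>\<^sup>+\<omega>'. f (\<omega>, \<omega>') \<partial>srcM B) \<in> borel_measurable (src A)" by measurable
  qed
  also have "\<dots> = (\<integral>\<^sup>+\<omega>. \<integral>\<^sup>+\<omega>'. f (\<omega>, \<omega>') \<partial>M \<partial>M)"
    by (intro nn_integral_cong nn_integral_srcM) simp
  finally show ?thesis .
qed

lemma integral_decouple:
  fixes f :: "'a \<times> 'a \<Rightarrow> complex"
  assumes "A \<inter> B = {}" and f[measurable]: "f \<in> borel_measurable (src A \<Otimes>\<^sub>M src B)"
    and int: "integrable M (\<lambda>\<omega>. f (\<omega>, \<omega>))"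
  shows "(\<integral>\<omega>. f (\<omega>, \<omega>) \<partial>M) = (\<integral>\<omega>. \<integral>\<omega>'. f (\<omega>, \<omega>') \<partial>M \<partial>M)"
proof -
  interpret A: prob_space "srcM A" by (rule prob_space_srcM)
  interpret B: prob_space "srcM B" by (rule prob_space_srcM)
  interpret AB: pair_sigma_finite "srcM A" "srcM B" ..
  have "integrable (srcM A \<Otimes>\<^sub>M srcM B) f"
    unfolding diagonal_distr[OF assms(1)] using int by (subst integrable_distr_eq) simp_all
  then have "(\<integral>x. f x \<partial>(srcM A \<Otimes>\<^sub>M srcM B)) = (\<integral>\<omega>. \<integral>\<omega>'. f (\<omega>, \<omega>') \<partial>srcM B \<partial>srcM A)"
    by (rule AB.integral_fst'[symmetric])
  also have "\<dots> = (\<integral>\<omega>. \<integral>\<omega>'. f (\<omega>, \<omega>') \<partial>srcM B \<partial>M)"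
  proof (rule integral_srcM)
    show "(\<lambda>\<omega>. \<integral>\<omega>'. f (\<omega>, \<omega>') \<partial>srcM B) \<in> borel_measurable (src A)" by measurable
  qed
  also have "\<dots> = (\<integral>\<omega>. \<integral>\<omega>'. f (\<omega>, \<omega>') \<partial>M \<partial>M)"
    by (intro Bochner_Integration.integral_cong refl integral_srcM) simp
  also have "(\<integral>x. f x \<partial>(srcM A \<Otimes>\<^sub>M srcM B)) = (\<integral>\<omega>. f (\<omega>, \<omega>) \<partial>M)"
    unfolding diagonal_distr[OF assms(1)] by (subst integral_distr) simp_all
  finally show ?thesis .
qed


section \<open>Laws of motions, lifetimes and offspring numbers\<close>

lemma motion_complex_exp:
  fixes z :: complex
  assumes BM: "brownian_motion M V" and s: "0 \<le> s"
  shows "integrable M (\<lambda>\<omega>. exp (z * of_real (V s \<omega>)))"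
    and "(\<integral>\<omega>. exp (z * of_real (V s \<omega>)) \<partial>M) = exp (z\<^sup>2 * of_real s / 2)"
proof -
  have V0: "V 0 \<omega> = 0" if "\<omega> \<in> space M" for \<omega> using BM that by (auto simp: brownian_motion_def)
  have *: "integrable M (\<lambda>\<omega>. exp (z * of_real (V s \<omega>))) \<and>
      (\<integral>\<omega>. exp (z * of_real (V s \<omega>)) \<partial>M) = exp (z\<^sup>2 * of_real s / 2)"
  proof (cases "s = 0")
    case True
    then have "\<omega> \<in> space M \<Longrightarrow> exp (z * of_real (V s \<omega>)) = 1" for \<omega> using V0 by simp
    then show ?thesis using True by (simp cong: Bochner_Integration.integrable_cong
      Bochner_Integration.integral_cong add: prob_space)
  next
    case False
    have "\<forall>s\<ge>0. \<forall>r>s. distributed M lborel (\<lambda>\<omega>. V r \<omega> - V s \<omega>) (normal_density 0 (sqrt (r - s)))"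
      using BM unfolding brownian_motion_def by blast
    then have "distributed M lborel (\<lambda>\<omega>. V s \<omega> - V 0 \<omega>) (normal_density 0 (sqrt (s - 0)))"
      using s False by (metis order_refl order_le_imp_less_or_eq)
    note N = normal_complex_exp[OF this, of z]
    have eq: "\<omega> \<in> space M \<Longrightarrow> V s \<omega> - V 0 \<omega> = V s \<omega>" for \<omega> using V0 by simp
    show ?thesis using N False s eq
      by (simp cong: Bochner_Integration.integrable_cong Bochner_Integration.integral_cong)
  qed
  show "integrable M (\<lambda>\<omega>. exp (z * of_real (V s \<omega>)))"
    and "(\<integral>\<omega>. exp (z * of_real (V s \<omega>)) \<partial>M) = exp (z\<^sup>2 * of_real s / 2)"
    using * by auto
qed

lemma motion_real_exp:
  assumes BM: "brownian_motion M V" and s: "0 \<le> s"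
  shows "(\<integral>\<^sup>+\<omega>. ennreal (exp (r * V s \<omega>)) \<partial>M) = ennreal (exp (r\<^sup>2 * s / 2))"
proof -
  have eq: "exp (complex_of_real r * of_real (V s \<omega>)) = of_real (exp (r * V s \<omega>))" for \<omega>
    by (simp flip: exp_of_real)
  note c = motion_complex_exp[OF assms, of "complex_of_real r", unfolded eq]
  have int: "integrable M (\<lambda>\<omega>. exp (r * V s \<omega>))"
    using integrable_Re[OF c(1)] by simp
  have "complex_of_real (\<integral>\<omega>. exp (r * V s \<omega>) \<partial>M) = exp ((complex_of_real r)\<^sup>2 * of_real s / 2)"
    using c(2) by simp
  also have "\<dots> = complex_of_real (exp (r\<^sup>2 * s / 2))" by (simp flip: exp_of_real)
  finally have "(\<integral>\<omega>. exp (r * V s \<omega>) \<partial>M) = exp (r\<^sup>2 * s / 2)"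
    by (simp only: of_real_eq_iff)
  then show ?thesis using nn_integral_eq_integral[OF int] by simp
qed

lemma lifetime_nn_integral:
  assumes "g \<in> borel_measurable borel"
  shows "(\<integral>\<^sup>+\<omega>. g (L u \<omega>) \<partial>M) = (\<integral>\<^sup>+x. ennreal (exponential_density 1 x) * g x \<partial>lborel)"
  using distributed_nn_integral[OF lifetime_distributed, of g u] assms by simp

lemma lifetime_laplace:
  assumes "0 \<le> \<theta>"
  shows "(\<integral>\<^sup>+\<omega>. ennreal (exp (- \<theta> * L u \<omega>)) \<partial>M) = ennreal (1 / (1 + \<theta>))"
proof -
  \<comment> \<open>Tilting an exponential density gives a multiple of another one.\<close>
  have eq: "ennreal (exponential_density 1 x) * ennreal (exp (- \<theta> * x)) =
      ennreal (1 / (1 + \<theta>)) * ennreal (exponential_density (1 + \<theta>) x)" for x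
    using assms by (auto simp: exponential_density_def field_simps simp flip: ennreal_mult exp_add)
  have "(\<integral>\<^sup>+x. ennreal (exponential_density (1 + \<theta>) x) \<partial>lborel) = 1"
    using prob_space.emeasure_space_1[OF prob_space_exponential_density[of "1 + \<theta>"]] assms
    by (simp add: emeasure_density)
  then show ?thesis
    by (subst lifetime_nn_integral) (measurable, simp only: eq, simp add: nn_integral_cmult)
qed

text \<open>
  The balance between the death rate 1 and the mean offspring number 2 that makes \<open>exp (- t)\<close> the
  right normalization of the number of particles at time \<open>t\<close>.
\<close>

lemma lifetime_branching_balance:
  assumes "0 \<le> s"
  shows "(\<integral>\<^sup>+\<omega>. (if L u \<omega> \<le> s then ennreal (2 * exp (- L u \<omega>)) else ennreal (exp (- s))) \<partial>M) = 1"
proof -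
  define g where "g x = (if x \<le> s then ennreal (2 * exp (- x)) else ennreal (exp (- s)))" for x
  have [measurable]: "g \<in> borel_measurable borel" unfolding g_def by measurable
  have cdf: "(\<integral>\<^sup>+x. ennreal (exponential_density l x) * indicator {..s} x \<partial>lborel) =
      ennreal (1 - exp (- s * l))" if "0 < l" for l
    using that assms emeasure_erlang_density[of l 0 s]
    by (simp add: emeasure_density erlang_CDF_0)
  have total: "(\<integral>\<^sup>+x. ennreal (exponential_density 1 x) * indicator {s<..} x \<partial>lborel) = ennreal (exp (- s))"
  proof -
    have "emeasure (density lborel (exponential_density 1)) {s<..} =
        emeasure (density lborel (exponential_density 1)) (space (density lborel (exponential_density 1)) - {..s})"
      by (rule arg_cong[where f = "emeasure _"]) auto
    also have "\<dots> = 1 - ennreal (1 - exp (- s * 1))"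
      using prob_space.emeasure_space_1[OF prob_space_exponential_density[of 1]] cdf[of 1]
      by (subst emeasure_compl) (auto simp: emeasure_density)
    also have "\<dots> = ennreal (exp (- s))"
      using assms by (simp flip: ennreal_1 add: ennreal_minus del: ennreal_1)
    finally show ?thesis by (simp add: emeasure_density)
  qed
  \<comment> \<open>The factor \<open>2 exp (- x)\<close> turns the exponential density of rate 1 into that of rate 2.\<close>
  have eq: "ennreal (exponential_density 1 x) * g x = ennreal (exponential_density 2 x) * indicator {..s} x
      + ennreal (exp (- s)) * (ennreal (exponential_density 1 x) * indicator {s<..} x)" for x
    by (auto simp: g_def exponential_density_def indicator_def algebra_simps simp flip: ennreal_mult exp_add)
  have "(\<integral>\<^sup>+\<omega>. g (L u \<omega>) \<partial>M) = ennreal (1 - exp (- s * 2)) + ennreal (exp (- s)) * ennreal (exp (- s))"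
    by (subst lifetime_nn_integral) (simp_all add: eq nn_integral_add nn_integral_cmult cdf total)
  also have "\<dots> = ennreal (1 - exp (- s * 2) + exp (- s) * exp (- s))"
    using assms by (simp flip: ennreal_mult ennreal_plus)
  also have "\<dots> = 1" by (simp flip: exp_add)
  finally show ?thesis unfolding g_def .
qed

lemma offspring_nn_integral:
  "(\<integral>\<^sup>+\<omega>. g (N u \<omega>) \<partial>M) = (\<Sum>k. ennreal (pmf p k) * g k)"
proof -
  have "(\<integral>\<^sup>+\<omega>. g (N u \<omega>) \<partial>M) = (\<integral>\<^sup>+k. g k \<partial>measure_pmf p)"
    unfolding offspring_distr[of u, symmetric]
    by (subst nn_integral_distr[OF offspring_measurable]) auto
  also have "\<dots> = (\<Sum>k. ennreal (pmf p k) * g k)"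
    by (subst nn_integral_measure_pmf) (simp add: nn_integral_count_space_nat)
  finally show ?thesis .
qed

lemma offspring_mean:
  assumes "offspring_law p"
  shows "(\<integral>\<^sup>+\<omega>. ennreal (real (N u \<omega>)) \<partial>M) = 2"
proof -
  have s: "(\<lambda>k. real k * pmf p k) sums 2" using assms by (simp add: offspring_law_def)
  have "(\<integral>\<^sup>+\<omega>. ennreal (real (N u \<omega>)) \<partial>M) = (\<Sum>k. ennreal (real k * pmf p k))"
    by (subst offspring_nn_integral) (simp add: ennreal_mult mult.commute)
  also have "\<dots> = ennreal 2"
    using sums_unique[OF s] sums_summable[OF s] by (subst suminf_ennreal2) auto
  finally show ?thesis by simp
qed

lemma offspring_second_moment:
  assumes "offspring_law p"
  shows "(\<integral>\<^sup>+\<omega>. ennreal ((real (N u \<omega>))\<^sup>2) \<partial>M) = ennreal (2 + (\<Sum>k. real k * (real k - 1) * pmf p k))"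
proof -
  have s: "(\<lambda>k. real k * pmf p k) sums 2" "summable (\<lambda>k. real k * (real k - 1) * pmf p k)"
    using assms by (simp_all add: offspring_law_def)
  have eq: "pmf p k * (real k)\<^sup>2 = real k * pmf p k + real k * (real k - 1) * pmf p k" for k
    by (simp add: power2_eq_square algebra_simps)
  have "(\<integral>\<^sup>+\<omega>. ennreal ((real (N u \<omega>))\<^sup>2) \<partial>M) = (\<Sum>k. ennreal (pmf p k * (real k)\<^sup>2))"
    by (subst offspring_nn_integral) (simp add: ennreal_mult)
  also have "\<dots> = ennreal (\<Sum>k. pmf p k * (real k)\<^sup>2)"
  proof (rule suminf_ennreal2)
    show "summable (\<lambda>k. pmf p k * (real k)\<^sup>2)"
      unfolding eq by (intro summable_add sums_summable[OF s(1)] s(2))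
  qed simp
  also have "(\<Sum>k. pmf p k * (real k)\<^sup>2) = 2 + (\<Sum>k. real k * (real k - 1) * pmf p k)"
    unfolding eq using s by (subst suminf_add[symmetric]) (auto intro: sums_summable simp: sums_unique[symmetric])
  finally show ?thesis .
qed

end


section \<open>Moments of a single edge\<close>

definition own_sources :: "label \<Rightarrow> source set" where
  "own_sources u = {Lifetime u, Offspring u, MotionX u, MotionZ u}"

text \<open>
  The CREM and branching Brownian motion at the horizon \<open>t\<close> in one framework. The clock \<open>\<Lambda>\<close> gives the
  variance accumulated up to a time, and \<open>\<alpha>\<close> is the order of the moments that are controlled.
\<close>

locale weighted_tree = branching_model M p L N W W'
  for M :: "'a measure" and p :: "nat pmf"
    and L :: "label \<Rightarrow> 'a \<Rightarrow> real" and N :: "label \<Rightarrow> 'a \<Rightarrow> nat"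
    and W W' :: "label \<Rightarrow> real \<Rightarrow> 'a \<Rightarrow> real" +
  fixes \<Lambda> :: "real \<Rightarrow> real" and t \<rho> \<sigma> \<tau> \<alpha> :: real
  assumes offspring: "offspring_law p"
    and clock_mono: "mono \<Lambda>"
    and clock_zero: "\<Lambda> 0 = 0"
    and clock_le: "0 \<le> s \<Longrightarrow> s \<le> t \<Longrightarrow> \<Lambda> s \<le> s"
    and horizon: "0 \<le> t"
    and correlation: "\<rho> \<in> {-1..1}"
    and exponent: "1 < \<alpha>" "\<alpha> \<le> 2"
    and subcritical: "moment_cost \<sigma> \<tau> \<alpha> < \<alpha> - 1"
begin

abbreviation drift :: complex where
  "drift \<equiv> growth_rate \<rho> \<sigma> \<tau> - 1"

text \<open>
  In this and the following definitions the time \<open>a\<close> of birth is an argument and not read off from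
  the sample point, since the past of a particle and its own sources will be sampled
  independently of each other. Negative durations are cut off because the motions are controlled at
  nonnegative times only.
\<close>

definition duration :: "label \<Rightarrow> real \<Rightarrow> 'a \<Rightarrow> real" where
  "duration u a \<omega> = max 0 (min (L u \<omega>) (t - a))"

definition clock_gain :: "label \<Rightarrow> real \<Rightarrow> 'a \<Rightarrow> real" where
  "clock_gain u a \<omega> = \<Lambda> (a + duration u a \<omega>) - \<Lambda> a"

definition speed :: "label \<Rightarrow> real \<Rightarrow> 'a \<Rightarrow> real" where
  "speed u a \<omega> = sqrt (clock_gain u a \<omega> / duration u a \<omega>)"

text \<open>
  The contribution of the edge of \<open>u\<close> to a summand of the partition function, together with its share
  of the normalization.
\<close>

definition edge_factor :: "label \<Rightarrow> real \<Rightarrow> 'a \<Rightarrow> complex" where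
  "edge_factor u a \<omega> = exp (- of_real (duration u a \<omega>) - drift * of_real (clock_gain u a \<omega>)) *
     boltzmann \<sigma> \<tau> (speed u a \<omega> * W u (duration u a \<omega>) \<omega>)
       (correlated \<rho> (speed u a \<omega> * W u (duration u a \<omega>) \<omega>) (speed u a \<omega> * W' u (duration u a \<omega>) \<omega>))"

text \<open>
  The number of lines that continue the line of \<open>u\<close>: its children if it dies before the horizon, and
  otherwise only the line itself, which ends there.
\<close>

definition offspring_factor :: "label \<Rightarrow> real \<Rightarrow> 'a \<Rightarrow> real" where
  "offspring_factor u a \<omega> = (if a + L u \<omega> \<le> t then real (N u \<omega>) else 1)"

lemma duration_nonneg [simp]: "0 \<le> duration u a \<omega>" by (simp add: duration_def)

lemma clock_gain_nonneg [simp]: "0 \<le> clock_gain u a \<omega>"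
  using clock_mono by (simp add: clock_gain_def monoD)

lemma clock_nonneg: "0 \<le> s \<Longrightarrow> 0 \<le> \<Lambda> s"
  using monoD[OF clock_mono, of 0 s] clock_zero by simp

lemma speed_sq_duration: "(speed u a \<omega>)\<^sup>2 * duration u a \<omega> = clock_gain u a \<omega>"
proof (cases "duration u a \<omega> = 0")
  case True
  then have "clock_gain u a \<omega> = 0" by (simp add: clock_gain_def)
  then show ?thesis using True by simp
qed (simp add: speed_def)

lemma duration_le: "a \<le> t \<Longrightarrow> a + duration u a \<omega> \<le> t" by (simp add: duration_def)

lemma clock_gain_le: "0 \<le> a \<Longrightarrow> a \<le> t \<Longrightarrow> clock_gain u a \<omega> \<le> t"
  using clock_le[of "a + duration u a \<omega>"] duration_le[of a u \<omega>] clock_nonneg[of a]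
  unfolding clock_gain_def by (smt (verit) duration_nonneg)

lemma clock_borel [measurable]: "\<Lambda> \<in> borel_measurable borel"
  using clock_mono by (rule borel_measurable_mono)

lemma duration_measurable:
  assumes [measurable]: "a \<in> borel_measurable P" "X \<in> P \<rightarrow>\<^sub>M src A" and "Lifetime u \<in> A"
  shows "(\<lambda>x. duration u (a x) (X x)) \<in> borel_measurable P"
proof -
  have [measurable]: "(\<lambda>x. L u (X x)) \<in> borel_measurable P"
    by (rule measurable_compose[OF _ lifetime_measurable_src[OF assms(3)]]) measurable
  show ?thesis unfolding duration_def by measurable
qed

lemma clock_gain_measurable:
  assumes [measurable]: "a \<in> borel_measurable P" "X \<in> P \<rightarrow>\<^sub>M src A" and "Lifetime u \<in> A"
  shows "(\<lambda>x. clock_gain u (a x) (X x)) \<in> borel_measurable P"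
proof -
  note [measurable] = duration_measurable[OF assms]
  show ?thesis unfolding clock_gain_def by measurable
qed

lemma speed_measurable:
  assumes [measurable]: "a \<in> borel_measurable P" "X \<in> P \<rightarrow>\<^sub>M src A" and "Lifetime u \<in> A"
  shows "(\<lambda>x. speed u (a x) (X x)) \<in> borel_measurable P"
proof -
  note [measurable] = duration_measurable[OF assms] clock_gain_measurable[OF assms]
  show ?thesis unfolding speed_def by measurable
qed

lemma offspring_factor_measurable:
  assumes [measurable]: "a \<in> borel_measurable P" "X \<in> P \<rightarrow>\<^sub>M src A" and "Lifetime u \<in> A" "Offspring u \<in> A"
  shows "(\<lambda>x. offspring_factor u (a x) (X x)) \<in> borel_measurable P"
proof -
  have [measurable]: "(\<lambda>x. L u (X x)) \<in> borel_measurable P"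
    by (rule measurable_compose[OF _ lifetime_measurable_src[OF assms(3)]]) measurable
  have [measurable]: "(\<lambda>x. N u (X x)) \<in> P \<rightarrow>\<^sub>M count_space UNIV"
    by (rule measurable_compose[OF _ offspring_measurable_src[OF assms(4)]]) measurable
  show ?thesis unfolding offspring_factor_def by measurable
qed

text \<open>
  The lifetime and the motion are read from two sample points \<open>Y x\<close> and \<open>X x\<close>, so that one of them can
  be integrated out.
\<close>

lemma walk_measurable:
  assumes [measurable]: "a \<in> borel_measurable P" "Y \<in> P \<rightarrow>\<^sub>M src A" "X \<in> P \<rightarrow>\<^sub>M src B"
    and "Lifetime u \<in> A"
  shows "MotionX u \<in> B \<Longrightarrow> (\<lambda>x. W u (duration u (a x) (Y x)) (X x)) \<in> borel_measurable P"
    and "MotionZ u \<in> B \<Longrightarrow> (\<lambda>x. W' u (duration u (a x) (Y x)) (X x)) \<in> borel_measurable P"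
proof -
  have [measurable]: "(\<lambda>x. L u (Y x)) \<in> borel_measurable P"
    by (rule measurable_compose[OF _ lifetime_measurable_src[OF assms(4)]]) measurable
  show "MotionX u \<in> B \<Longrightarrow> (\<lambda>x. W u (duration u (a x) (Y x)) (X x)) \<in> borel_measurable P"
    unfolding duration_def by (rule motion_x_at_random_time[of u B "\<lambda>x. min (L u (Y x)) (t - a x)"]) measurable
  show "MotionZ u \<in> B \<Longrightarrow> (\<lambda>x. W' u (duration u (a x) (Y x)) (X x)) \<in> borel_measurable P"
    unfolding duration_def by (rule motion_z_at_random_time[of u B "\<lambda>x. min (L u (Y x)) (t - a x)"]) measurable
qed

lemma edge_factor_measurable:
  assumes [measurable]: "a \<in> borel_measurable P" "X \<in> P \<rightarrow>\<^sub>M src A" and "own_sources u \<subseteq> A"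
  shows "(\<lambda>x. edge_factor u (a x) (X x)) \<in> borel_measurable P"
proof -
  have in_A: "Lifetime u \<in> A" "MotionX u \<in> A" "MotionZ u \<in> A" using assms(3) by (auto simp: own_sources_def)
  note [measurable] = duration_measurable[OF assms(1,2) in_A(1)] clock_gain_measurable[OF assms(1,2) in_A(1)]
    speed_measurable[OF assms(1,2) in_A(1)]
    walk_measurable(1)[OF assms(1,2,2) in_A(1,2)] walk_measurable(2)[OF assms(1,2,2) in_A(1,3)]
  show ?thesis unfolding edge_factor_def boltzmann_correlated by measurable
qed

lemma norm_edge_factor_powr:
  "cmod (edge_factor u a \<omega>) powr r = exp (- r * duration u a \<omega> - r * ((\<sigma>\<^sup>2 - \<tau>\<^sup>2) / 2) * clock_gain u a \<omega>) *
     exp (r * \<sigma> * speed u a \<omega> * W u (duration u a \<omega>) \<omega>)"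
  by (simp add: edge_factor_def norm_mult norm_boltzmann growth_rate_def powr_mult powr_def algebra_simps
      flip: exp_add)

text \<open>
  Given the lifetime, \<open>W u\<close> at the duration is Gaussian. The modulus forgets the oscillation in \<open>y\<close>,
  whose damping of the mean is what the \<open>\<tau>\<^sup>2\<close> in \<open>moment_cost\<close> pays for.
\<close>

lemma edge_factor_moment:
  fixes h :: "'a \<Rightarrow> ennreal"
  assumes h[measurable]: "h \<in> borel_measurable (src {Lifetime u, Offspring u})"
  shows "(\<integral>\<^sup>+\<omega>. h \<omega> * ennreal (cmod (edge_factor u a \<omega>) powr r) \<partial>M) =
    (\<integral>\<^sup>+\<omega>. h \<omega> * ennreal (exp (- r * duration u a \<omega> + moment_cost \<sigma> \<tau> r * clock_gain u a \<omega>)) \<partial>M)"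
proof -
  let ?A = "{Lifetime u, Offspring u}" and ?B = "{MotionX u}"
  let ?g = "\<lambda>\<omega>. h \<omega> * ennreal (exp (- r * duration u a \<omega> - r * ((\<sigma>\<^sup>2 - \<tau>\<^sup>2) / 2) * clock_gain u a \<omega>))"
  define f where "f = (\<lambda>(\<omega>, \<omega>'). ?g \<omega> * ennreal (exp (r * \<sigma> * speed u a \<omega> * W u (duration u a \<omega>) \<omega>')))"
  have in_A: "Lifetime u \<in> ?A" by simp
  note [measurable] = duration_measurable[OF borel_measurable_const measurable_fst in_A, of a]
    clock_gain_measurable[OF borel_measurable_const measurable_fst in_A, of a]
    speed_measurable[OF borel_measurable_const measurable_fst in_A, of a]
    walk_measurable(1)[OF borel_measurable_const measurable_fst measurable_snd in_A, of ?B a]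
  have f: "f \<in> borel_measurable (src ?A \<Otimes>\<^sub>M src ?B)"
    unfolding f_def case_prod_beta by measurable
  have "(\<integral>\<^sup>+\<omega>. h \<omega> * ennreal (cmod (edge_factor u a \<omega>) powr r) \<partial>M) = (\<integral>\<^sup>+\<omega>. f (\<omega>, \<omega>) \<partial>M)"
    by (simp add: f_def norm_edge_factor_powr ennreal_mult mult.assoc)
  also have "\<dots> = (\<integral>\<^sup>+\<omega>. \<integral>\<^sup>+\<omega>'. f (\<omega>, \<omega>') \<partial>M \<partial>M)"
    using f by (rule nn_integral_decouple[rotated]) simp
  also have "\<dots> = (\<integral>\<^sup>+\<omega>. h \<omega> * ennreal (exp (- r * duration u a \<omega> + moment_cost \<sigma> \<tau> r * clock_gain u a \<omega>)) \<partial>M)"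
  proof (rule nn_integral_cong)
    fix \<omega>
    have [measurable]: "W u (duration u a \<omega>) \<in> borel_measurable M"
      using motion_x[of u] by (simp add: brownian_motion_def)
    have "(\<integral>\<^sup>+\<omega>'. f (\<omega>, \<omega>') \<partial>M) = ?g \<omega> * ennreal (exp ((r * \<sigma> * speed u a \<omega>)\<^sup>2 * duration u a \<omega> / 2))"
      unfolding f_def by (simp add: nn_integral_cmult motion_real_exp[OF motion_x])
    also have "(r * \<sigma> * speed u a \<omega>)\<^sup>2 * duration u a \<omega> = (r * \<sigma>)\<^sup>2 * clock_gain u a \<omega>"
      unfolding speed_sq_duration[symmetric] by (simp add: power_mult_distrib)
    also have "?g \<omega> * ennreal (exp ((r * \<sigma>)\<^sup>2 * clock_gain u a \<omega> / 2)) =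
        h \<omega> * ennreal (exp (- r * duration u a \<omega> - r * ((\<sigma>\<^sup>2 - \<tau>\<^sup>2) / 2) * clock_gain u a \<omega> + (r * \<sigma>)\<^sup>2 * clock_gain u a \<omega> / 2))"
      by (simp add: exp_add ennreal_mult mult.assoc)
    also have "- r * duration u a \<omega> - r * ((\<sigma>\<^sup>2 - \<tau>\<^sup>2) / 2) * clock_gain u a \<omega> + (r * \<sigma>)\<^sup>2 * clock_gain u a \<omega> / 2 =
        - r * duration u a \<omega> + moment_cost \<sigma> \<tau> r * clock_gain u a \<omega>"
      by (simp add: moment_cost_def power2_eq_square field_simps)
    finally show "(\<integral>\<^sup>+\<omega>'. f (\<omega>, \<omega>') \<partial>M) =
      h \<omega> * ennreal (exp (- r * duration u a \<omega> + moment_cost \<sigma> \<tau> r * clock_gain u a \<omega>))" .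
  qed
  finally show ?thesis .
qed

lemma edge_factor_integrable:
  fixes g :: "'a \<Rightarrow> complex"
  assumes g[measurable]: "g \<in> borel_measurable (src {Lifetime u, Offspring u})" and int: "integrable M g"
    and a: "0 \<le> a" "a \<le> t"
  shows "integrable M (\<lambda>\<omega>. g \<omega> * edge_factor u a \<omega>)"
proof (rule integrableI_bounded)
  have [measurable]: "g \<in> borel_measurable M" using int by auto
  have [measurable]: "edge_factor u a \<in> borel_measurable M"
    by (rule edge_factor_measurable[of "\<lambda>_. a" M "\<lambda>\<omega>. \<omega>" UNIV]) auto
  show "(\<lambda>\<omega>. g \<omega> * edge_factor u a \<omega>) \<in> borel_measurable M" by measurable
  have "(\<integral>\<^sup>+\<omega>. ennreal (cmod (g \<omega> * edge_factor u a \<omega>)) \<partial>M) =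
     (\<integral>\<^sup>+\<omega>. ennreal (cmod (g \<omega>)) * ennreal (cmod (edge_factor u a \<omega>) powr 1) \<partial>M)"
    by (simp add: norm_mult ennreal_mult)
  also have "\<dots> = (\<integral>\<^sup>+\<omega>. ennreal (cmod (g \<omega>)) * ennreal (exp (- 1 * duration u a \<omega> + moment_cost \<sigma> \<tau> 1 * clock_gain u a \<omega>)) \<partial>M)"
    by (rule edge_factor_moment) measurable
  also have "\<dots> \<le> (\<integral>\<^sup>+\<omega>. ennreal (exp (\<tau>\<^sup>2 / 2 * t)) * ennreal (cmod (g \<omega>)) \<partial>M)"
  proof (rule nn_integral_mono)
    fix \<omega>
    have "moment_cost \<sigma> \<tau> 1 * clock_gain u a \<omega> \<le> \<tau>\<^sup>2 / 2 * t"
      unfolding moment_cost_def using clock_gain_le[OF a] by (intro mult_mono) auto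
    then have "- 1 * duration u a \<omega> + moment_cost \<sigma> \<tau> 1 * clock_gain u a \<omega> \<le> \<tau>\<^sup>2 / 2 * t"
      using duration_nonneg[of u a \<omega>] by linarith
    then show "ennreal (cmod (g \<omega>)) * ennreal (exp (- 1 * duration u a \<omega> + moment_cost \<sigma> \<tau> 1 * clock_gain u a \<omega>))
        \<le> ennreal (exp (\<tau>\<^sup>2 / 2 * t)) * ennreal (cmod (g \<omega>))"
      by (subst mult.commute) (intro mult_right_mono ennreal_leI, simp_all)
  qed
  also have "\<dots> = ennreal (exp (\<tau>\<^sup>2 / 2 * t)) * (\<integral>\<^sup>+\<omega>. ennreal (cmod (g \<omega>)) \<partial>M)"
    by (rule nn_integral_cmult) measurable
  also have "\<dots> < \<infinity>"
    using int by (simp add: integrable_iff_bounded ennreal_mult_less_top)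
  finally show "(\<integral>\<^sup>+\<omega>. ennreal (cmod (g \<omega> * edge_factor u a \<omega>)) \<partial>M) < \<infinity>" .
qed

lemma sqrt_correlation_sq: "(sqrt (1 - \<rho>\<^sup>2))\<^sup>2 = 1 - \<rho>\<^sup>2"
  using correlation by (simp add: abs_square_le_1 abs_le_iff)

lemma motions_complex_exp:
  fixes z z' :: complex
  assumes s: "0 \<le> s"
  shows "(\<integral>\<omega>. exp (z * of_real (W u s \<omega>)) * exp (z' * of_real (W' u s \<omega>)) \<partial>M) =
    exp (z\<^sup>2 * of_real s / 2) * exp (z'\<^sup>2 * of_real s / 2)"
proof -
  let ?A = "{MotionX u}" and ?B = "{MotionZ u}"
  define f where "f = (\<lambda>(\<omega>, \<omega>'). exp (z * of_real (W u s \<omega>)) * exp (z' * of_real (W' u s \<omega>')))"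
  have [measurable]: "W u s \<in> borel_measurable (src ?A)" "W' u s \<in> borel_measurable (src ?B)"
    using s by (auto intro: motion_x_measurable_src motion_z_measurable_src)
  have f: "f \<in> borel_measurable (src ?A \<Otimes>\<^sub>M src ?B)"
    unfolding f_def by measurable
  have meas: "W u s \<in> borel_measurable M" "W' u s \<in> borel_measurable M"
    using motion_x[of u] motion_z[of u] s by (simp_all add: brownian_motion_def)
  note [measurable] = meas
  have "integrable M (\<lambda>\<omega>. f (\<omega>, \<omega>))"
  proof (rule integrableI_bounded)
    show "(\<lambda>\<omega>. f (\<omega>, \<omega>)) \<in> borel_measurable M" unfolding f_def by simp
    have "(\<integral>\<^sup>+\<omega>. ennreal (cmod (f (\<omega>, \<omega>))) \<partial>M) = (\<integral>\<^sup>+\<omega>. \<integral>\<^sup>+\<omega>'. ennreal (cmod (f (\<omega>, \<omega>'))) \<partial>M \<partial>M)"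
      using f by (intro nn_integral_decouple[of ?A ?B "\<lambda>x. ennreal (cmod (f x))"]) auto
    also have "\<dots> = (\<integral>\<^sup>+\<omega>. ennreal (exp (Re z * W u s \<omega>)) * ennreal (exp ((Re z')\<^sup>2 * s / 2)) \<partial>M)"
      unfolding f_def
      by (simp add: norm_mult ennreal_mult nn_integral_cmult motion_real_exp[OF motion_z s])
    also have "\<dots> < \<infinity>"
      by (subst nn_integral_multc)
        (measurable, simp add: motion_real_exp[OF motion_x s] ennreal_mult_less_top)
    finally show "(\<integral>\<^sup>+\<omega>. ennreal (cmod (f (\<omega>, \<omega>))) \<partial>M) < \<infinity>" .
  qed
  then have "(\<integral>\<omega>. f (\<omega>, \<omega>) \<partial>M) = (\<integral>\<omega>. \<integral>\<omega>'. f (\<omega>, \<omega>') \<partial>M \<partial>M)"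
    by (intro integral_decouple[OF _ f]) auto
  also have "\<dots> = exp (z\<^sup>2 * of_real s / 2) * exp (z'\<^sup>2 * of_real s / 2)"
    unfolding f_def by (simp add: motion_complex_exp(2)[OF motion_z s] motion_complex_exp(2)[OF motion_x s])
  finally show ?thesis by (simp add: f_def)
qed

text \<open>
  Given the lifetime, the Gaussian integral over the motions cancels the factor with the drift.
\<close>

lemma edge_factor_mean:
  fixes g :: "'a \<Rightarrow> complex"
  assumes g[measurable]: "g \<in> borel_measurable (src {Lifetime u, Offspring u})" and int: "integrable M g"
    and a: "0 \<le> a" "a \<le> t"
  shows "(\<integral>\<omega>. g \<omega> * edge_factor u a \<omega> \<partial>M) = (\<integral>\<omega>. g \<omega> * exp (- of_real (duration u a \<omega>)) \<partial>M)"
proof -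
  let ?A = "{Lifetime u, Offspring u}" and ?B = "{MotionX u, MotionZ u}"
  define z z' where "z = complex_of_real \<sigma> + \<i> * of_real (\<tau> * \<rho>)" and "z' = \<i> * of_real (\<tau> * sqrt (1 - \<rho>\<^sup>2))"
  let ?g = "\<lambda>\<omega>. g \<omega> * exp (- of_real (duration u a \<omega>) - drift * of_real (clock_gain u a \<omega>))"
  define f where "f = (\<lambda>(\<omega>, \<omega>'). ?g \<omega> *
     (exp ((z * of_real (speed u a \<omega>)) * of_real (W u (duration u a \<omega>) \<omega>')) *
      exp ((z' * of_real (speed u a \<omega>)) * of_real (W' u (duration u a \<omega>) \<omega>'))))"
  have in_A: "Lifetime u \<in> ?A" by simp
  note [measurable] = duration_measurable[OF borel_measurable_const measurable_fst in_A, of a]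
    clock_gain_measurable[OF borel_measurable_const measurable_fst in_A, of a]
    speed_measurable[OF borel_measurable_const measurable_fst in_A, of a]
    walk_measurable[OF borel_measurable_const measurable_fst measurable_snd in_A, of ?B a]
  have f: "f \<in> borel_measurable (src ?A \<Otimes>\<^sub>M src ?B)"
    unfolding f_def case_prod_beta by measurable
  have eq: "g \<omega> * edge_factor u a \<omega> = f (\<omega>, \<omega>)" for \<omega>
    by (simp add: f_def edge_factor_def boltzmann_correlated z_def z'_def mult_ac)
  have "(\<integral>\<omega>. g \<omega> * edge_factor u a \<omega> \<partial>M) = (\<integral>\<omega>. \<integral>\<omega>'. f (\<omega>, \<omega>') \<partial>M \<partial>M)"
    unfolding eq using edge_factor_integrable[OF assms] by (intro integral_decouple[OF _ f]) (auto simp: eq)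
  also have "\<dots> = (\<integral>\<omega>. g \<omega> * exp (- of_real (duration u a \<omega>)) \<partial>M)"
  proof (rule Bochner_Integration.integral_cong[OF refl])
    fix \<omega>
    let ?G = "complex_of_real (clock_gain u a \<omega>)"
    have sq: "(y * of_real (speed u a \<omega>))\<^sup>2 * of_real (duration u a \<omega>) = y\<^sup>2 * ?G" for y
      unfolding speed_sq_duration[symmetric] by (simp add: power_mult_distrib)
    \<comment> \<open>The drift is half the variance rate of \<open>\<sigma> x + \<i> \<tau> y\<close>.\<close>
    have zz: "z\<^sup>2 + z'\<^sup>2 = 2 * drift"
    proof -
      define c where "c = sqrt (1 - \<rho>\<^sup>2)"
      have "z'\<^sup>2 = - of_real (\<tau>\<^sup>2 * c\<^sup>2)"
        unfolding z'_def c_def[symmetric] by (simp add: power_mult_distrib)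
      then have "z'\<^sup>2 = - of_real (\<tau>\<^sup>2 * (1 - \<rho>\<^sup>2))"
        unfolding c_def sqrt_correlation_sq .
      then show ?thesis
        by (simp add: z_def growth_rate_def power2_eq_square algebra_simps diff_divide_distrib)
    qed
    have "(\<integral>\<omega>'. f (\<omega>, \<omega>') \<partial>M) = ?g \<omega> * (exp (z\<^sup>2 * ?G / 2) * exp (z'\<^sup>2 * ?G / 2))"
      unfolding f_def by (simp add: motions_complex_exp sq)
    also have "\<dots> = g \<omega> * exp (- of_real (duration u a \<omega>) - drift * ?G + (z\<^sup>2 + z'\<^sup>2) * ?G / 2)"
      by (simp add: exp_add add_divide_distrib distrib_right)
    also have "\<dots> = g \<omega> * exp (- of_real (duration u a \<omega>))"
      unfolding zz by (simp only: mult.assoc nonzero_mult_div_cancel_left[OF zero_neq_numeral[symmetric]] diff_add_cancel)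
    finally show "(\<integral>\<omega>'. f (\<omega>, \<omega>') \<partial>M) = g \<omega> * exp (- of_real (duration u a \<omega>))" .
  qed
  finally show ?thesis .
qed

definition cost :: real where "cost = moment_cost \<sigma> \<tau> \<alpha>"

definition decay_rate :: real where "decay_rate = \<alpha> - cost"

lemma cost_nonneg: "0 \<le> cost"
  using exponent by (simp add: cost_def moment_cost_def)

lemma decay_rate_gt_1: "1 < decay_rate"
  using subcritical by (simp add: decay_rate_def cost_def)

lemma offspring_factor_nonneg [simp]: "0 \<le> offspring_factor u a \<omega>" by (simp add: offspring_factor_def)

lemma duration_eq_lifetime: "\<omega> \<in> space M \<Longrightarrow> a + L u \<omega> \<le> t \<Longrightarrow> duration u a \<omega> = L u \<omega>"
  using lifetime_positive[of \<omega> u] by (simp add: duration_def)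

lemma duration_eq_remaining: "a \<le> t \<Longrightarrow> t < a + L u \<omega> \<Longrightarrow> duration u a \<omega> = t - a"
  by (simp add: duration_def)

lemma lifetime_measurable [measurable]: "L u \<in> borel_measurable M"
  by (rule measurable_src_imp[OF lifetime_measurable_src[of u UNIV]]) simp

declare offspring_measurable [measurable]

lemma offspring_factor_mean:
  assumes a: "0 \<le> a" "a \<le> t"
  shows "(\<integral>\<^sup>+\<omega>. ennreal (offspring_factor u a \<omega> * exp (- duration u a \<omega>)) \<partial>M) = 1"
proof -
  let ?A = "{Lifetime u}" and ?B = "{Offspring u}"
  define f where "f = (\<lambda>(\<omega>, \<omega>'). (if a + L u \<omega> \<le> t then ennreal (real (N u \<omega>')) else 1) * ennreal (exp (- duration u a \<omega>)))"
  have in_A: "Lifetime u \<in> ?A" by simp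
  note [measurable] = duration_measurable[OF borel_measurable_const measurable_fst in_A, of a]
    measurable_compose[OF measurable_snd offspring_measurable_src[of u ?B]]
    measurable_compose[OF measurable_fst lifetime_measurable_src[of u ?A]]
  have f: "f \<in> borel_measurable (src ?A \<Otimes>\<^sub>M src ?B)"
    unfolding f_def case_prod_beta by measurable
  have "(\<integral>\<^sup>+\<omega>. ennreal (offspring_factor u a \<omega> * exp (- duration u a \<omega>)) \<partial>M) = (\<integral>\<^sup>+\<omega>. f (\<omega>, \<omega>) \<partial>M)"
    by (intro nn_integral_cong) (simp add: f_def offspring_factor_def ennreal_mult)
  also have "\<dots> = (\<integral>\<^sup>+\<omega>. \<integral>\<^sup>+\<omega>'. f (\<omega>, \<omega>') \<partial>M \<partial>M)"
    using f by (rule nn_integral_decouple[rotated]) simp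
  also have "\<dots> = (\<integral>\<^sup>+\<omega>. (if L u \<omega> \<le> t - a then ennreal (2 * exp (- L u \<omega>)) else ennreal (exp (- (t - a)))) \<partial>M)"
  proof (rule nn_integral_cong)
    fix \<omega> assume \<omega>: "\<omega> \<in> space M"
    show "(\<integral>\<^sup>+\<omega>'. f (\<omega>, \<omega>') \<partial>M) = (if L u \<omega> \<le> t - a then ennreal (2 * exp (- L u \<omega>)) else ennreal (exp (- (t - a))))"
      using a duration_eq_lifetime[OF \<omega>, of a u] duration_eq_remaining[of a u \<omega>]
      by (auto simp: f_def nn_integral_multc offspring_mean[OF offspring] ennreal_mult emeasure_space_1)
  qed
  also have "\<dots> = 1" using a by (intro lifetime_branching_balance) simp
  finally show ?thesis .
qed

lemma offspring_integrable: "integrable M (\<lambda>\<omega>. real (N u \<omega>))"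
  using offspring_mean[OF offspring, of u] by (intro integrableI_bounded) auto

lemma offspring_factor_integrable: "integrable M (offspring_factor u a)"
proof (rule Bochner_Integration.integrable_bound)
  show "integrable M (\<lambda>\<omega>. 1 + real (N u \<omega>))"
    using offspring_integrable by (intro Bochner_Integration.integrable_add) auto
  show "offspring_factor u a \<in> borel_measurable M" unfolding offspring_factor_def by measurable
qed (auto simp: offspring_factor_def)

text \<open>
  The reason why the increments below are centred: on average, the descendants of a particle
  contribute as much as the particle itself.
\<close>

lemma branching_edge_mean:
  assumes a: "0 \<le> a" "a \<le> t"
  shows "integrable M (\<lambda>\<omega>. of_real (offspring_factor u a \<omega>) * edge_factor u a \<omega>)"
    and "(\<integral>\<omega>. of_real (offspring_factor u a \<omega>) * edge_factor u a \<omega> \<partial>M) = 1"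
proof -
  have in_A: "Lifetime u \<in> {Lifetime u, Offspring u}" "Offspring u \<in> {Lifetime u, Offspring u}" by auto
  have g: "(\<lambda>\<omega>. complex_of_real (offspring_factor u a \<omega>)) \<in> borel_measurable (src {Lifetime u, Offspring u})"
    using offspring_factor_measurable[OF borel_measurable_const measurable_ident[unfolded id_def] in_A, of a] by measurable
  have int: "integrable M (\<lambda>\<omega>. complex_of_real (offspring_factor u a \<omega>))"
    using offspring_factor_integrable by simp
  show "integrable M (\<lambda>\<omega>. of_real (offspring_factor u a \<omega>) * edge_factor u a \<omega>)"
    using edge_factor_integrable[OF g int a] .
  have [measurable]: "offspring_factor u a \<in> borel_measurable M" "duration u a \<in> borel_measurable M"
    unfolding offspring_factor_def duration_def by measurable
  have "(\<integral>\<omega>. of_real (offspring_factor u a \<omega>) * edge_factor u a \<omega> \<partial>M) = (\<integral>\<omega>. of_real (offspring_factor u a \<omega>) * exp (- of_real (duration u a \<omega>)) \<partial>M)"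
    using edge_factor_mean[OF g int a] .
  also have "\<dots> = of_real (\<integral>\<omega>. offspring_factor u a \<omega> * exp (- duration u a \<omega>) \<partial>M)"
    by (simp flip: integral_complex_of_real exp_of_real)
  also have "(\<integral>\<omega>. offspring_factor u a \<omega> * exp (- duration u a \<omega>) \<partial>M) = 1"
    by (subst integral_eq_nn_integral) (auto simp: offspring_factor_mean[OF a])
  finally show "(\<integral>\<omega>. of_real (offspring_factor u a \<omega>) * edge_factor u a \<omega> \<partial>M) = 1" by simp
qed

text \<open>
  The \<open>\<alpha>\<close>-th power of the edge factor, enlarged by the moment cost of the time that the clock has not
  used. This makes the expectation depend on the duration alone, so that the bounds become uniform
  in the clock.
\<close>

definition tilted_factor :: "label \<Rightarrow> real \<Rightarrow> 'a \<Rightarrow> real" where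
  "tilted_factor u a \<omega> = cmod (edge_factor u a \<omega>) powr \<alpha> * exp (cost * (duration u a \<omega> - clock_gain u a \<omega>))"

lemma tilted_factor_nonneg [simp]: "0 \<le> tilted_factor u a \<omega>" by (simp add: tilted_factor_def)

lemma tilted_factor_measurable:
  assumes "a \<in> borel_measurable P" "X \<in> P \<rightarrow>\<^sub>M src A" and "own_sources u \<subseteq> A"
  shows "(\<lambda>x. tilted_factor u (a x) (X x)) \<in> borel_measurable P"
proof -
  have in_A: "Lifetime u \<in> A" using assms(3) by (auto simp: own_sources_def)
  note [measurable] = edge_factor_measurable[OF assms] duration_measurable[OF assms(1,2) in_A] clock_gain_measurable[OF assms(1,2) in_A]
  show ?thesis unfolding tilted_factor_def by measurable
qed

lemma tilted_factor_moment:
  fixes h :: "'a \<Rightarrow> ennreal"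
  assumes h[measurable]: "h \<in> borel_measurable (src {Lifetime u, Offspring u})"
  shows "(\<integral>\<^sup>+\<omega>. h \<omega> * ennreal (tilted_factor u a \<omega>) \<partial>M) = (\<integral>\<^sup>+\<omega>. h \<omega> * ennreal (exp (- decay_rate * duration u a \<omega>)) \<partial>M)"
proof -
  have in_A: "Lifetime u \<in> {Lifetime u, Offspring u}" by auto
  note [measurable] = duration_measurable[OF borel_measurable_const measurable_ident[unfolded id_def] in_A, of a]
    clock_gain_measurable[OF borel_measurable_const measurable_ident[unfolded id_def] in_A, of a]
  have "(\<integral>\<^sup>+\<omega>. h \<omega> * ennreal (tilted_factor u a \<omega>) \<partial>M) =
     (\<integral>\<^sup>+\<omega>. (h \<omega> * ennreal (exp (cost * (duration u a \<omega> - clock_gain u a \<omega>)))) * ennreal (cmod (edge_factor u a \<omega>) powr \<alpha>) \<partial>M)"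
    by (simp add: tilted_factor_def ennreal_mult mult_ac)
  also have "\<dots> = (\<integral>\<^sup>+\<omega>. (h \<omega> * ennreal (exp (cost * (duration u a \<omega> - clock_gain u a \<omega>)))) *
       ennreal (exp (- \<alpha> * duration u a \<omega> + moment_cost \<sigma> \<tau> \<alpha> * clock_gain u a \<omega>)) \<partial>M)"
    by (rule edge_factor_moment) measurable
  also have "\<dots> = (\<integral>\<^sup>+\<omega>. h \<omega> * ennreal (exp (- decay_rate * duration u a \<omega>)) \<partial>M)"
    by (simp add: mult.assoc decay_rate_def cost_def algebra_simps flip: ennreal_mult exp_add)
  finally show ?thesis .
qed

text \<open>
  The probability that a particle has a child number \<open>j\<close>, times the Laplace transform of its lifetime
  at \<open>decay_rate\<close>.
\<close>

definition child_ratio :: "nat \<Rightarrow> real" where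
  "child_ratio j = measure (measure_pmf p) {j<..} / (1 + decay_rate)"

lemma child_ratio_nonneg [simp]: "0 \<le> child_ratio j"
  using decay_rate_gt_1 by (simp add: child_ratio_def)

lemma indicator_offspring_measurable:
  assumes "Y \<in> P \<rightarrow>\<^sub>M count_space UNIV"
  shows "(\<lambda>x. indicator {j<..} (Y x :: nat) :: ennreal) \<in> borel_measurable P"
  by (rule measurable_compose[OF assms]) simp

lemma prob_offspring_gt: "(\<integral>\<^sup>+\<omega>. indicator {j<..} (N u \<omega>) \<partial>M) = ennreal (measure (measure_pmf p) {j<..})"
proof -
  have "(\<integral>\<^sup>+\<omega>. indicator {j<..} (N u \<omega>) \<partial>M) = (\<integral>\<^sup>+k. indicator {j<..} k \<partial>distr M (count_space UNIV) (N u))"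
    by (subst nn_integral_distr[OF offspring_measurable]) auto
  also have "\<dots> = emeasure (measure_pmf p) {j<..}"
    unfolding offspring_distr by simp
  finally show ?thesis by (simp add: measure_pmf.emeasure_eq_measure)
qed

lemma sum_child_ratio_le: "(\<Sum>j<b. child_ratio j) \<le> 2 / (1 + decay_rate)"
proof -
  have "ennreal (\<Sum>j<b. measure (measure_pmf p) {j<..}) = (\<Sum>j<b. \<integral>\<^sup>+\<omega>. indicator {j<..} (N [] \<omega>) \<partial>M)"
    by (subst sum_ennreal[symmetric]) (auto simp: prob_offspring_gt)
  also have "\<dots> = (\<integral>\<^sup>+\<omega>. (\<Sum>j<b. indicator {j<..} (N [] \<omega>)) \<partial>M)"
    by (subst nn_integral_sum) (auto intro: indicator_offspring_measurable offspring_measurable)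
  also have "\<dots> \<le> (\<integral>\<^sup>+\<omega>. ennreal (real (N [] \<omega>)) \<partial>M)"
  proof (rule nn_integral_mono)
    fix \<omega>
    have "(\<Sum>j<b. indicator {j<..} (N [] \<omega>) :: ennreal) = of_nat (card {j. j < b \<and> j < N [] \<omega>})"
      by (simp add: indicator_def sum.If_cases Int_def)
    also have "\<dots> \<le> of_nat (N [] \<omega>)"
      by (intro of_nat_mono) (auto intro: order_trans[OF card_mono[of "{..<N [] \<omega>}"]])
    finally show "(\<Sum>j<b. indicator {j<..} (N [] \<omega>)) \<le> ennreal (real (N [] \<omega>))"
      by (simp add: ennreal_of_nat_eq_real_of_nat)
  qed
  also have "\<dots> = ennreal 2" using offspring_mean[OF offspring] by simp
  finally have "(\<Sum>j<b. measure (measure_pmf p) {j<..}) \<le> 2"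
    by (subst (asm) ennreal_le_iff) auto
  then show ?thesis using decay_rate_gt_1
    unfolding child_ratio_def by (simp flip: sum_divide_distrib add: divide_right_mono)
qed

lemma tilted_factor_child_le:
  "(\<integral>\<^sup>+\<omega>. ennreal (if j < N u \<omega> \<and> a + L u \<omega> \<le> t then tilted_factor u a \<omega> else 0) \<partial>M) \<le> ennreal (child_ratio j)"
proof -
  let ?A = "{Lifetime u}" and ?B = "{Offspring u}"
  define h where "h \<omega> = (if j < N u \<omega> \<and> a + L u \<omega> \<le> t then 1 else 0 :: ennreal)" for \<omega>
  note [measurable] = offspring_measurable_src[of u "{Lifetime u, Offspring u}", simplified]
    lifetime_measurable_src[of u "{Lifetime u, Offspring u}", simplified]
  have h: "h \<in> borel_measurable (src {Lifetime u, Offspring u})" unfolding h_def by measurable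
  have [measurable]: "(\<lambda>\<omega>. N u (snd \<omega>)) \<in> src ?A \<Otimes>\<^sub>M src ?B \<rightarrow>\<^sub>M count_space UNIV"
    "(\<lambda>\<omega>. L u (fst \<omega>)) \<in> borel_measurable (src ?A \<Otimes>\<^sub>M src ?B)"
    by (auto intro: measurable_compose[OF measurable_snd offspring_measurable_src]
      measurable_compose[OF measurable_fst lifetime_measurable_src])
  note [measurable] = indicator_offspring_measurable[OF this(1), of j]
  have f: "(\<lambda>x. ennreal (exp (- decay_rate * L u (fst x))) * indicator {j<..} (N u (snd x)))
      \<in> borel_measurable (src ?A \<Otimes>\<^sub>M src ?B)"
    by measurable
  have "(\<integral>\<^sup>+\<omega>. ennreal (if j < N u \<omega> \<and> a + L u \<omega> \<le> t then tilted_factor u a \<omega> else 0) \<partial>M) =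
     (\<integral>\<^sup>+\<omega>. h \<omega> * ennreal (tilted_factor u a \<omega>) \<partial>M)"
    by (intro nn_integral_cong) (simp add: h_def)
  also have "\<dots> = (\<integral>\<^sup>+\<omega>. h \<omega> * ennreal (exp (- decay_rate * duration u a \<omega>)) \<partial>M)"
    using h by (rule tilted_factor_moment)
  also have "\<dots> \<le> (\<integral>\<^sup>+\<omega>. ennreal (exp (- decay_rate * L u \<omega>)) * indicator {j<..} (N u \<omega>) \<partial>M)"
    by (intro nn_integral_mono) (auto simp: h_def duration_eq_lifetime)
  also have "\<dots> = (\<integral>\<^sup>+\<omega>. \<integral>\<^sup>+\<omega>'. ennreal (exp (- decay_rate * L u \<omega>)) * indicator {j<..} (N u \<omega>') \<partial>M \<partial>M)"
    using nn_integral_decouple[OF _ f] by simp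
  also have "\<dots> = (\<integral>\<^sup>+\<omega>. ennreal (exp (- decay_rate * L u \<omega>)) * ennreal (measure (measure_pmf p) {j<..}) \<partial>M)"
    by (simp add: nn_integral_cmult prob_offspring_gt indicator_offspring_measurable[OF offspring_measurable])
  also have "\<dots> = ennreal (1 / (1 + decay_rate)) * ennreal (measure (measure_pmf p) {j<..})"
    using lifetime_laplace[of decay_rate u] decay_rate_gt_1 by (subst nn_integral_multc) auto
  also have "\<dots> = ennreal (child_ratio j)"
    using decay_rate_gt_1 by (simp add: child_ratio_def flip: ennreal_mult)
  finally show ?thesis .
qed

text \<open>
  This is 1 plus the second moment of the offspring law.
\<close>

definition branching_moment :: real where
  "branching_moment = 3 + (\<Sum>k. real k * (real k - 1) * pmf p k)"

lemma branching_moment_ge_1: "1 \<le> branching_moment"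
proof -
  have "0 \<le> real k * (real k - 1) * pmf p k" for k by (cases k) auto
  then have "0 \<le> (\<Sum>k. real k * (real k - 1) * pmf p k)"
    using offspring by (intro suminf_nonneg) (auto simp: offspring_law_def)
  then show ?thesis by (simp add: branching_moment_def)
qed

lemma branching_moment_nonneg: "0 \<le> branching_moment"
  using branching_moment_ge_1 by simp

lemma tilted_factor_offspring_le:
  "(\<integral>\<^sup>+\<omega>. ennreal (offspring_factor u a \<omega> powr \<alpha> * tilted_factor u a \<omega>) \<partial>M) \<le> ennreal branching_moment"
proof -
  have in_A: "Lifetime u \<in> {Lifetime u, Offspring u}" "Offspring u \<in> {Lifetime u, Offspring u}" by auto
  note [measurable] = offspring_factor_measurable[OF borel_measurable_const measurable_ident[unfolded id_def] in_A, of a]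
  have "(\<integral>\<^sup>+\<omega>. ennreal (offspring_factor u a \<omega> powr \<alpha> * tilted_factor u a \<omega>) \<partial>M) =
    (\<integral>\<^sup>+\<omega>. ennreal (offspring_factor u a \<omega> powr \<alpha>) * ennreal (tilted_factor u a \<omega>) \<partial>M)"
    by (simp add: ennreal_mult)
  also have "\<dots> = (\<integral>\<^sup>+\<omega>. ennreal (offspring_factor u a \<omega> powr \<alpha>) * ennreal (exp (- decay_rate * duration u a \<omega>)) \<partial>M)"
    by (rule tilted_factor_moment) measurable
  also have "\<dots> \<le> (\<integral>\<^sup>+\<omega>. 1 + ennreal ((real (N u \<omega>))\<^sup>2) \<partial>M)"
  proof (rule nn_integral_mono)
    fix \<omega>
    have "real k powr \<alpha> \<le> (real k)\<^sup>2" for k :: nat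
    proof (cases "k = 0")
      case False
      then have "real k powr \<alpha> \<le> real k powr 2" using exponent by (intro powr_mono) auto
      then show ?thesis using False by simp
    qed simp
    then have "offspring_factor u a \<omega> powr \<alpha> \<le> 1 + (real (N u \<omega>))\<^sup>2"
      by (auto simp: offspring_factor_def intro: order_trans add_increasing)
    moreover have "exp (- decay_rate * duration u a \<omega>) \<le> 1" using decay_rate_gt_1 by simp
    ultimately have "offspring_factor u a \<omega> powr \<alpha> * exp (- decay_rate * duration u a \<omega>) \<le> (1 + (real (N u \<omega>))\<^sup>2) * 1"
      by (intro mult_mono) auto
    then have "ennreal (offspring_factor u a \<omega> powr \<alpha> * exp (- decay_rate * duration u a \<omega>)) \<le> ennreal (1 + (real (N u \<omega>))\<^sup>2)"
      by (intro ennreal_leI) simp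
    then show "ennreal (offspring_factor u a \<omega> powr \<alpha>) * ennreal (exp (- decay_rate * duration u a \<omega>)) \<le> 1 + ennreal ((real (N u \<omega>))\<^sup>2)"
      by (simp add: ennreal_mult)
  qed
  also have "\<dots> = 1 + ennreal (branching_moment - 1)"
    by (simp add: nn_integral_add emeasure_space_1 offspring_second_moment[OF offspring] branching_moment_def)
  also have "\<dots> = ennreal branching_moment"
    using branching_moment_ge_1 by (simp flip: ennreal_1 ennreal_plus del: ennreal_1)
  finally show ?thesis .
qed


section \<open>Increments along the tree\<close>

abbreviation born :: "label \<Rightarrow> 'a \<Rightarrow> real" where
  "born u \<omega> \<equiv> birth (\<lambda>v. L v \<omega>) u"

definition present :: "label \<Rightarrow> 'a \<Rightarrow> bool" where
  "present u \<omega> \<longleftrightarrow> in_tree (\<lambda>v. N v \<omega>) u \<and> born u \<omega> \<le> t"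

definition line_weight :: "label \<Rightarrow> 'a \<Rightarrow> complex" where
  "line_weight u \<omega> = (\<Prod>i<length u. edge_factor (take i u) (born (take i u) \<omega>) \<omega>)"

definition tilted_line :: "label \<Rightarrow> 'a \<Rightarrow> real" where
  "tilted_line u \<omega> = (\<Prod>i<length u. tilted_factor (take i u) (born (take i u) \<omega>) \<omega>)"

text \<open>
  When the sources of \<open>u\<close> are revealed, its weight is replaced by the total weight of its children or,
  if it survives up to the horizon, by its summand.
\<close>

definition increment :: "label \<Rightarrow> 'a \<Rightarrow> complex" where
  "increment u \<omega> = (if present u \<omega> then
     line_weight u \<omega> * (of_real (offspring_factor u (born u \<omega>) \<omega>) * edge_factor u (born u \<omega>) \<omega> - 1) else 0)"

definition tilted_weight :: "label \<Rightarrow> 'a \<Rightarrow> real" where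
  "tilted_weight u \<omega> = (if present u \<omega> then tilted_line u \<omega> else 0)"

lemma born_Nil [simp]: "born [] \<omega> = 0" by (simp add: birth_def)

lemma born_snoc [simp]: "born (u @ [j]) \<omega> = born u \<omega> + L u \<omega>"
  by (simp add: birth_def)

lemma in_tree_Nil [simp]: "in_tree K []" by (simp add: in_tree_def)

lemma in_tree_snoc [simp]: "in_tree K (u @ [j]) \<longleftrightarrow> in_tree K u \<and> j < K u"
  by (auto simp: in_tree_def nth_append less_Suc_eq)

lemma line_weight_Nil [simp]: "line_weight [] \<omega> = 1" by (simp add: line_weight_def)

lemma line_weight_snoc [simp]: "line_weight (u @ [j]) \<omega> = line_weight u \<omega> * edge_factor u (born u \<omega>) \<omega>"
  by (simp add: line_weight_def)

lemma tilted_line_Nil [simp]: "tilted_line [] \<omega> = 1" by (simp add: tilted_line_def)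

lemma tilted_line_snoc [simp]: "tilted_line (u @ [j]) \<omega> = tilted_line u \<omega> * tilted_factor u (born u \<omega>) \<omega>"
  by (simp add: tilted_line_def)

lemma tilted_line_nonneg [simp]: "0 \<le> tilted_line u \<omega>"
  by (simp add: tilted_line_def prod_nonneg)

lemma tilted_weight_nonneg [simp]: "0 \<le> tilted_weight u \<omega>"
  by (simp add: tilted_weight_def)

lemma born_nonneg: "\<omega> \<in> space M \<Longrightarrow> 0 \<le> born u \<omega>"
  unfolding birth_def by (intro sum_nonneg) (auto intro: less_imp_le lifetime_positive)

lemma present_Nil [simp]: "present [] \<omega>"
  using horizon by (simp add: present_def)

lemma present_snoc:
  "\<omega> \<in> space M \<Longrightarrow> present (u @ [j]) \<omega> \<longleftrightarrow> present u \<omega> \<and> j < N u \<omega> \<and> born u \<omega> + L u \<omega> \<le> t"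
  using lifetime_positive[of \<omega> u] by (auto simp: present_def)

lemma born_measurable_src:
  assumes "\<And>i. i < length u \<Longrightarrow> own_sources (take i u) \<subseteq> A"
  shows "born u \<in> borel_measurable (src A)"
  unfolding birth_def using assms
  by (intro borel_measurable_sum lifetime_measurable_src) (auto simp: own_sources_def)

lemma present_measurable_src:
  assumes "\<And>i. i < length u \<Longrightarrow> own_sources (take i u) \<subseteq> A"
  shows "Measurable.pred (src A) (present u)"
proof -
  have [measurable]: "born u \<in> borel_measurable (src A)" using assms by (rule born_measurable_src)
  have [measurable]: "i < length u \<Longrightarrow> N (take i u) \<in> src A \<rightarrow>\<^sub>M count_space UNIV" for i
    using assms[of i] by (intro offspring_measurable_src) (auto simp: own_sources_def)
  have "Measurable.pred (src A) (\<lambda>\<omega>. \<forall>i\<in>{..<length u}. u ! i < N (take i u) \<omega>)"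
    by (rule pred_intros_finite(3)) auto
  then show ?thesis unfolding present_def in_tree_def by (simp add: Ball_def) measurable
qed

lemma born_take_measurable_src:
  assumes "\<And>i. i < length u \<Longrightarrow> own_sources (take i u) \<subseteq> A" "i \<le> length u"
  shows "born (take i u) \<in> borel_measurable (src A)"
proof (rule born_measurable_src)
  fix k assume "k < length (take i u)"
  then show "own_sources (take k (take i u)) \<subseteq> A"
    using assms(1)[of k] by (simp add: min.absorb1)
qed

lemma line_weight_measurable_src:
  assumes "\<And>i. i < length u \<Longrightarrow> own_sources (take i u) \<subseteq> A"
  shows "line_weight u \<in> borel_measurable (src A)"
  unfolding line_weight_def
  by (intro borel_measurable_prod edge_factor_measurable[where A = A] born_take_measurable_src[OF assms]) (use assms in auto)

lemma tilted_line_measurable_src: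
  assumes "\<And>i. i < length u \<Longrightarrow> own_sources (take i u) \<subseteq> A"
  shows "tilted_line u \<in> borel_measurable (src A)"
  unfolding tilted_line_def
  by (intro borel_measurable_prod tilted_factor_measurable[where A = A] born_take_measurable_src[OF assms]) (use assms in auto)

lemma tilted_weight_measurable_src:
  assumes "\<And>i. i < length u \<Longrightarrow> own_sources (take i u) \<subseteq> A"
  shows "tilted_weight u \<in> borel_measurable (src A)"
  using present_measurable_src[OF assms] tilted_line_measurable_src[OF assms]
  unfolding tilted_weight_def by measurable

lemma increment_measurable_src:
  assumes "\<And>i. i \<le> length u \<Longrightarrow> own_sources (take i u) \<subseteq> A"
  shows "increment u \<in> borel_measurable (src A)"
proof -
  have pre: "\<And>i. i < length u \<Longrightarrow> own_sources (take i u) \<subseteq> A" using assms by simp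
  have own_sources: "own_sources u \<subseteq> A" using assms[of "length u"] by simp
  note [measurable] = present_measurable_src[OF pre] line_weight_measurable_src[OF pre] born_measurable_src[OF pre]
    edge_factor_measurable[OF born_measurable_src[OF pre] measurable_ident[unfolded id_def] own_sources]
    offspring_factor_measurable[OF born_measurable_src[OF pre] measurable_ident[unfolded id_def]]
  have [measurable]: "(\<lambda>\<omega>. offspring_factor u (born u \<omega>) \<omega>) \<in> borel_measurable (src A)"
    by (rule offspring_factor_measurable[OF born_measurable_src[OF pre] measurable_ident[unfolded id_def]])
      (use own_sources in \<open>auto simp: own_sources_def\<close>)
  show ?thesis unfolding increment_def by measurable
qed

lemma measurable_M [measurable]:
  "born u \<in> borel_measurable M" "Measurable.pred M (present u)" "line_weight u \<in> borel_measurable M"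
  "tilted_weight u \<in> borel_measurable M" "increment u \<in> borel_measurable M"
proof -
  show "Measurable.pred M (present u)"
    by (rule measurable_src_imp[OF present_measurable_src[of u UNIV]]) simp
  show "born u \<in> borel_measurable M" by (rule measurable_src_imp[OF born_measurable_src[of u UNIV]]) simp
  show "line_weight u \<in> borel_measurable M" by (rule measurable_src_imp[OF line_weight_measurable_src[of u UNIV]]) simp
  show "tilted_weight u \<in> borel_measurable M" by (rule measurable_src_imp[OF tilted_weight_measurable_src[of u UNIV]]) simp
  show "increment u \<in> borel_measurable M" by (rule measurable_src_imp[OF increment_measurable_src[of u UNIV]]) simp
qed

definition other_sources :: "label \<Rightarrow> source set" where
  "other_sources v = (\<Union>u\<in>-{v}. own_sources u)"

lemma other_own_sources_disjoint: "other_sources v \<inter> own_sources v = {}"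
  by (auto simp: other_sources_def own_sources_def)

lemma own_sources_subset_other: "u \<noteq> v \<Longrightarrow> own_sources u \<subseteq> other_sources v"
  by (auto simp: other_sources_def)

lemma own_sources_take_subset_other: "i < length v \<Longrightarrow> own_sources (take i v) \<subseteq> other_sources v"
  by (rule own_sources_subset_other) (metis length_take min.absorb4 nat_neq_iff)

text \<open>
  The last edge is integrated out first. Given its ancestors, this contributes at most \<open>child_ratio j\<close>
  for the \<open>j\<close>-th child, whatever the time of birth.
\<close>

lemma tilted_weight_mean_le:
  "(\<integral>\<^sup>+\<omega>. ennreal (tilted_weight u \<omega>) \<partial>M) \<le> ennreal (\<Prod>i<length u. child_ratio (u ! i))"
proof (induction u rule: rev_induct)
  case Nil
  then show ?case by (simp add: tilted_weight_def emeasure_space_1)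
next
  case (snoc j v)
  note meas = tilted_weight_measurable_src[OF own_sources_take_subset_other[of _ v]] born_measurable_src[OF own_sources_take_subset_other[of _ v]]
  define f where "f = (\<lambda>(\<omega>, \<omega>'). ennreal (tilted_weight v \<omega>) *
     ennreal (if j < N v \<omega>' \<and> born v \<omega> + L v \<omega>' \<le> t then tilted_factor v (born v \<omega>) \<omega>' else 0))"
  note [measurable] = measurable_compose[OF measurable_fst meas(1)]
    measurable_compose[OF measurable_fst meas(2)]
    measurable_compose[OF measurable_snd offspring_measurable_src[of v "own_sources v"]]
    measurable_compose[OF measurable_snd lifetime_measurable_src[of v "own_sources v"]]
    tilted_factor_measurable[OF measurable_compose[OF measurable_fst meas(2)] measurable_snd, where A = "own_sources v" and u = v]
  have [simp]: "Lifetime v \<in> own_sources v" "Offspring v \<in> own_sources v" by (auto simp: own_sources_def)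
  have f: "f \<in> borel_measurable (src (other_sources v) \<Otimes>\<^sub>M src (own_sources v))"
    unfolding f_def case_prod_beta by measurable
  have "(\<integral>\<^sup>+\<omega>. ennreal (tilted_weight (v @ [j]) \<omega>) \<partial>M) = (\<integral>\<^sup>+\<omega>. f (\<omega>, \<omega>) \<partial>M)"
    by (intro nn_integral_cong) (simp add: f_def tilted_weight_def present_snoc flip: ennreal_mult)
  also have "\<dots> = (\<integral>\<^sup>+\<omega>. \<integral>\<^sup>+\<omega>'. f (\<omega>, \<omega>') \<partial>M \<partial>M)"
    by (rule nn_integral_decouple[OF other_own_sources_disjoint f])
  also have "\<dots> \<le> (\<integral>\<^sup>+\<omega>. ennreal (tilted_weight v \<omega>) * ennreal (child_ratio j) \<partial>M)"
  proof (rule nn_integral_mono)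
    fix \<omega>
    have [measurable]: "tilted_factor v (born v \<omega>) \<in> borel_measurable M"
      by (rule tilted_factor_measurable[of "\<lambda>_. born v \<omega>" M "\<lambda>\<omega>. \<omega>" UNIV]) auto
    have "(\<integral>\<^sup>+\<omega>'. f (\<omega>, \<omega>') \<partial>M) = ennreal (tilted_weight v \<omega>) *
        (\<integral>\<^sup>+\<omega>'. ennreal (if j < N v \<omega>' \<and> born v \<omega> + L v \<omega>' \<le> t then tilted_factor v (born v \<omega>) \<omega>' else 0) \<partial>M)"
      unfolding f_def prod.case by (rule nn_integral_cmult) measurable
    also have "\<dots> \<le> ennreal (tilted_weight v \<omega>) * ennreal (child_ratio j)"
      by (intro mult_left_mono tilted_factor_child_le) simp
    finally show "(\<integral>\<^sup>+\<omega>'. f (\<omega>, \<omega>') \<partial>M) \<le> ennreal (tilted_weight v \<omega>) * ennreal (child_ratio j)" .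
  qed
  also have "\<dots> = (\<integral>\<^sup>+\<omega>. ennreal (tilted_weight v \<omega>) \<partial>M) * ennreal (child_ratio j)"
    by (rule nn_integral_multc) measurable
  also have "\<dots> \<le> ennreal (\<Prod>i<length v. child_ratio (v ! i)) * ennreal (child_ratio j)"
    using snoc by (intro mult_right_mono) auto
  also have "\<dots> = ennreal (\<Prod>i<length (v @ [j]). child_ratio ((v @ [j]) ! i))"
    by (simp add: nth_append prod_nonneg flip: ennreal_mult)
  finally show ?case .
qed

text \<open>
  The enlargements of the tilted factors telescope along the ancestral line.
\<close>

lemma norm_line_weight_powr:
  assumes "\<omega> \<in> space M" "present u \<omega>"
  shows "cmod (line_weight u \<omega>) powr \<alpha> = tilted_line u \<omega> * exp (- cost * (born u \<omega> - \<Lambda> (born u \<omega>)))"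
  using assms(2)
proof (induction u rule: rev_induct)
  case Nil
  then show ?case using clock_zero by simp
next
  case (snoc j v)
  then have v: "present v \<omega>" "born v \<omega> + L v \<omega> \<le> t" using present_snoc[OF assms(1)] by auto
  have d: "duration v (born v \<omega>) \<omega> = L v \<omega>" by (rule duration_eq_lifetime[OF assms(1) v(2)])
  have "cmod (edge_factor v (born v \<omega>) \<omega>) powr \<alpha> =
      tilted_factor v (born v \<omega>) \<omega> * exp (- cost * (duration v (born v \<omega>) \<omega> - clock_gain v (born v \<omega>) \<omega>))"
    by (simp add: tilted_factor_def flip: exp_add)
  then show ?case using snoc.IH[OF v(1)]
    by (simp add: norm_mult powr_mult clock_gain_def d algebra_simps flip: exp_add)
qed

lemma norm_diff_one_powr_le: "cmod (z - 1) powr \<alpha> \<le> 4 * (cmod z powr \<alpha> + 1)"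
proof -
  have "cmod (z - 1) \<le> 2 * max (cmod z) 1"
    using norm_triangle_ineq4[of z 1] by (simp add: max_def)
  then have "cmod (z - 1) powr \<alpha> \<le> (2 * max (cmod z) 1) powr \<alpha>"
    using exponent by (intro powr_mono2) auto
  also have "\<dots> = 2 powr \<alpha> * max (cmod z) 1 powr \<alpha>" by (simp add: powr_mult)
  also have "\<dots> \<le> 2 powr 2 * (cmod z powr \<alpha> + 1)"
    using exponent by (intro mult_mono powr_mono) (auto simp: max_def)
  finally show ?thesis by simp
qed

lemma norm_increment_powr_le:
  assumes "\<omega> \<in> space M"
  shows "cmod (increment u \<omega>) powr \<alpha> \<le>
    4 * tilted_weight u \<omega> * (offspring_factor u (born u \<omega>) \<omega> powr \<alpha> * tilted_factor u (born u \<omega>) \<omega> + 1)"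
proof (cases "present u \<omega>")
  case True
  let ?a = "born u \<omega>" and ?F = "edge_factor u (born u \<omega>) \<omega>" and ?m = "offspring_factor u (born u \<omega>) \<omega>"
  let ?d = "duration u (born u \<omega>) \<omega>" and ?g = "clock_gain u (born u \<omega>) \<omega>"
  have a: "0 \<le> ?a" "?a \<le> t" using born_nonneg[OF assms] True by (auto simp: present_def)
  \<comment> \<open>The cost of the time that the clock has not used so far is nonnegative, both at the birth of
    \<open>u\<close> and at the end of its edge.\<close>
  have e1: "exp (- cost * (?a - \<Lambda> ?a)) \<le> 1"
    using cost_nonneg clock_le[OF a] by simp
  have e2: "exp (- cost * (?a - \<Lambda> ?a)) * exp (- cost * (?d - ?g)) \<le> 1"
  proof -
    have "\<Lambda> (?a + ?d) \<le> ?a + ?d" using a duration_le by (intro clock_le) auto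
    then have "0 \<le> cost * (?a + ?d - \<Lambda> (?a + ?d))" using cost_nonneg by simp
    then show ?thesis by (simp add: clock_gain_def algebra_simps flip: exp_add)
  qed
  have F: "cmod ?F powr \<alpha> = tilted_factor u ?a \<omega> * exp (- cost * (?d - ?g))"
    by (simp add: tilted_factor_def flip: exp_add)
  have "cmod (increment u \<omega>) powr \<alpha> = cmod (line_weight u \<omega>) powr \<alpha> * cmod (of_real ?m * ?F - 1) powr \<alpha>"
    using True by (simp add: increment_def norm_mult powr_mult)
  also have "\<dots> \<le> cmod (line_weight u \<omega>) powr \<alpha> * (4 * (?m powr \<alpha> * cmod ?F powr \<alpha> + 1))"
    using norm_diff_one_powr_le[of "of_real ?m * ?F"]
    by (intro mult_left_mono) (auto simp: norm_mult powr_mult)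
  also have "\<dots> = 4 * tilted_line u \<omega> * (?m powr \<alpha> * tilted_factor u ?a \<omega> * (exp (- cost * (?a - \<Lambda> ?a)) * exp (- cost * (?d - ?g)))
      + exp (- cost * (?a - \<Lambda> ?a)))"
    unfolding norm_line_weight_powr[OF assms True] F by (simp add: algebra_simps)
  also have "\<dots> \<le> 4 * tilted_line u \<omega> * (?m powr \<alpha> * tilted_factor u ?a \<omega> * 1 + 1)"
    by (intro mult_left_mono add_mono e1 e2) auto
  finally show ?thesis using True by (simp add: tilted_weight_def)
next
  case False
  then show ?thesis by (simp add: increment_def tilted_weight_def)
qed

lemma increment_moment_le:
  "(\<integral>\<^sup>+\<omega>. ennreal (cmod (increment u \<omega>) powr \<alpha>) \<partial>M) \<le>
    ennreal (4 * (branching_moment + 1) * (\<Prod>i<length u. child_ratio (u ! i)))"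
proof -
  note meas = tilted_weight_measurable_src[OF own_sources_take_subset_other[of _ u]] born_measurable_src[OF own_sources_take_subset_other[of _ u]]
  define f where "f = (\<lambda>(\<omega>, \<omega>'). ennreal (4 * tilted_weight u \<omega>) *
     ennreal (offspring_factor u (born u \<omega>) \<omega>' powr \<alpha> * tilted_factor u (born u \<omega>) \<omega>' + 1))"
  note [measurable] = measurable_compose[OF measurable_fst meas(1)]
    offspring_factor_measurable[OF measurable_compose[OF measurable_fst meas(2)] measurable_snd, where A = "own_sources u" and u = u]
    tilted_factor_measurable[OF measurable_compose[OF measurable_fst meas(2)] measurable_snd, where A = "own_sources u" and u = u]
  have [simp]: "Lifetime u \<in> own_sources u" "Offspring u \<in> own_sources u" by (auto simp: own_sources_def)
  have f: "f \<in> borel_measurable (src (other_sources u) \<Otimes>\<^sub>M src (own_sources u))"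
    unfolding f_def case_prod_beta by measurable
  have "(\<integral>\<^sup>+\<omega>. ennreal (cmod (increment u \<omega>) powr \<alpha>) \<partial>M) \<le> (\<integral>\<^sup>+\<omega>. f (\<omega>, \<omega>) \<partial>M)"
  proof (rule nn_integral_mono)
    fix \<omega> assume "\<omega> \<in> space M"
    then show "ennreal (cmod (increment u \<omega>) powr \<alpha>) \<le> f (\<omega>, \<omega>)"
      unfolding f_def prod.case
      by (subst ennreal_mult[symmetric]) (auto intro!: ennreal_leI norm_increment_powr_le)
  qed
  also have "\<dots> = (\<integral>\<^sup>+\<omega>. \<integral>\<^sup>+\<omega>'. f (\<omega>, \<omega>') \<partial>M \<partial>M)"
    by (rule nn_integral_decouple[OF other_own_sources_disjoint f])
  also have "\<dots> \<le> (\<integral>\<^sup>+\<omega>. ennreal (4 * tilted_weight u \<omega>) * ennreal (branching_moment + 1) \<partial>M)"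
  proof (rule nn_integral_mono)
    fix \<omega>
    have [measurable]: "tilted_factor u (born u \<omega>) \<in> borel_measurable M" "offspring_factor u (born u \<omega>) \<in> borel_measurable M"
      by (rule tilted_factor_measurable[of "\<lambda>_. born u \<omega>" M "\<lambda>\<omega>. \<omega>" UNIV] offspring_factor_measurable[of "\<lambda>_. born u \<omega>" M "\<lambda>\<omega>. \<omega>" UNIV]; auto)+
    have "(\<integral>\<^sup>+\<omega>'. f (\<omega>, \<omega>') \<partial>M) = ennreal (4 * tilted_weight u \<omega>) *
        (\<integral>\<^sup>+\<omega>'. ennreal (offspring_factor u (born u \<omega>) \<omega>' powr \<alpha> * tilted_factor u (born u \<omega>) \<omega>' + 1) \<partial>M)"
      unfolding f_def prod.case by (rule nn_integral_cmult) measurable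
    also have "(\<integral>\<^sup>+\<omega>'. ennreal (offspring_factor u (born u \<omega>) \<omega>' powr \<alpha> * tilted_factor u (born u \<omega>) \<omega>' + 1) \<partial>M) =
       (\<integral>\<^sup>+\<omega>'. ennreal (offspring_factor u (born u \<omega>) \<omega>' powr \<alpha> * tilted_factor u (born u \<omega>) \<omega>') + 1 \<partial>M)"
      by (intro nn_integral_cong) simp
    also have "\<dots> = (\<integral>\<^sup>+\<omega>'. ennreal (offspring_factor u (born u \<omega>) \<omega>' powr \<alpha> * tilted_factor u (born u \<omega>) \<omega>') \<partial>M) + 1"
      by (subst nn_integral_add) (auto simp: emeasure_space_1)
    also have "\<dots> \<le> ennreal branching_moment + 1"
      by (intro add_right_mono tilted_factor_offspring_le)
    also have "\<dots> = ennreal (branching_moment + 1)" using branching_moment_nonneg by simp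
    finally show "(\<integral>\<^sup>+\<omega>'. f (\<omega>, \<omega>') \<partial>M) \<le> ennreal (4 * tilted_weight u \<omega>) * ennreal (branching_moment + 1)"
      by (simp add: mult_left_mono)
  qed
  also have "\<dots> = (\<integral>\<^sup>+\<omega>. ennreal (4 * (branching_moment + 1)) * ennreal (tilted_weight u \<omega>) \<partial>M)"
    using branching_moment_nonneg
    by (intro nn_integral_cong, subst (1 2) ennreal_mult[symmetric]) (auto simp: mult_ac)
  also have "\<dots> = ennreal (4 * (branching_moment + 1)) * (\<integral>\<^sup>+\<omega>. ennreal (tilted_weight u \<omega>) \<partial>M)"
    by (rule nn_integral_cmult) measurable
  also have "\<dots> \<le> ennreal (4 * (branching_moment + 1)) * ennreal (\<Prod>i<length u. child_ratio (u ! i))"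
    by (intro mult_left_mono tilted_weight_mean_le) simp
  also have "\<dots> = ennreal (4 * (branching_moment + 1) * (\<Prod>i<length u. child_ratio (u ! i)))"
    using branching_moment_nonneg by (subst ennreal_mult[symmetric]) (auto simp: prod_nonneg)
  finally show ?thesis .
qed

text \<open>
  Resampling the sources of \<open>v\<close> leaves \<open>G\<close>, the weight of the line of \<open>v\<close> and its time of birth
  unchanged, and the remaining factor has mean 0 by \<open>branching_edge_mean\<close>.
\<close>

lemma increment_orthogonal:
  fixes G :: "'a \<Rightarrow> complex"
  assumes G: "G \<in> borel_measurable (src (other_sources v))" and int: "integrable M (\<lambda>\<omega>. G \<omega> * increment v \<omega>)"
  shows "(\<integral>\<omega>. G \<omega> * increment v \<omega> \<partial>M) = 0"
proof -
  note meas = present_measurable_src[OF own_sources_take_subset_other[of _ v]] line_weight_measurable_src[OF own_sources_take_subset_other[of _ v]]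
    born_measurable_src[OF own_sources_take_subset_other[of _ v]]
  define f where "f = (\<lambda>(\<omega>, \<omega>'). (if present v \<omega> then G \<omega> * line_weight v \<omega> else 0) *
     (of_real (offspring_factor v (born v \<omega>) \<omega>') * edge_factor v (born v \<omega>) \<omega>' - 1))"
  note [measurable] = measurable_compose[OF measurable_fst meas(1)]
    measurable_compose[OF measurable_fst meas(2)] measurable_compose[OF measurable_fst G]
    offspring_factor_measurable[OF measurable_compose[OF measurable_fst meas(3)] measurable_snd, where A = "own_sources v" and u = v]
    edge_factor_measurable[OF measurable_compose[OF measurable_fst meas(3)] measurable_snd, where A = "own_sources v" and u = v]
  have [simp]: "Lifetime v \<in> own_sources v" "Offspring v \<in> own_sources v" by (auto simp: own_sources_def)
  have f: "f \<in> borel_measurable (src (other_sources v) \<Otimes>\<^sub>M src (own_sources v))"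
    unfolding f_def case_prod_beta by measurable
  have eq: "f (\<omega>, \<omega>) = G \<omega> * increment v \<omega>" for \<omega>
    by (simp add: f_def increment_def)
  have "(\<integral>\<omega>. G \<omega> * increment v \<omega> \<partial>M) = (\<integral>\<omega>. \<integral>\<omega>'. f (\<omega>, \<omega>') \<partial>M \<partial>M)"
    using integral_decouple[OF other_own_sources_disjoint f] int unfolding eq by simp
  also have "\<dots> = (\<integral>\<omega>. 0 \<partial>M)"
  proof (rule Bochner_Integration.integral_cong[OF refl])
    fix \<omega> assume \<omega>: "\<omega> \<in> space M"
    show "(\<integral>\<omega>'. f (\<omega>, \<omega>') \<partial>M) = 0"
    proof (cases "present v \<omega>")
      case True
      then have a: "0 \<le> born v \<omega>" "born v \<omega> \<le> t" using born_nonneg[OF \<omega>] by (auto simp: present_def)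
      show ?thesis using branching_edge_mean[OF a, of v] prob_space by (simp add: f_def)
    qed (simp add: f_def)
  qed
  finally show ?thesis by simp
qed


section \<open>Late generations\<close>

definition generation_ratio :: real where "generation_ratio = 2 / (1 + decay_rate)"

lemma generation_ratio_bounds: "0 \<le> generation_ratio" "generation_ratio < 1"
  using decay_rate_gt_1 by (auto simp: generation_ratio_def)

lemma sum_child_ratios_long:
  assumes "finite F" "\<And>u. u \<in> F \<Longrightarrow> n \<le> length u"
  shows "(\<Sum>u\<in>F. \<Prod>i<length u. child_ratio (u ! i)) \<le> generation_ratio ^ n / (1 - generation_ratio)"
  using sum_child_ratio_le generation_ratio_bounds assms
  by (intro sum_prod_long_lists) (auto simp: generation_ratio_def)

lemma increment_powr_integrable: "integrable M (\<lambda>\<omega>. cmod (increment u \<omega>) powr \<alpha>)"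
  using increment_moment_le[of u] by (intro integrableI_bounded) (auto intro: le_less_trans)

lemma increment_powr_integral_le:
  "(\<integral>\<omega>. cmod (increment u \<omega>) powr \<alpha> \<partial>M) \<le> 4 * (branching_moment + 1) * (\<Prod>i<length u. child_ratio (u ! i))"
  using increment_moment_le[of u] branching_moment_nonneg
  by (simp add: nn_integral_eq_integral[OF increment_powr_integrable] prod_nonneg)

text \<open>
  Labels are added in the order of their lengths. The sum so far is then a function of the other
  sources than those of the new label, whence the linear term of \<open>norm_add_powr_le\<close> has mean 0.
\<close>

lemma sum_increments_moment:
  assumes "finite F"
  shows "integrable M (\<lambda>\<omega>. cmod (\<Sum>u\<in>F. increment u \<omega>) powr \<alpha>) \<and>
    (\<integral>\<omega>. cmod (\<Sum>u\<in>F. increment u \<omega>) powr \<alpha> \<partial>M) \<le> 6 * (\<Sum>u\<in>F. \<integral>\<omega>. cmod (increment u \<omega>) powr \<alpha> \<partial>M)"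
  using assms
proof (induction F rule: finite_ranking_induct[where f = length])
  case empty
  then show ?case by simp
next
  case (insert v F)
  show ?case
  proof (cases "v \<in> F")
    case True
    then show ?thesis using insert.IH by (simp add: insert_absorb)
  next
    case False
    define S where "S \<omega> = (\<Sum>u\<in>F. increment u \<omega>)" for \<omega>
    define G where "G \<omega> = cnj (of_real (cmod (S \<omega>) powr (\<alpha> - 2)) * S \<omega>)" for \<omega>
    \<comment> \<open>By maximality of its length, \<open>v\<close> lies on the ancestral line of no label in \<open>F\<close>.\<close>
    have S_meas: "S \<in> borel_measurable (src (other_sources v))"
      unfolding S_def
    proof (intro borel_measurable_sum increment_measurable_src own_sources_subset_other notI)
      fix u i assume u: "u \<in> F" and i: "i \<le> length u" and eq: "take i u = v"
      have "length v = i" using i eq[symmetric] by simp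
      then have "i = length u" using insert.hyps(2)[OF u] i by simp
      then show False using eq u False by simp
    qed
    have G_meas: "G \<in> borel_measurable (src (other_sources v))"
    proof -
      have cnj: "cnj \<in> borel_measurable borel"
        by (intro borel_measurable_continuous_onI continuous_on_cnj continuous_on_id)
      note [measurable] = S_meas
      show ?thesis unfolding G_def by (rule measurable_compose[OF _ cnj]) measurable
    qed
    note [measurable] = measurable_src_imp[OF S_meas] measurable_src_imp[OF G_meas]
    have IH: "integrable M (\<lambda>\<omega>. cmod (S \<omega>) powr \<alpha>)"
      "(\<integral>\<omega>. cmod (S \<omega>) powr \<alpha> \<partial>M) \<le> 6 * (\<Sum>u\<in>F. \<integral>\<omega>. cmod (increment u \<omega>) powr \<alpha> \<partial>M)"
      using insert.IH by (auto simp: S_def)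
    note X = increment_powr_integrable[of v]
    have cross: "integrable M (\<lambda>\<omega>. G \<omega> * increment v \<omega>)"
    proof (rule Bochner_Integration.integrable_bound[OF Bochner_Integration.integrable_add[OF IH(1) X]])
      show "AE \<omega> in M. norm (G \<omega> * increment v \<omega>) \<le> norm (cmod (S \<omega>) powr \<alpha> + cmod (increment v \<omega>) powr \<alpha>)"
        using norm_cross_term_le[OF exponent(1)] by (auto simp: G_def)
    qed measurable
    have bound_int: "integrable M (\<lambda>\<omega>. cmod (S \<omega>) powr \<alpha> + \<alpha> * Re (G \<omega> * increment v \<omega>) + 6 * cmod (increment v \<omega>) powr \<alpha>)"
      by (intro Bochner_Integration.integrable_add integrable_mult_right integrable_Re IH(1) X cross)
    have bound: "cmod (S \<omega> + increment v \<omega>) powr \<alpha> \<le>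
        cmod (S \<omega>) powr \<alpha> + \<alpha> * Re (G \<omega> * increment v \<omega>) + 6 * cmod (increment v \<omega>) powr \<alpha>" for \<omega>
      unfolding G_def by (rule norm_add_powr_le[OF exponent])
    have int: "integrable M (\<lambda>\<omega>. cmod (S \<omega> + increment v \<omega>) powr \<alpha>)"
    proof (rule Bochner_Integration.integrable_bound[OF bound_int])
      show "AE \<omega> in M. norm (cmod (S \<omega> + increment v \<omega>) powr \<alpha>) \<le>
         norm (cmod (S \<omega>) powr \<alpha> + \<alpha> * Re (G \<omega> * increment v \<omega>) + 6 * cmod (increment v \<omega>) powr \<alpha>)"
        using bound by (intro AE_I2) (smt (verit) powr_ge_zero real_norm_def)
    qed measurable
    have zero: "(\<integral>\<omega>. G \<omega> * increment v \<omega> \<partial>M) = 0"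
      by (rule increment_orthogonal[OF G_meas cross])
    have "(\<integral>\<omega>. cmod (S \<omega> + increment v \<omega>) powr \<alpha> \<partial>M) \<le>
        (\<integral>\<omega>. cmod (S \<omega>) powr \<alpha> + \<alpha> * Re (G \<omega> * increment v \<omega>) + 6 * cmod (increment v \<omega>) powr \<alpha> \<partial>M)"
      by (rule integral_mono[OF int bound_int bound])
    also have "\<dots> = (\<integral>\<omega>. cmod (S \<omega>) powr \<alpha> \<partial>M) + \<alpha> * (\<integral>\<omega>. Re (G \<omega> * increment v \<omega>) \<partial>M)
        + 6 * (\<integral>\<omega>. cmod (increment v \<omega>) powr \<alpha> \<partial>M)"
      using IH(1) X cross by (simp del: times_complex.sel)
    also have "(\<integral>\<omega>. Re (G \<omega> * increment v \<omega>) \<partial>M) = 0"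
      using zero cross by (simp only: integral_Re) simp
    finally have "(\<integral>\<omega>. cmod (S \<omega> + increment v \<omega>) powr \<alpha> \<partial>M) \<le>
        6 * (\<Sum>u\<in>insert v F. \<integral>\<omega>. cmod (increment u \<omega>) powr \<alpha> \<partial>M)"
      using IH(2) False insert.hyps(1) by simp
    moreover have "(\<Sum>u\<in>insert v F. increment u \<omega>) = S \<omega> + increment v \<omega>" for \<omega>
      using False insert.hyps(1) by (simp add: S_def add.commute)
    ultimately show ?thesis using int by simp
  qed
qed

definition tail_const :: real where
  "tail_const = 24 * (branching_moment + 1) / (1 - generation_ratio)"

lemma sum_long_increments_moment:
  assumes F: "finite F" "\<And>u. u \<in> F \<Longrightarrow> n \<le> length u"
  shows "(\<integral>\<^sup>+\<omega>. ennreal (cmod (\<Sum>u\<in>F. increment u \<omega>) powr \<alpha>) \<partial>M) \<le> ennreal (tail_const * generation_ratio ^ n)"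
proof -
  note s = sum_increments_moment[OF F(1)]
  have "(\<integral>\<omega>. cmod (\<Sum>u\<in>F. increment u \<omega>) powr \<alpha> \<partial>M) \<le>
      6 * (\<Sum>u\<in>F. 4 * (branching_moment + 1) * (\<Prod>i<length u. child_ratio (u ! i)))"
    by (rule order_trans[OF conjunct2[OF s]])
      (intro mult_left_mono sum_mono increment_powr_integral_le, simp)
  also have "\<dots> = 24 * (branching_moment + 1) * (\<Sum>u\<in>F. \<Prod>i<length u. child_ratio (u ! i))"
    by (simp add: sum_distrib_left algebra_simps)
  also have "\<dots> \<le> 24 * (branching_moment + 1) * (generation_ratio ^ n / (1 - generation_ratio))"
    using sum_child_ratios_long[OF F] branching_moment_nonneg by (intro mult_left_mono) auto
  finally show ?thesis
    using s by (subst nn_integral_eq_integral) (auto intro!: ennreal_leI simp: tail_const_def)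
qed

text \<open>
  With these parameters the tilted weight of a present label is \<open>exp (-2 born)\<close>, which is at least
  \<open>exp (-2 t)\<close>. Hence the bound on the tilted weights makes the probabilities of presence summable.
\<close>

lemma AE_finite_present_unweighted:
  assumes "\<sigma> = 0" "\<tau> = 0" "\<alpha> = 2"
  shows "AE \<omega> in M. finite {u. present u \<omega>}"
proof -
  have c: "cost = 0" unfolding cost_def moment_cost_def using assms by simp
  have qf: "tilted_factor v a \<omega> = exp (- 2 * duration v a \<omega>)" for v a \<omega>
    unfolding tilted_factor_def norm_edge_factor_powr c unfolding assms by simp
  have q: "tilted_line u \<omega> = exp (- 2 * born u \<omega>)" if "\<omega> \<in> space M" "present u \<omega>" for u \<omega>
    using that(2)
  proof (induction u rule: rev_induct)
    case (snoc j v)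
    then show ?case using present_snoc[OF that(1), of v j] duration_eq_lifetime[OF that(1), of "born v \<omega>" v]
      by (simp add: qf flip: exp_add)
  qed simp
  have bound: "prob {\<omega> \<in> space M. present u \<omega>} \<le> exp (2 * t) * (\<Prod>i<length u. child_ratio (u ! i))" for u
  proof -
    have "emeasure M {\<omega> \<in> space M. present u \<omega>} = (\<integral>\<^sup>+\<omega>. indicator {\<omega> \<in> space M. present u \<omega>} \<omega> \<partial>M)"
      by simp
    also have "\<dots> \<le> (\<integral>\<^sup>+\<omega>. ennreal (exp (2 * t)) * ennreal (tilted_weight u \<omega>) \<partial>M)"
    proof (rule nn_integral_mono)
      fix \<omega> assume \<omega>: "\<omega> \<in> space M"
      have "1 \<le> exp (2 * t) * tilted_weight u \<omega>" if "present u \<omega>"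
        using that q[OF \<omega> that] by (simp add: tilted_weight_def present_def flip: exp_add)
      then show "indicator {\<omega> \<in> space M. present u \<omega>} \<omega> \<le> ennreal (exp (2 * t)) * ennreal (tilted_weight u \<omega>)"
        by (auto simp: indicator_def simp flip: ennreal_mult)
    qed
    also have "\<dots> = ennreal (exp (2 * t)) * (\<integral>\<^sup>+\<omega>. ennreal (tilted_weight u \<omega>) \<partial>M)"
      by (rule nn_integral_cmult) measurable
    also have "\<dots> \<le> ennreal (exp (2 * t)) * ennreal (\<Prod>i<length u. child_ratio (u ! i))"
      by (intro mult_left_mono tilted_weight_mean_le) simp
    finally show ?thesis
      by (simp add: emeasure_eq_measure prod_nonneg flip: ennreal_mult)
  qed
  have "summable (\<lambda>n. prob {\<omega> \<in> space M. present (label_enum n) \<omega>})"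
  proof (rule summableI_nonneg_bounded)
    fix n
    have inj: "inj_on label_enum {..<n}"
      using bij_label_enum by (auto intro: inj_on_subset simp: bij_def)
    have "(\<Sum>i<n. prob {\<omega> \<in> space M. present (label_enum i) \<omega>}) \<le>
        (\<Sum>i<n. exp (2 * t) * (\<Prod>k<length (label_enum i). child_ratio (label_enum i ! k)))"
      by (intro sum_mono bound)
    also have "\<dots> = exp (2 * t) * (\<Sum>u\<in>label_enum ` {..<n}. \<Prod>k<length u. child_ratio (u ! k))"
      by (simp add: sum.reindex[OF inj] sum_distrib_left)
    also have "\<dots> \<le> exp (2 * t) * (generation_ratio ^ 0 / (1 - generation_ratio))"
      by (intro mult_left_mono sum_child_ratios_long) auto
    finally show "(\<Sum>i<n. prob {\<omega> \<in> space M. present (label_enum i) \<omega>}) \<le> exp (2 * t) * (generation_ratio ^ 0 / (1 - generation_ratio))" .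
  qed simp
  then have "AE \<omega> in M. \<forall>\<^sub>F n in sequentially. \<omega> \<in> space M - {\<omega> \<in> space M. present (label_enum n) \<omega>}"
    by (intro borel_cantelli_AE1) (auto simp: emeasure_eq_measure)
  then show ?thesis
  proof (rule AE_mp, intro AE_I2 impI)
    fix \<omega> assume \<omega>: "\<omega> \<in> space M"
      and "\<forall>\<^sub>F n in sequentially. \<omega> \<in> space M - {\<omega> \<in> space M. present (label_enum n) \<omega>}"
    then obtain m where m: "\<And>n. m \<le> n \<Longrightarrow> \<not> present (label_enum n) \<omega>"
      by (auto simp: eventually_sequentially)
    have "u \<in> label_enum ` {..<m}" if "present u \<omega>" for u
    proof -
      obtain n where "u = label_enum n" using surjD[OF bij_is_surj[OF bij_label_enum]] by blast
      then show ?thesis using m[of n] that by (cases "n < m") auto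
    qed
    then have "{u. present u \<omega>} \<subseteq> label_enum ` {..<m}" by blast
    then show "finite {u. present u \<omega>}" by (rule finite_subset) simp
  qed
qed

text \<open>
  Presence depends on the tree only, so the parameters of the weights may be chosen.
\<close>

lemma AE_finite_present: "AE \<omega> in M. finite {u. present u \<omega>}"
proof -
  interpret unweighted: weighted_tree M p L N W W' "\<lambda>_. 0" t \<rho> 0 0 2
    using offspring horizon correlation by unfold_locales (auto simp: mono_def moment_cost_def)
  show ?thesis using unweighted.AE_finite_present_unweighted by simp
qed

definition normalized_sum :: "'a \<Rightarrow> complex" where
  "normalized_sum \<omega> = (\<Sum>u | present u \<omega> \<and> t < born u \<omega> + L u \<omega>. line_weight u \<omega> * edge_factor u (born u \<omega>) \<omega>)"

text \<open>
  The conditional expectation of the normalized sum given the sources of the generations below \<open>n\<close>.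
\<close>

definition early_sum :: "nat \<Rightarrow> 'a \<Rightarrow> complex" where
  "early_sum n \<omega> = 1 + (\<Sum>u | present u \<omega> \<and> length u < n. increment u \<omega>)"

text \<open>
  The sum telescopes: the weights of the children of all particles that die before the horizon are the
  weights of all present labels except the root, whose weight is 1.
\<close>

lemma sum_increments_eq_normalized_sum:
  assumes \<omega>: "\<omega> \<in> space M" and fin: "finite {u. present u \<omega>}"
  shows "(\<Sum>u | present u \<omega>. increment u \<omega>) = normalized_sum \<omega> - 1"
proof -
  let ?P = "{u. present u \<omega>}" and ?D = "{u. present u \<omega> \<and> born u \<omega> + L u \<omega> \<le> t}"
  let ?e = "\<lambda>u. line_weight u \<omega> * edge_factor u (born u \<omega>) \<omega>"
  have finD: "finite ?D" using fin by (rule rev_finite_subset) auto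
  have img: "?P - {[]} = (\<lambda>(u, j). u @ [j]) ` (SIGMA u:?D. {..<N u \<omega>})"
  proof (intro set_eqI iffI)
    fix w assume "w \<in> ?P - {[]}"
    then obtain v j where w: "w = v @ [j]" "present (v @ [j]) \<omega>" by (cases w rule: rev_cases) auto
    then show "w \<in> (\<lambda>(u, j). u @ [j]) ` (SIGMA u:?D. {..<N u \<omega>})"
      using present_snoc[OF \<omega>, of v j] by (auto intro!: image_eqI[of _ _ "(v, j)"])
  qed (auto simp: present_snoc[OF \<omega>])
  have children: "(\<Sum>u\<in>?D. of_nat (N u \<omega>) * ?e u) = (\<Sum>w\<in>?P - {[]}. line_weight w \<omega>)"
  proof -
    have "(\<Sum>u\<in>?D. of_nat (N u \<omega>) * ?e u) = (\<Sum>u\<in>?D. \<Sum>j<N u \<omega>. line_weight (u @ [j]) \<omega>)" by simp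
    also have "\<dots> = (\<Sum>(u, j)\<in>(SIGMA u:?D. {..<N u \<omega>}). line_weight (u @ [j]) \<omega>)"
      using finD by (subst sum.Sigma) auto
    also have "\<dots> = (\<Sum>w\<in>?P - {[]}. line_weight w \<omega>)"
      unfolding img by (subst sum.reindex) (auto simp: inj_on_def intro!: sum.cong)
    finally show ?thesis .
  qed
  have "(\<Sum>u\<in>?P. increment u \<omega>) = (\<Sum>u\<in>?P. of_real (offspring_factor u (born u \<omega>) \<omega>) * ?e u) - (\<Sum>u\<in>?P. line_weight u \<omega>)"
    by (simp add: increment_def sum_subtractf algebra_simps)
  also have "(\<Sum>u\<in>?P. of_real (offspring_factor u (born u \<omega>) \<omega>) * ?e u) =
      (\<Sum>u\<in>?P - ?D. of_real (offspring_factor u (born u \<omega>) \<omega>) * ?e u) + (\<Sum>u\<in>?D. of_real (offspring_factor u (born u \<omega>) \<omega>) * ?e u)"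
    using fin by (intro sum.subset_diff) auto
  also have "(\<Sum>u\<in>?P - ?D. of_real (offspring_factor u (born u \<omega>) \<omega>) * ?e u) = normalized_sum \<omega>"
    unfolding normalized_sum_def by (intro sum.cong) (auto simp: offspring_factor_def)
  also have "(\<Sum>u\<in>?D. of_real (offspring_factor u (born u \<omega>) \<omega>) * ?e u) = (\<Sum>w\<in>?P - {[]}. line_weight w \<omega>)"
    unfolding children[symmetric] by (intro sum.cong) (auto simp: offspring_factor_def)
  also have "(\<Sum>u\<in>?P. line_weight u \<omega>) = 1 + (\<Sum>w\<in>?P - {[]}. line_weight w \<omega>)"
    using fin by (subst sum.remove[of _ "[]"]) auto
  finally show ?thesis by simp
qed

lemma normalized_sum_minus_early_sum:
  assumes \<omega>: "\<omega> \<in> space M" and fin: "finite {u. present u \<omega>}"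
  shows "normalized_sum \<omega> - early_sum n \<omega> = (\<Sum>u | present u \<omega> \<and> n \<le> length u. increment u \<omega>)"
proof -
  have "(\<Sum>u | present u \<omega>. increment u \<omega>) =
      (\<Sum>u | present u \<omega> \<and> length u < n. increment u \<omega>) + (\<Sum>u | present u \<omega> \<and> n \<le> length u. increment u \<omega>)"
    using fin by (subst sum.union_disjoint[symmetric]) (auto intro!: sum.cong)
  then show ?thesis using sum_increments_eq_normalized_sum[OF assms] by (simp add: early_sum_def algebra_simps)
qed

lemma normalized_sum_measurable [measurable]: "normalized_sum \<in> borel_measurable M"
  unfolding normalized_sum_def
proof (rule measurable_random_finite_sum)
  fix u
  have [measurable]: "(\<lambda>\<omega>. edge_factor u (born u \<omega>) \<omega>) \<in> borel_measurable M"
    by (rule edge_factor_measurable[of _ _ "\<lambda>\<omega>. \<omega>" UNIV]) auto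
  show "(\<lambda>\<omega>. if present u \<omega> \<and> t < born u \<omega> + L u \<omega> then line_weight u \<omega> * edge_factor u (born u \<omega>) \<omega> else 0) \<in> borel_measurable M"
    by measurable
qed measurable

lemma early_sum_measurable [measurable]: "early_sum n \<in> borel_measurable M"
proof -
  have "(\<lambda>\<omega>. \<Sum>u | present u \<omega> \<and> length u < n. increment u \<omega>) \<in> borel_measurable M"
    by (rule measurable_random_finite_sum) measurable
  then show ?thesis unfolding early_sum_def by measurable
qed

text \<open>
  Fatou's lemma along an exhaustion of the labels. The constants involve neither the
  horizon nor the clock.
\<close>

lemma tail_moment:
  "(\<integral>\<^sup>+\<omega>. ennreal (cmod (normalized_sum \<omega> - early_sum n \<omega>) powr \<alpha>) \<partial>M) \<le> ennreal (tail_const * generation_ratio ^ n)"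
proof -
  define F where "F m = {u \<in> label_enum ` {..<m}. n \<le> length u}" for m
  define S where "S m \<omega> = (\<Sum>u\<in>F m. increment u \<omega>)" for m \<omega>
  have finF: "finite (F m)" for m by (simp add: F_def)
  have [measurable]: "S m \<in> borel_measurable M" for m unfolding S_def by measurable
  have conv: "(\<lambda>m. ennreal (cmod (S m \<omega>) powr \<alpha>)) \<longlonglongrightarrow> ennreal (cmod (normalized_sum \<omega> - early_sum n \<omega>) powr \<alpha>)"
    if \<omega>: "\<omega> \<in> space M" and fin: "finite {u. present u \<omega>}" for \<omega>
  proof (rule tendsto_eventually, rule eventually_mono[OF label_enum_cofinal[OF fin]])
    fix m assume sub: "{u. present u \<omega>} \<subseteq> label_enum ` {..<m}"
    have "S m \<omega> = (\<Sum>u | present u \<omega> \<and> n \<le> length u. increment u \<omega>)"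
      unfolding S_def using sub finF[of m]
      by (intro sum.mono_neutral_right) (auto simp: F_def increment_def)
    then show "ennreal (cmod (S m \<omega>) powr \<alpha>) = ennreal (cmod (normalized_sum \<omega> - early_sum n \<omega>) powr \<alpha>)"
      using normalized_sum_minus_early_sum[OF \<omega> fin] by simp
  qed
  have "(\<integral>\<^sup>+\<omega>. ennreal (cmod (normalized_sum \<omega> - early_sum n \<omega>) powr \<alpha>) \<partial>M) =
      (\<integral>\<^sup>+\<omega>. liminf (\<lambda>m. ennreal (cmod (S m \<omega>) powr \<alpha>)) \<partial>M)"
  proof (rule nn_integral_cong_AE, rule AE_mp[OF AE_finite_present], intro AE_I2 impI)
    fix \<omega> assume "\<omega> \<in> space M" "finite {u. present u \<omega>}"
    from lim_imp_Liminf[OF _ conv[OF this]]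
    show "ennreal (cmod (normalized_sum \<omega> - early_sum n \<omega>) powr \<alpha>) = liminf (\<lambda>m. ennreal (cmod (S m \<omega>) powr \<alpha>))"
      by simp
  qed
  also have "\<dots> \<le> liminf (\<lambda>m. \<integral>\<^sup>+\<omega>. ennreal (cmod (S m \<omega>) powr \<alpha>) \<partial>M)"
    by (rule nn_integral_liminf) measurable
  also have "\<dots> \<le> liminf (\<lambda>m::nat. ennreal (tail_const * generation_ratio ^ n))"
    unfolding S_def using finF
    by (intro Liminf_mono always_eventually allI sum_long_increments_moment) (auto simp: F_def)
  also have "\<dots> = ennreal (tail_const * generation_ratio ^ n)" by (simp add: Liminf_const)
  finally show ?thesis .
qed

lemma tail_probability:
  assumes "0 < \<epsilon>"
  shows "prob {\<omega> \<in> space M. \<epsilon> < cmod (normalized_sum \<omega> - early_sum n \<omega>)} \<le> tail_const * generation_ratio ^ n / \<epsilon> powr \<alpha>"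
proof -
  let ?X = "\<lambda>\<omega>. cmod (normalized_sum \<omega> - early_sum n \<omega>)"
  have nonneg: "0 \<le> tail_const * generation_ratio ^ n"
    using branching_moment_nonneg generation_ratio_bounds by (simp add: tail_const_def)
  have "emeasure M {\<omega> \<in> space M. \<epsilon> < ?X \<omega>} = (\<integral>\<^sup>+\<omega>. indicator {\<omega> \<in> space M. \<epsilon> < ?X \<omega>} \<omega> \<partial>M)"
    by simp
  also have "\<dots> \<le> (\<integral>\<^sup>+\<omega>. ennreal (1 / \<epsilon> powr \<alpha>) * ennreal (?X \<omega> powr \<alpha>) \<partial>M)"
  proof (rule nn_integral_mono)
    fix \<omega>
    have "1 \<le> 1 / \<epsilon> powr \<alpha> * ?X \<omega> powr \<alpha>" if "\<epsilon> < ?X \<omega>"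
      using that assms exponent powr_mono2[of \<alpha> \<epsilon> "?X \<omega>"] by (simp add: field_simps)
    then show "indicator {\<omega> \<in> space M. \<epsilon> < ?X \<omega>} \<omega> \<le> ennreal (1 / \<epsilon> powr \<alpha>) * ennreal (?X \<omega> powr \<alpha>)"
      by (auto simp: indicator_def simp flip: ennreal_mult)
  qed
  also have "\<dots> = ennreal (1 / \<epsilon> powr \<alpha>) * (\<integral>\<^sup>+\<omega>. ennreal (?X \<omega> powr \<alpha>) \<partial>M)"
    by (rule nn_integral_cmult) measurable
  also have "\<dots> \<le> ennreal (1 / \<epsilon> powr \<alpha>) * ennreal (tail_const * generation_ratio ^ n)"
    by (intro mult_left_mono tail_moment) simp
  also have "\<dots> = ennreal (tail_const * generation_ratio ^ n / \<epsilon> powr \<alpha>)"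
    using nonneg by (simp flip: ennreal_mult)
  finally show ?thesis
    using nonneg by (simp add: emeasure_eq_measure)
qed


section \<open>The CREM and branching Brownian motion as weighted trees\<close>

definition x_step :: "label \<Rightarrow> 'a \<Rightarrow> real" where
  "x_step v \<omega> = speed v (born v \<omega>) \<omega> * W v (duration v (born v \<omega>) \<omega>) \<omega>"

definition z_step :: "label \<Rightarrow> 'a \<Rightarrow> real" where
  "z_step v \<omega> = speed v (born v \<omega>) \<omega> * W' v (duration v (born v \<omega>) \<omega>) \<omega>"

lemma edge_factor_eq_steps: "edge_factor v (born v \<omega>) \<omega> =
    exp (- of_real (duration v (born v \<omega>) \<omega>) - drift * of_real (clock_gain v (born v \<omega>) \<omega>)) *
    boltzmann \<sigma> \<tau> (x_step v \<omega>) (correlated \<rho> (x_step v \<omega>) (z_step v \<omega>))"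
  by (simp add: edge_factor_def x_step_def z_step_def)

text \<open>
  Durations and clock gains telescope along the ancestral line, and the displacements add up.
\<close>

lemma line_weight_eq_boltzmann:
  assumes "\<omega> \<in> space M" "present u \<omega>"
  shows "line_weight u \<omega> = exp (- of_real (born u \<omega>) - drift * of_real (\<Lambda> (born u \<omega>))) *
    boltzmann \<sigma> \<tau> (\<Sum>i<length u. x_step (take i u) \<omega>)
      (correlated \<rho> (\<Sum>i<length u. x_step (take i u) \<omega>) (\<Sum>i<length u. z_step (take i u) \<omega>))"
  using assms(2)
proof (induction u rule: rev_induct)
  case Nil
  then show ?case using clock_zero by simp
next
  case (snoc j v)
  then have v: "present v \<omega>" "born v \<omega> + L v \<omega> \<le> t" using present_snoc[OF assms(1)] by auto
  have d: "duration v (born v \<omega>) \<omega> = L v \<omega>" by (rule duration_eq_lifetime[OF assms(1) v(2)])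
  have e: "exp (- of_real (born v \<omega>) - drift * of_real (\<Lambda> (born v \<omega>))) *
      exp (- of_real (L v \<omega>) - drift * of_real (clock_gain v (born v \<omega>) \<omega>)) =
      exp (- of_real (born v \<omega> + L v \<omega>) - drift * of_real (\<Lambda> (born v \<omega> + L v \<omega>)))"
    unfolding clock_gain_def d by (simp add: algebra_simps flip: exp_add)
  show ?case
    unfolding line_weight_snoc snoc.IH[OF v(1)] edge_factor_eq_steps d born_snoc e[symmetric]
    by (simp add: boltzmann_add mult_ac)
qed

lemma leaf_eq_boltzmann:
  assumes "\<omega> \<in> space M" "present u \<omega>" "t < born u \<omega> + L u \<omega>"
  shows "line_weight u \<omega> * edge_factor u (born u \<omega>) \<omega> = exp (- of_real t - drift * of_real (\<Lambda> t)) *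
    boltzmann \<sigma> \<tau> (\<Sum>i\<le>length u. x_step (take i u) \<omega>)
      (correlated \<rho> (\<Sum>i\<le>length u. x_step (take i u) \<omega>) (\<Sum>i\<le>length u. z_step (take i u) \<omega>))"
proof -
  have d: "duration u (born u \<omega>) \<omega> = t - born u \<omega>"
    using assms by (intro duration_eq_remaining) (auto simp: present_def)
  have e: "exp (- of_real (born u \<omega>) - drift * of_real (\<Lambda> (born u \<omega>))) *
      exp (- of_real (t - born u \<omega>) - drift * of_real (clock_gain u (born u \<omega>) \<omega>)) =
      exp (- of_real t - drift * of_real (\<Lambda> t))"
    unfolding clock_gain_def d by (simp add: algebra_simps flip: exp_add)
  show ?thesis
    unfolding line_weight_eq_boltzmann[OF assms(1,2)] edge_factor_eq_steps d e[symmetric]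
    by (simp add: boltzmann_add mult_ac flip: lessThan_Suc_atMost)
qed

lemma born_take_le:
  assumes "\<omega> \<in> space M"
  shows "born (take i u) \<omega> \<le> born u \<omega>"
proof -
  have "born (take i u) \<omega> = (\<Sum>k<min (length u) i. L (take k u) \<omega>)"
    by (simp add: birth_def min.absorb1 min.commute)
  also have "\<dots> \<le> born u \<omega>"
    unfolding birth_def using lifetime_positive[OF assms]
    by (intro sum_mono2) (auto intro: less_imp_le)
  finally show ?thesis .
qed

lemma alive_eq: "alive (\<lambda>u. L u \<omega>) (\<lambda>u. N u \<omega>) t = {u. present u \<omega> \<and> t < born u \<omega> + L u \<omega>}"
  by (auto simp: alive_def present_def death_def)

lemma truncated_edge:
  fixes i :: nat
  assumes "\<omega> \<in> space M" "present u \<omega>"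
  defines "v \<equiv> take i u"
  shows "0 \<le> born v \<omega>" "born v \<omega> \<le> t"
    and "edge_end (\<lambda>u. L u \<omega>) t v = born v \<omega> + duration v (born v \<omega>) \<omega>"
proof -
  show "0 \<le> born v \<omega>" by (rule born_nonneg[OF assms(1)])
  show le: "born v \<omega> \<le> t"
    using born_take_le[OF assms(1), of i u] assms(2) by (simp add: present_def v_def)
  show "edge_end (\<lambda>u. L u \<omega>) t v = born v \<omega> + duration v (born v \<omega>) \<omega>"
    using le lifetime_positive[OF assms(1), of v] by (simp add: edge_end_def death_def duration_def)
qed

end

text \<open>
  Clamping the argument of \<open>A\<close> extends the clock monotonically beyond \<open>[0,t]\<close>.
\<close>

definition crem_clock :: "(real \<Rightarrow> real) \<Rightarrow> real \<Rightarrow> real \<Rightarrow> real" where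
  "crem_clock A t s = t * A (max 0 (min 1 (s / t)))"

context weighted_tree
begin

lemma normalized_sum_eq_crem:
  assumes \<omega>: "\<omega> \<in> space M" and t: "0 < t" and clock: "\<Lambda> = crem_clock A t" and A1: "A 1 = 1"
  shows "exp (- complex_of_real t * growth_rate \<rho> \<sigma> \<tau>) *
    partition_function A (\<lambda>u. L u \<omega>) (\<lambda>u. N u \<omega>) (\<lambda>u s. W u s \<omega>) (\<lambda>u s. W' u s \<omega>) \<rho> \<sigma> \<tau> t = normalized_sum \<omega>"
proof -
  have \<Lambda>: "\<Lambda> s = t * A (s / t)" if "0 \<le> s" "s \<le> t" for s
    using that t by (simp add: clock crem_clock_def max_def min_def)
  have pos: "crem_position A (\<lambda>u. L u \<omega>) (\<lambda>u s. V u s \<omega>) t u =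
      (\<Sum>i\<le>length u. let v = take i u in speed v (born v \<omega>) \<omega> * V v (duration v (born v \<omega>) \<omega>) \<omega>)"
    if "present u \<omega>" for u and V :: "label \<Rightarrow> real \<Rightarrow> 'a \<Rightarrow> real"
    unfolding crem_position_def
  proof (rule sum.cong[OF refl])
    fix i
    note tr = truncated_edge[OF \<omega> that, of i]
    have 1: "\<Lambda> (born (take i u) \<omega>) = t * A (born (take i u) \<omega> / t)"
      using tr by (intro \<Lambda>) auto
    have 2: "\<Lambda> (born (take i u) \<omega> + duration (take i u) (born (take i u) \<omega>) \<omega>) =
        t * A ((born (take i u) \<omega> + duration (take i u) (born (take i u) \<omega>) \<omega>) / t)"
      using tr duration_le by (intro \<Lambda>) auto
    show "(let v = take i u; a = born v \<omega>; b = edge_end (\<lambda>u. L u \<omega>) t v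
        in sqrt ((t * A (b / t) - t * A (a / t)) / (b - a)) * edge_increment (\<lambda>u. L u \<omega>) (\<lambda>u s. V u s \<omega>) t v) =
      (let v = take i u in speed v (born v \<omega>) \<omega> * V v (duration v (born v \<omega>) \<omega>) \<omega>)"
      unfolding Let_def edge_increment_def tr(3) speed_def clock_gain_def 1 2 by simp
  qed
  have "exp (- complex_of_real t * growth_rate \<rho> \<sigma> \<tau>) = exp (- of_real t - drift * of_real (\<Lambda> t))"
    using \<Lambda>[of t] t A1 by (simp add: algebra_simps)
  then show ?thesis
    unfolding partition_function_def normalized_sum_def alive_eq sum_distrib_left
    by (intro sum.cong) (simp_all add: leaf_eq_boltzmann[OF \<omega>] pos Let_def x_step_def z_step_def)
qed

text \<open>
  With a linear clock all edges have the same speed \<open>b\<close>, and multiplying the motions by \<open>b\<close> is the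
  same as multiplying \<open>\<sigma>\<close> and \<open>\<tau>\<close> by \<open>b\<close>.
\<close>

lemma normalized_sum_eq_bbm:
  assumes \<omega>: "\<omega> \<in> space M" and clock: "\<Lambda> = (\<lambda>s. b\<^sup>2 * s)" and b: "0 \<le> b"
  shows "additive_martingale (\<lambda>u. L u \<omega>) (\<lambda>u. N u \<omega>) (\<lambda>u s. W u s \<omega>) (\<lambda>u s. W' u s \<omega>)
    \<rho> (b * \<sigma>) (b * \<tau>) t = normalized_sum \<omega>"
proof -
  have pos: "b * bbm_position (\<lambda>u. L u \<omega>) (\<lambda>u s. V u s \<omega>) t u =
      (\<Sum>i\<le>length u. let v = take i u in speed v (born v \<omega>) \<omega> * V v (duration v (born v \<omega>) \<omega>) \<omega>)"
    if "present u \<omega>" and BM: "\<And>v. brownian_motion M (V v)" for u and V :: "label \<Rightarrow> real \<Rightarrow> 'a \<Rightarrow> real"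
    unfolding bbm_position_def sum_distrib_left
  proof (rule sum.cong[OF refl])
    fix i
    \<comment> \<open>An edge of duration 0 has speed 0 instead of \<open>b\<close>, which is harmless since its increment is 0.\<close>
    have "V v 0 \<omega> = 0" for v using BM[of v] \<omega> by (simp add: brownian_motion_def)
    then show "b * edge_increment (\<lambda>u. L u \<omega>) (\<lambda>u s. V u s \<omega>) t (take i u) =
      (let v = take i u in speed v (born v \<omega>) \<omega> * V v (duration v (born v \<omega>) \<omega>) \<omega>)"
      unfolding Let_def edge_increment_def truncated_edge(3)[OF \<omega> that(1)] speed_def clock_gain_def
      unfolding clock
      using b by (cases "duration (take i u) (born (take i u) \<omega>) \<omega> = 0") (auto simp: algebra_simps)
  qed
  have scale: "boltzmann (b * \<sigma>) (b * \<tau>) x (correlated \<rho> x z) = boltzmann \<sigma> \<tau> (b * x) (correlated \<rho> (b * x) (b * z))" for x z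
    by (simp add: boltzmann_def correlated_def algebra_simps)
  have "exp (- complex_of_real t * growth_rate \<rho> (b * \<sigma>) (b * \<tau>)) = exp (- of_real t - drift * of_real (\<Lambda> t))"
    by (simp add: clock growth_rate_def power2_eq_square algebra_simps diff_divide_distrib)
  then show ?thesis
    unfolding additive_martingale_def normalized_sum_def alive_eq
    by (intro sum.cong) (simp_all add: leaf_eq_boltzmann[OF \<omega>] pos[OF _ motion_x] pos[OF _ motion_z] scale
      Let_def x_step_def z_step_def)
qed

end

lemma crem_clock_tendsto:
  assumes A: "(A has_real_derivative D) (at 0 within {0..1})" "A 0 = 0"
    and T: "filterlim T at_top sequentially" and s: "0 \<le> s"
  shows "(\<lambda>k. crem_clock A (T k) s) \<longlonglongrightarrow> D * s"
proof (cases "s = 0")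
  case True
  then show ?thesis using A by (simp add: crem_clock_def)
next
  case False
  then have s: "0 < s" using assms by simp
  have "((\<lambda>x. (A x - A 0) / (x - 0)) \<longlongrightarrow> D) (at 0 within {0..1})"
    using A(1) by (simp add: has_field_derivative_iff)
  then have quot: "((\<lambda>x. A x / x) \<longlongrightarrow> D) (at 0 within {0..1})" using A(2) by simp
  have late: "\<forall>\<^sub>F k in sequentially. s \<le> T k" using T by (simp add: filterlim_at_top)
  have "(\<lambda>k. s / T k) \<longlonglongrightarrow> 0"
    by (rule real_tendsto_divide_at_top[OF tendsto_const T])
  moreover have "\<forall>\<^sub>F k in sequentially. s / T k \<in> {0..1} \<and> s / T k \<noteq> 0"
    using late by (rule eventually_mono) (use s in \<open>auto simp: field_simps\<close>)
  ultimately have "filterlim (\<lambda>k. s / T k) (at 0 within {0..1}) sequentially"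
    unfolding filterlim_at by simp
  with quot have "(\<lambda>k. A (s / T k) / (s / T k)) \<longlonglongrightarrow> D" by (rule filterlim_compose)
  then have "(\<lambda>k. A (s / T k) / (s / T k) * s) \<longlonglongrightarrow> D * s" by (intro tendsto_mult tendsto_const)
  moreover have "\<forall>\<^sub>F k in sequentially. A (s / T k) / (s / T k) * s = crem_clock A (T k) s"
    using late
  proof (rule eventually_mono)
    fix k assume "s \<le> T k"
    then show "A (s / T k) / (s / T k) * s = crem_clock A (T k) s"
      using s by (simp add: crem_clock_def max_def min_def)
  qed
  ultimately show ?thesis by (rule Lim_transform_eventually)
qed

lemma crem_clock_mono:
  assumes "mono_on {0..1} A" "0 \<le> t"
  shows "mono (crem_clock A t)"
  unfolding crem_clock_def using assms
  by (intro monoI mult_left_mono mono_onD[OF assms(1)] max.mono min.mono divide_right_mono) auto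

lemma crem_clock_le:
  assumes "\<And>x. 0 \<le> x \<Longrightarrow> x \<le> 1 \<Longrightarrow> A x \<le> x" "0 < t" "0 \<le> s" "s \<le> t"
  shows "crem_clock A t s \<le> s"
proof -
  have "t * A (s / t) \<le> t * (s / t)" using assms by (intro mult_left_mono assms(1)) auto
  then show ?thesis using assms by (simp add: crem_clock_def max_def min_def)
qed

lemma derivative_at_0_le_1:
  assumes A: "(A has_real_derivative D) (at 0 within {0..1})" "A 0 = 0"
    and le: "\<And>x. 0 \<le> x \<Longrightarrow> x \<le> 1 \<Longrightarrow> A x \<le> x"
  shows "D \<le> 1"
proof (rule tendsto_upperbound)
  show "((\<lambda>x. A x / x) \<longlongrightarrow> D) (at 0 within {0..1})"
    using A by (simp add: has_field_derivative_iff)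
  show "\<forall>\<^sub>F x in at 0 within {0..1}. A x / x \<le> 1"
    unfolding eventually_at_filter using le by (intro always_eventually) (auto simp: divide_le_eq)
  show "at 0 within {0..1} \<noteq> (bot :: real filter)"
    by (simp add: trivial_limit_within islimpt_Icc)
qed


section \<open>Early generations\<close>

context branching_model
begin

context
  fixes \<rho> \<sigma> \<tau> v :: real
begin

text \<open>
  The edge factor for the clock \<open>s \<mapsto> v s\<close> without truncation at a horizon.
\<close>

definition limit_factor :: "label \<Rightarrow> 'a \<Rightarrow> complex" where
  "limit_factor u \<omega> = exp (- of_real (L u \<omega>) - (growth_rate \<rho> \<sigma> \<tau> - 1) * of_real (v * L u \<omega>)) *
     (exp ((of_real \<sigma> + \<i> * of_real (\<tau> * \<rho>)) * of_real (sqrt v * W u (L u \<omega>) \<omega>)) *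
      exp (\<i> * of_real (\<tau> * sqrt (1 - \<rho>\<^sup>2)) * of_real (sqrt v * W' u (L u \<omega>) \<omega>)))"

definition limit_sum :: "nat \<Rightarrow> 'a \<Rightarrow> complex" where
  "limit_sum n \<omega> = 1 + (\<Sum>u | in_tree (\<lambda>v. N v \<omega>) u \<and> length u < n.
     (\<Prod>i<length u. limit_factor (take i u) \<omega>) * (of_nat (N u \<omega>) * limit_factor u \<omega> - 1))"

text \<open>
  The limit depends on the clocks only through \<open>v\<close>, so it is the same for the CREM and for branching
  Brownian motion.
\<close>

lemma early_sum_tendsto:
  assumes tree: "\<And>k. weighted_tree M p L N W W' (\<Lambda> k) (T k) \<rho> \<sigma> \<tau> \<alpha>"
    and T: "filterlim T at_top sequentially"
    and \<Lambda>: "\<And>s. 0 \<le> s \<Longrightarrow> (\<lambda>k. \<Lambda> k s) \<longlonglongrightarrow> v * s"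
    and \<omega>: "\<omega> \<in> space M"
  shows "(\<lambda>k. weighted_tree.early_sum L N W W' (\<Lambda> k) (T k) \<rho> \<sigma> \<tau> n \<omega>) \<longlonglongrightarrow> limit_sum n \<omega>"
proof -
  note pos = lifetime_positive[OF \<omega>]
  let ?born = "\<lambda>u. birth (\<lambda>v. L v \<omega>) u"
  let ?edge_factor = "\<lambda>k. weighted_tree.edge_factor L W W' (\<Lambda> k) (T k) \<rho> \<sigma> \<tau>"
  let ?inc = "\<lambda>k u. weighted_tree.increment L N W W' (\<Lambda> k) (T k) \<rho> \<sigma> \<tau> u \<omega>"
  let ?tree = "in_tree (\<lambda>v. N v \<omega>)"
  \<comment> \<open>Every particle of a fixed realization eventually dies before the horizon.\<close>
  have late: "\<forall>\<^sub>F k in sequentially. s \<le> T k" for s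
    using T by (simp add: filterlim_at_top)
  have duration: "\<forall>\<^sub>F k in sequentially. weighted_tree.duration L (T k) u a \<omega> = L u \<omega>" for u a
    using late[of "a + L u \<omega>"]
    by (rule eventually_mono) (auto intro: weighted_tree.duration_eq_lifetime[OF tree \<omega>])
  have edge_factor: "(\<lambda>k. ?edge_factor k u a \<omega>) \<longlonglongrightarrow> limit_factor u \<omega>" if a: "0 \<le> a" for u a
  proof -
    let ?g = "\<lambda>k. \<Lambda> k (a + L u \<omega>) - \<Lambda> k a"
    let ?s = "\<lambda>k. sqrt (?g k / L u \<omega>)"
    have g: "?g \<longlonglongrightarrow> v * L u \<omega>"
      using tendsto_diff[OF \<Lambda>[of "a + L u \<omega>"] \<Lambda>[OF a]] a pos[of u] by (simp add: algebra_simps)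
    have "?s \<longlonglongrightarrow> sqrt (v * L u \<omega> / L u \<omega>)"
      using pos[of u] by (intro tendsto_real_sqrt tendsto_divide g tendsto_const) auto
    then have s: "?s \<longlonglongrightarrow> sqrt v" using pos[of u] by simp
    have "(\<lambda>k. exp (- of_real (L u \<omega>) - (growth_rate \<rho> \<sigma> \<tau> - 1) * of_real (?g k)) *
       (exp ((of_real \<sigma> + \<i> * of_real (\<tau> * \<rho>)) * of_real (?s k * W u (L u \<omega>) \<omega>)) *
        exp (\<i> * of_real (\<tau> * sqrt (1 - \<rho>\<^sup>2)) * of_real (?s k * W' u (L u \<omega>) \<omega>)))) \<longlonglongrightarrow> limit_factor u \<omega>"
      unfolding limit_factor_def by (intro tendsto_intros g s)
    moreover have "\<forall>\<^sub>F k in sequentially. exp (- of_real (L u \<omega>) - (growth_rate \<rho> \<sigma> \<tau> - 1) * of_real (?g k)) *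
       (exp ((of_real \<sigma> + \<i> * of_real (\<tau> * \<rho>)) * of_real (?s k * W u (L u \<omega>) \<omega>)) *
        exp (\<i> * of_real (\<tau> * sqrt (1 - \<rho>\<^sup>2)) * of_real (?s k * W' u (L u \<omega>) \<omega>))) = ?edge_factor k u a \<omega>"
      using duration[of u a]
      by (rule eventually_mono)
        (simp add: weighted_tree.edge_factor_def[OF tree] weighted_tree.clock_gain_def[OF tree] weighted_tree.speed_def[OF tree] boltzmann_correlated)
    ultimately show ?thesis by (rule Lim_transform_eventually)
  qed
  have nonneg: "0 \<le> ?born u" for u
    by (rule weighted_tree.born_nonneg[OF tree \<omega>])
  have inc: "(\<lambda>k. ?inc k u) \<longlonglongrightarrow> (\<Prod>i<length u. limit_factor (take i u) \<omega>) * (of_nat (N u \<omega>) * limit_factor u \<omega> - 1)"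
    if "?tree u" for u
  proof -
    have "(\<lambda>k. (\<Prod>i<length u. ?edge_factor k (take i u) (?born (take i u)) \<omega>) * (of_nat (N u \<omega>) * ?edge_factor k u (?born u) \<omega> - 1))
        \<longlonglongrightarrow> (\<Prod>i<length u. limit_factor (take i u) \<omega>) * (of_nat (N u \<omega>) * limit_factor u \<omega> - 1)"
      by (intro tendsto_intros edge_factor nonneg)
    moreover have "\<forall>\<^sub>F k in sequentially.
        (\<Prod>i<length u. ?edge_factor k (take i u) (?born (take i u)) \<omega>) * (of_nat (N u \<omega>) * ?edge_factor k u (?born u) \<omega> - 1) = ?inc k u"
      using late[of "?born u + L u \<omega>"]
    proof (rule eventually_mono)
      fix k assume k: "?born u + L u \<omega> \<le> T k"
      then have "weighted_tree.present L N (T k) u \<omega>"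
        using that pos[of u] by (simp add: weighted_tree.present_def[OF tree])
      then show "(\<Prod>i<length u. ?edge_factor k (take i u) (?born (take i u)) \<omega>) * (of_nat (N u \<omega>) * ?edge_factor k u (?born u) \<omega> - 1) = ?inc k u"
        using k by (simp add: weighted_tree.increment_def[OF tree] weighted_tree.line_weight_def[OF tree] weighted_tree.offspring_factor_def[OF tree])
    qed
    ultimately show ?thesis by (rule Lim_transform_eventually)
  qed
  have "weighted_tree.early_sum L N W W' (\<Lambda> k) (T k) \<rho> \<sigma> \<tau> n \<omega> = 1 + (\<Sum>u | ?tree u \<and> length u < n. ?inc k u)" for k
  proof -
    have "(\<Sum>u | weighted_tree.present L N (T k) u \<omega> \<and> length u < n. ?inc k u) = (\<Sum>u | ?tree u \<and> length u < n. ?inc k u)"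
      by (rule sum.mono_neutral_left[OF finite_in_tree_generations])
        (auto simp: weighted_tree.present_def[OF tree] weighted_tree.increment_def[OF tree])
    then show ?thesis by (simp add: weighted_tree.early_sum_def[OF tree])
  qed
  then show ?thesis unfolding limit_sum_def
    by (simp only:) (intro tendsto_intros, auto intro: inc)
qed

end

end


section \<open>Convergence of the partition function\<close>

theorem theorem1p3:
  fixes M :: "'a measure"
    and p :: "nat pmf"
    and L :: "label \<Rightarrow> 'a \<Rightarrow> real"
    and N :: "label \<Rightarrow> 'a \<Rightarrow> nat"
    and W W' :: "label \<Rightarrow> real \<Rightarrow> 'a \<Rightarrow> real"
    and A :: "real \<Rightarrow> real"
    and \<sigma>\<^sub>b \<rho> \<sigma> \<tau> :: real
    and Mhat :: "'a \<Rightarrow> complex"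
  assumes "offspring_law p"
    and "branching_model M p L N W W'"
    and "weak_correlation A \<sigma>\<^sub>b"
    and "\<rho> \<in> {-1..1}"
    and "Complex \<sigma> \<tau> \<in> B1"
    and "Mhat \<in> borel_measurable M"
    and "AE \<omega> in M. ((\<lambda>r. additive_martingale (\<lambda>u. L u \<omega>) (\<lambda>u. N u \<omega>)
                              (\<lambda>u s. W u s \<omega>) (\<lambda>u s. W' u s \<omega>) \<rho> (\<sigma>\<^sub>b * \<sigma>) (\<sigma>\<^sub>b * \<tau>) r)
                       \<longlongrightarrow> Mhat \<omega>) at_top"
  shows "converges_in_probability M
           (\<lambda>t \<omega>. exp (- complex_of_real t * growth_rate \<rho> \<sigma> \<tau>) *
                   partition_function A (\<lambda>u. L u \<omega>) (\<lambda>u. N u \<omega>)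
                     (\<lambda>u s. W u s \<omega>) (\<lambda>u s. W' u s \<omega>) \<rho> \<sigma> \<tau> t)
           Mhat at_top"
proof -
  interpret branching_model M p L N W W' by fact
  obtain \<alpha> where \<alpha>: "1 < \<alpha>" "\<alpha> \<le> 2" "moment_cost \<sigma> \<tau> \<alpha> < \<alpha> - 1"
    using B1_subcritical_moment[OF assms(5)] by blast
  have A: "mono_on {0..1} A" "A 0 = 0" "A 1 = 1" "\<And>x. 0 < x \<Longrightarrow> x < 1 \<Longrightarrow> A x < x" "0 \<le> \<sigma>\<^sub>b"
    and dA: "(A has_real_derivative \<sigma>\<^sub>b\<^sup>2) (at 0 within {0..1})"
    using assms(3) by (auto simp: weak_correlation_def sandwiched_def)
  have Ale: "A x \<le> x" if "0 \<le> x" "x \<le> 1" for x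
    using A(2,3) A(4)[of x] that by (cases "x = 0 \<or> x = 1") auto
  have b1: "\<sigma>\<^sub>b\<^sup>2 \<le> 1" by (rule derivative_at_0_le_1[OF dA A(2) Ale])
  have crem: "weighted_tree M p L N W W' (crem_clock A t) t \<rho> \<sigma> \<tau> \<alpha>" if "0 < t" for t
    using assms(1,4) \<alpha> that A crem_clock_mono[OF A(1), of t] crem_clock_le[OF Ale that]
    by unfold_locales (auto simp: crem_clock_def)
  have bbm: "weighted_tree M p L N W W' (\<lambda>s. \<sigma>\<^sub>b\<^sup>2 * s) t \<rho> \<sigma> \<tau> \<alpha>" if "0 < t" for t
    using assms(1,4) \<alpha> that b1 by unfold_locales (auto simp: mono_def mult_left_mono mult_left_le_one_le)
  let ?X = "\<lambda>t \<omega>. exp (- complex_of_real t * growth_rate \<rho> \<sigma> \<tau>) *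
     partition_function A (\<lambda>u. L u \<omega>) (\<lambda>u. N u \<omega>) (\<lambda>u s. W u s \<omega>) (\<lambda>u s. W' u s \<omega>) \<rho> \<sigma> \<tau> t"
  let ?M = "\<lambda>t \<omega>. additive_martingale (\<lambda>u. L u \<omega>) (\<lambda>u. N u \<omega>) (\<lambda>u s. W u s \<omega>) (\<lambda>u s. W' u s \<omega>) \<rho> (\<sigma>\<^sub>b * \<sigma>) (\<sigma>\<^sub>b * \<tau>) t"
  let ?Z = "\<lambda>\<Lambda> t. weighted_tree.normalized_sum L N W W' \<Lambda> t \<rho> \<sigma> \<tau>"
  let ?h = "\<lambda>\<Lambda> t. weighted_tree.early_sum L N W W' \<Lambda> t \<rho> \<sigma> \<tau>"
  let ?lin = "\<lambda>s. \<sigma>\<^sub>b\<^sup>2 * s"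
  have XZ: "?X t \<omega> = ?Z (crem_clock A t) t \<omega>" if "0 < t" "\<omega> \<in> space M" for t \<omega>
    using weighted_tree.normalized_sum_eq_crem[OF crem[OF that(1)] that(2,1) refl A(3)] .
  have MZ: "?M t \<omega> = ?Z ?lin t \<omega>" if "0 < t" "\<omega> \<in> space M" for t \<omega>
    using weighted_tree.normalized_sum_eq_bbm[OF bbm[OF that(1)] that(2) refl A(5)] .
  note Mhat[measurable] = assms(6)
  have X_meas: "?X t \<in> borel_measurable M" if "0 < t" for t
    using weighted_tree.normalized_sum_measurable[OF crem[OF that]] XZ[OF that] by (subst measurable_cong) auto
  define C where "C = weighted_tree.tail_const p \<sigma> \<tau> \<alpha>"
  define q where "q = weighted_tree.generation_ratio \<sigma> \<tau> \<alpha>"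
  have q: "0 \<le> q" "q < 1"
    using weighted_tree.generation_ratio_bounds[OF bbm[of 1]] by (auto simp: q_def)
  have lim: "(\<lambda>k. prob {\<omega> \<in> space M. \<epsilon> < dist (?X (T k) \<omega>) (Mhat \<omega>)}) \<longlonglongrightarrow> 0"
    if \<epsilon>: "0 < \<epsilon>" and T: "filterlim T at_top sequentially" and Tpos: "\<And>k. 0 < T k"
    for \<epsilon> and T :: "nat \<Rightarrow> real"
  proof -
    \<comment> \<open>\<open>Z\<close> and \<open>B\<close> are the CREM sum and the martingale at time \<open>T k\<close>; \<open>hZ n\<close> and \<open>hB n\<close> keep only the
      increments of the generations below \<open>n\<close>.\<close>
    define Z B hZ hB where "Z k = ?Z (crem_clock A (T k)) (T k)" and "B k = ?Z ?lin (T k)"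
      and "hZ n k = ?h (crem_clock A (T k)) (T k) n" and "hB n k = ?h ?lin (T k) n" for k n
    have [measurable]: "Z k \<in> borel_measurable M" "B k \<in> borel_measurable M"
      "hZ n k \<in> borel_measurable M" "hB n k \<in> borel_measurable M" for k n
      unfolding Z_def B_def hZ_def hB_def
      using weighted_tree.normalized_sum_measurable[OF crem[OF Tpos]] weighted_tree.normalized_sum_measurable[OF bbm[OF Tpos]]
        weighted_tree.early_sum_measurable[OF crem[OF Tpos]] weighted_tree.early_sum_measurable[OF bbm[OF Tpos]]
      by auto
    let ?p = "\<lambda>Y. prob {\<omega> \<in> space M. \<epsilon> / 4 < cmod (Y \<omega>)}"
    have mid: "(\<lambda>k. ?p (\<lambda>\<omega>. hZ n k \<omega> - hB n k \<omega>)) \<longlonglongrightarrow> 0" for n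
    proof (rule AE_tendsto_imp_prob_tendsto)
      show "AE \<omega> in M. (\<lambda>k. hZ n k \<omega> - hB n k \<omega>) \<longlonglongrightarrow> 0"
      proof (rule AE_I2)
        fix \<omega> assume \<omega>: "\<omega> \<in> space M"
        have "(\<lambda>k. hZ n k \<omega> - hB n k \<omega>) \<longlonglongrightarrow> limit_sum \<rho> \<sigma> \<tau> (\<sigma>\<^sub>b\<^sup>2) n \<omega> - limit_sum \<rho> \<sigma> \<tau> (\<sigma>\<^sub>b\<^sup>2) n \<omega>"
          unfolding hZ_def hB_def
          by (intro tendsto_diff early_sum_tendsto[OF crem[OF Tpos] T crem_clock_tendsto[OF dA A(2) T] \<omega>]
            early_sum_tendsto[OF bbm[OF Tpos] T _ \<omega>] tendsto_const)
        then show "(\<lambda>k. hZ n k \<omega> - hB n k \<omega>) \<longlonglongrightarrow> 0" by simp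
      qed
    qed (use \<epsilon> in auto)
    have mart: "(\<lambda>k. ?p (\<lambda>\<omega>. B k \<omega> - Mhat \<omega>)) \<longlonglongrightarrow> 0"
    proof (rule AE_tendsto_imp_prob_tendsto)
      show "AE \<omega> in M. (\<lambda>k. B k \<omega> - Mhat \<omega>) \<longlonglongrightarrow> 0"
        using assms(7)
      proof (rule AE_mp, intro AE_I2 impI)
        fix \<omega> assume \<omega>: "\<omega> \<in> space M" and l: "((\<lambda>r. ?M r \<omega>) \<longlongrightarrow> Mhat \<omega>) at_top"
        have "(\<lambda>k. B k \<omega>) \<longlonglongrightarrow> Mhat \<omega>"
          using filterlim_compose[OF l T] MZ[OF Tpos \<omega>] by (simp add: B_def)
        then show "(\<lambda>k. B k \<omega> - Mhat \<omega>) \<longlonglongrightarrow> 0" by (simp add: LIM_zero)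
      qed
    qed (use \<epsilon> in auto)
    have tailZ: "?p (\<lambda>\<omega>. Z k \<omega> - hZ n k \<omega>) \<le> C * q ^ n / (\<epsilon> / 4) powr \<alpha>" for k n
      unfolding Z_def hZ_def C_def q_def
      using \<epsilon> by (intro weighted_tree.tail_probability[OF crem[OF Tpos]]) simp
    have tailB: "?p (\<lambda>\<omega>. B k \<omega> - hB n k \<omega>) \<le> C * q ^ n / (\<epsilon> / 4) powr \<alpha>" for k n
      unfolding B_def hB_def C_def q_def
      using \<epsilon> by (intro weighted_tree.tail_probability[OF bbm[OF Tpos]]) simp
    have split: "prob {\<omega> \<in> space M. \<epsilon> < dist (?X (T k) \<omega>) (Mhat \<omega>)} \<le>
        2 * (C * q ^ n / (\<epsilon> / 4) powr \<alpha>) + (?p (\<lambda>\<omega>. hZ n k \<omega> - hB n k \<omega>) + ?p (\<lambda>\<omega>. B k \<omega> - Mhat \<omega>))" for k n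
    proof -
      let ?S = "\<lambda>Y. {\<omega> \<in> space M. \<epsilon> / 4 < cmod (Y \<omega>)}"
      have "{\<omega> \<in> space M. \<epsilon> < dist (?X (T k) \<omega>) (Mhat \<omega>)} \<subseteq>
        (?S (\<lambda>\<omega>. Z k \<omega> - hZ n k \<omega>) \<union> ?S (\<lambda>\<omega>. B k \<omega> - hB n k \<omega>)) \<union>
        (?S (\<lambda>\<omega>. hZ n k \<omega> - hB n k \<omega>) \<union> ?S (\<lambda>\<omega>. B k \<omega> - Mhat \<omega>))"
      proof
        fix \<omega> assume "\<omega> \<in> {\<omega> \<in> space M. \<epsilon> < dist (?X (T k) \<omega>) (Mhat \<omega>)}"
        then have \<omega>: "\<omega> \<in> space M" and "\<epsilon> < cmod (Z k \<omega> - Mhat \<omega>)"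
          using XZ[OF Tpos] by (auto simp: Z_def dist_norm)
        moreover have "cmod (Z k \<omega> - Mhat \<omega>) \<le> (cmod (Z k \<omega> - hZ n k \<omega>) + cmod (hZ n k \<omega> - hB n k \<omega>))
            + (cmod (hB n k \<omega> - B k \<omega>) + cmod (B k \<omega> - Mhat \<omega>))"
        proof -
          have "Z k \<omega> - Mhat \<omega> = ((Z k \<omega> - hZ n k \<omega>) + (hZ n k \<omega> - hB n k \<omega>)) + ((hB n k \<omega> - B k \<omega>) + (B k \<omega> - Mhat \<omega>))"
            by simp
          then show ?thesis by (metis norm_triangle_mono norm_triangle_ineq)
        qed
        ultimately show "\<omega> \<in> (?S (\<lambda>\<omega>. Z k \<omega> - hZ n k \<omega>) \<union> ?S (\<lambda>\<omega>. B k \<omega> - hB n k \<omega>)) \<union>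
          (?S (\<lambda>\<omega>. hZ n k \<omega> - hB n k \<omega>) \<union> ?S (\<lambda>\<omega>. B k \<omega> - Mhat \<omega>))"
          by (auto simp: norm_minus_commute[of "hB n k \<omega>"])
      qed
      then have "prob {\<omega> \<in> space M. \<epsilon> < dist (?X (T k) \<omega>) (Mhat \<omega>)} \<le>
          prob ((?S (\<lambda>\<omega>. Z k \<omega> - hZ n k \<omega>) \<union> ?S (\<lambda>\<omega>. B k \<omega> - hB n k \<omega>)) \<union>
        (?S (\<lambda>\<omega>. hZ n k \<omega> - hB n k \<omega>) \<union> ?S (\<lambda>\<omega>. B k \<omega> - Mhat \<omega>)))"
        by (intro finite_measure_mono) measurable
      also have "\<dots> \<le> (?p (\<lambda>\<omega>. Z k \<omega> - hZ n k \<omega>) + ?p (\<lambda>\<omega>. B k \<omega> - hB n k \<omega>)) +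
          (?p (\<lambda>\<omega>. hZ n k \<omega> - hB n k \<omega>) + ?p (\<lambda>\<omega>. B k \<omega> - Mhat \<omega>))"
        by (intro order_trans[OF measure_Un_le] add_mono measure_Un_le) measurable
      finally show ?thesis using tailZ[of k n] tailB[of k n] by linarith
    qed
    \<comment> \<open>First \<open>n\<close> is chosen for the late generations, uniformly in \<open>k\<close>; then \<open>k\<close> tends to infinity.\<close>
    show ?thesis
    proof (rule order_tendstoI)
      fix \<delta> :: real assume "0 < \<delta>"
      have "(\<lambda>n. 2 * (C * q ^ n / (\<epsilon> / 4) powr \<alpha>)) \<longlonglongrightarrow> 2 * (C * 0 / (\<epsilon> / 4) powr \<alpha>)"
        using q \<epsilon> by (intro tendsto_intros LIMSEQ_realpow_zero) auto
      then have "\<forall>\<^sub>F n in sequentially. 2 * (C * q ^ n / (\<epsilon> / 4) powr \<alpha>) < \<delta> / 2"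
        using \<open>0 < \<delta>\<close> by (intro order_tendstoD) auto
      then obtain n where n: "2 * (C * q ^ n / (\<epsilon> / 4) powr \<alpha>) < \<delta> / 2"
        by (auto simp: eventually_sequentially)
      have "(\<lambda>k. ?p (\<lambda>\<omega>. hZ n k \<omega> - hB n k \<omega>) + ?p (\<lambda>\<omega>. B k \<omega> - Mhat \<omega>)) \<longlonglongrightarrow> 0 + 0"
        by (intro tendsto_add mid mart)
      then have "\<forall>\<^sub>F k in sequentially. ?p (\<lambda>\<omega>. hZ n k \<omega> - hB n k \<omega>) + ?p (\<lambda>\<omega>. B k \<omega> - Mhat \<omega>) < \<delta> / 2"
        using \<open>0 < \<delta>\<close> by (intro order_tendstoD) auto
      then show "\<forall>\<^sub>F k in sequentially. prob {\<omega> \<in> space M. \<epsilon> < dist (?X (T k) \<omega>) (Mhat \<omega>)} < \<delta>"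
      proof (rule eventually_mono)
        fix k assume "?p (\<lambda>\<omega>. hZ n k \<omega> - hB n k \<omega>) + ?p (\<lambda>\<omega>. B k \<omega> - Mhat \<omega>) < \<delta> / 2"
        then show "prob {\<omega> \<in> space M. \<epsilon> < dist (?X (T k) \<omega>) (Mhat \<omega>)} < \<delta>"
          using split[of k n] n by linarith
      qed
    qed (auto intro!: always_eventually intro: less_le_trans)
  qed
  show ?thesis
    unfolding converges_in_probability_def
  proof (intro conjI allI impI)
    show "\<forall>\<^sub>F t in at_top. ?X t \<in> borel_measurable M"
      using eventually_gt_at_top[of 0] by (rule eventually_mono) (rule X_meas)
    show "Mhat \<in> borel_measurable M" by (rule Mhat)
    fix \<epsilon> :: real assume \<epsilon>: "0 < \<epsilon>"
    show "((\<lambda>t. prob {\<omega> \<in> space M. \<epsilon> < dist (?X t \<omega>) (Mhat \<omega>)}) \<longlongrightarrow> 0) at_top"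
    proof (rule tendsto_at_topI_sequentially)
      fix S :: "nat \<Rightarrow> real" assume S: "filterlim S at_top sequentially"
      have late: "\<forall>\<^sub>F k in sequentially. 1 \<le> S k" using S by (simp add: filterlim_at_top)
      \<comment> \<open>Cutting off at 1 changes finitely many horizons only and makes them all positive.\<close>
      have "filterlim (\<lambda>k. max 1 (S k)) at_top sequentially"
        by (rule filterlim_at_top_mono[OF S]) simp
      then have "(\<lambda>k. prob {\<omega> \<in> space M. \<epsilon> < dist (?X (max 1 (S k)) \<omega>) (Mhat \<omega>)}) \<longlonglongrightarrow> 0"
        by (rule lim[OF \<epsilon>]) (simp add: less_max_iff_disj)
      moreover have "\<forall>\<^sub>F k in sequentially. prob {\<omega> \<in> space M. \<epsilon> < dist (?X (max 1 (S k)) \<omega>) (Mhat \<omega>)} =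
          prob {\<omega> \<in> space M. \<epsilon> < dist (?X (S k) \<omega>) (Mhat \<omega>)}"
        using late by (rule eventually_mono) (simp add: max_absorb2)
      ultimately show "(\<lambda>k. prob {\<omega> \<in> space M. \<epsilon> < dist (?X (S k) \<omega>) (Mhat \<omega>)}) \<longlonglongrightarrow> 0"
        by (rule Lim_transform_eventually)
    qed
  qed
qed

end
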